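(* For all partitions $\lambda_1,\lambda_2,\mu_1,\mu_2$, the product of Remmel–Whitney basis elements expands in the Remmel–Whitney basis as \[ w_{\lambda_1,\lambda_2}\, w_{\mu_1,\mu_2}=\sum_{\gamma_1,\gamma_2} c^{\gamma_1}_{\lambda_1\mu_1}\, c^{\gamma_2}_{\lambda_2\mu_2}\, w_{\gamma_1,\gamma_2}, \] the sum running over all pairs of partitions $(\gamma_1,\gamma_2)$. That is, the structure constants of the Remmel–Whitney basis coincide with those of the basis $\{s_{\alpha_1,\alpha_2}\}$.
   Context: Partitions are identified with Young diagrams in English notation (rows numbered $1,2,\dots$ from top to bottom, columns from left to right). For partitions $\beta\subseteq\alpha$, $\alpha/\beta$ is the skew shape; a standard tableau of shape $\alpha/\beta$ is a bijective filling of its boxes by $1,\dots,|\alpha|-|\beta|$ increasing along rows and down columns. $c^{\lambda}_{\mu\nu}$ denotes the Littlewood–Richardson coefficient (coefficient of $s_\lambda$ in $s_\mu s_\nu$). For a skew shape $\alpha/\beta$, the reverse lexicographic filling $\mathrm{rl}(\alpha/\beta)$ writes $1,\dots,|\alpha|-|\beta|$ into the boxes of $\alpha/\beta$ from right to left along each row, rows taken from top to bottom. For skew shapes $\gamma/\delta$, $\alpha/\beta$, the Remmel–Whitney set $\mathrm{RW}_{\gamma/\delta}(\alpha/\beta)$ is the set of standard tableaux $T$ of shape $\gamma/\delta$ such that: (i) whenever $i,i+1$ lie in the same row of $\mathrm{rl}(\alpha/\beta)$, the entry $i+1$ of $T$ lies strictly to the right of and weakly above the entry $i$; (ii) whenever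 $i$ lies directly above $j$ in the same column of $\mathrm{rl}(\alpha/\beta)$, the entry $j$ of $T$ lies strictly below and weakly to the left of the entry $i$. Let $\Lambda_1,\Lambda_2$ be the rings of symmetric functions in $x_1,x_2,\dots$ and $y_1,y_2,\dots$, and $s_{\alpha_1,\alpha_2}=s_{\alpha_1}(x)s_{\alpha_2}(y)\in\Lambda_1\otimes_{\mathbb Z}\Lambda_2$. The Remmel–Whitney quiver has as vertices all pairs of partitions; for distinct pairs $(\alpha_1,\alpha_2)\neq(\beta_1,\beta_2)$ with $\alpha_1\subseteq\beta_1$, $\beta_2\subseteq\alpha_2$ there is one arrow $a_T:(\alpha_1,\alpha_2)\to(\beta_1,\beta_2)$ for each $T\in\mathrm{RW}_{\beta_1/\alpha_1}(\alpha_2/\beta_2)$. Let $t(a)$ be the target of $a$ and $\mathrm{Arr}_{(\alpha_1,\alpha_2)}$ the set of arrows with source $(\alpha_1,\alpha_2)$. The Remmel–Whitney basis is defined recursively on $|\alpha_2|$ (arrows strictly decrease the size of the second partition) by $w_{\alpha_1,\alpha_2}=s_{\alpha_1,\alpha_2}-\sum_{a\in\mathrm{Arr}_{(\alpha_1,\alpha_2)}} w_{t(a)}$. *)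

theory Defs
  imports "HOL-Library.Multiset"
begin

section \<open>Formal power series over the integers in arbitrarily many variables\<close>

text \<open>
  A monomial in variables indexed by the type \<open>'v\<close> is a finite multiset over \<open>'v\<close>; the
  multiplicity of \<open>v\<close> is its exponent. No bound on the degree is imposed, so the ring of
  symmetric functions in \<open>x\<^sub>1, x\<^sub>2, \<dots>\<close> is a subring of \<open>nat pser\<close>, and
  \<open>\<Lambda>\<^sub>1 \<otimes> \<Lambda>\<^sub>2\<close> embeds into \<open>(nat + nat) pser\<close> by \<open>f \<otimes> g \<mapsto> f(x) g(y)\<close>, where
  the variables \<open>x\<close> are the \<open>Inl i\<close> and the variables \<open>y\<close> are the \<open>Inr i\<close>.
\<close>

typedef 'v pser = "UNIV :: ('v multiset \<Rightarrow> int) set"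
  morphisms pcoeff Pser ..

setup_lifting type_definition_pser

lemma finite_splits: "finite {(A, B). A + B = (M :: 'v multiset)}"
proof -
  have fin: "finite {A. A \<subseteq># N}" for N :: "'v multiset"
  proof (induction N)
    case empty
    then show ?case by simp
  next
    case (add x N)
    have "{A. A \<subseteq># add_mset x N} \<subseteq> {A. A \<subseteq># N} \<union> add_mset x ` {A. A \<subseteq># N}"
    proof
      fix A assume "A \<in> {A. A \<subseteq># add_mset x N}"
      hence A: "A \<subseteq># add_mset x N" by simp
      show "A \<in> {A. A \<subseteq># N} \<union> add_mset x ` {A. A \<subseteq># N}"
      proof (cases "x \<in># A")
        case True
        then obtain B where "A = add_mset x B" by (meson multi_member_split)
        with A show ?thesis by auto
      next
        case False
        with A have "A \<subseteq># N"
          by (metis add_mset_remove_trivial diff_single_trivial subset_eq_diff_conv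
              add_mset_add_single)
        then show ?thesis by simp
      qed
    qed
    with add show ?case by (meson finite_UnI finite_imageI finite_subset)
  qed
  have "{(A, B). A + B = M} \<subseteq> (\<lambda>A. (A, M - A)) ` {A. A \<subseteq># M}"
    by (auto simp: image_iff)
  with fin show ?thesis by (meson finite_imageI finite_subset)
qed

instantiation pser :: (type) comm_ring_1
begin

lift_definition zero_pser :: "'a pser" is "\<lambda>_. 0" .
lift_definition one_pser :: "'a pser" is "\<lambda>M. if M = {#} then 1 else 0" .
lift_definition plus_pser :: "'a pser \<Rightarrow> 'a pser \<Rightarrow> 'a pser" is "\<lambda>f g M. f M + g M" .
lift_definition uminus_pser :: "'a pser \<Rightarrow> 'a pser" is "\<lambda>f M. - f M" .
lift_definition minus_pser :: "'a pser \<Rightarrow> 'a pser \<Rightarrow> 'a pser" is "\<lambda>f g M. f M - g M" .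
lift_definition times_pser :: "'a pser \<Rightarrow> 'a pser \<Rightarrow> 'a pser" is
  "\<lambda>f g M. \<Sum>(A, B) | A + B = M. f A * g B" .

instance
proof
  fix a b c :: "'a pser"
  show "a * b * c = a * (b * c)"
  proof (transfer, rule ext)
    fix f g h :: "'a multiset \<Rightarrow> int" and M :: "'a multiset"
    let ?D = "\<lambda>N :: 'a multiset. {(A, B). A + B = N}"
    have "(\<Sum>(A, B)\<in>?D M. (\<Sum>(A', B')\<in>?D A. f A' * g B') * h B) =
          (\<Sum>p\<in>?D M. \<Sum>q\<in>?D (fst p). f (fst q) * g (snd q) * h (snd p))"
      by (simp add: sum_distrib_right case_prod_unfold)
    also have "\<dots> = (\<Sum>z\<in>(SIGMA p:?D M. ?D (fst p)).
        f (fst (snd z)) * g (snd (snd z)) * h (snd (fst z)))"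
      by (subst sum.Sigma) (auto simp: finite_splits[unfolded case_prod_unfold] case_prod_unfold)
    also have "\<dots> = (\<Sum>z\<in>(SIGMA p:?D M. ?D (snd p)).
        f (fst (fst z)) * (g (fst (snd z)) * h (snd (snd z))))"
      by (rule sum.reindex_bij_witness
          [where j = "\<lambda>((A, B), (A', B')). ((A', B' + B), (B', B))"
             and i = "\<lambda>((A, B), (A', B')). ((A + A', B'), (A, A'))"])
        (auto simp: add.assoc mult.assoc)
    also have "\<dots> = (\<Sum>p\<in>?D M. \<Sum>q\<in>?D (snd p). f (fst p) * (g (fst q) * h (snd q)))"
      by (subst sum.Sigma) (auto simp: finite_splits[unfolded case_prod_unfold] case_prod_unfold)
    also have "\<dots> = (\<Sum>(A, B)\<in>?D M. f A * (\<Sum>(A', B')\<in>?D B. g A' * h B'))"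
      by (simp add: sum_distrib_left case_prod_unfold)
    finally show "(\<Sum>(A, B)\<in>?D M. (\<Sum>(A', B')\<in>?D A. f A' * g B') * h B) =
      (\<Sum>(A, B)\<in>?D M. f A * (\<Sum>(A', B')\<in>?D B. g A' * h B'))" .
  qed
  show "a * b = b * a"
    by (transfer, rule ext, rule sum.reindex_bij_witness[where i = prod.swap and j = prod.swap])
      (auto simp: add.commute mult.commute)
  show "1 * a = a"
  proof (transfer, rule ext)
    fix f :: "'a multiset \<Rightarrow> int" and M :: "'a multiset"
    have "(\<Sum>(A, B) | A + B = M. (if A = {#} then 1 else 0) * f B) =
          (\<Sum>(A, B)\<in>{({#} :: 'a multiset, M)}. (if A = {#} then 1 else 0) * f B)"
      by (rule sum.mono_neutral_right) (auto simp: finite_splits split: if_splits)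
    then show "(\<Sum>(A, B) | A + B = M. (if A = {#} then 1 else 0) * f B) = f M"
      by simp
  qed
  show "(a + b) * c = a * c + b * c"
    by (transfer, rule ext) (simp add: case_prod_unfold distrib_right sum.distrib)
  show "(0 :: 'a pser) \<noteq> 1"
    by transfer (metis zero_neq_one)
qed (transfer; simp add: fun_eq_iff)+

end

section \<open>Structure constants\<close>

text \<open>
  The coordinates of \<open>f\<close> with respect to the family \<open>b\<close>; meaningful when \<open>b\<close> is linearly
  independent over the integers and \<open>f\<close> lies in its span.
\<close>

definition coordinates :: "('i \<Rightarrow> 'v pser) \<Rightarrow> 'v pser \<Rightarrow> 'i \<Rightarrow> int" where
  "coordinates b f =
     (THE c. finite {i. c i \<noteq> 0} \<and> f = (\<Sum>i | c i \<noteq> 0. of_int (c i) * b i))"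

definition structure_const :: "('i \<Rightarrow> 'v pser) \<Rightarrow> 'i \<Rightarrow> 'i \<Rightarrow> 'i \<Rightarrow> int" where
  "structure_const b i j k = coordinates b (b i * b j) k"

section \<open>Partitions and Young diagrams\<close>

text \<open>Rows and columns are numbered from 0; \<open>part \<alpha> i\<close> is the length of row \<open>i\<close>.\<close>

typedef partition = "{p :: nat \<Rightarrow> nat. antimono p \<and> finite {i. p i \<noteq> 0}}"
  morphisms part Partition
proof
  show "(\<lambda>_. 0) \<in> {p :: nat \<Rightarrow> nat. antimono p \<and> finite {i. p i \<noteq> 0}}"
    by (simp add: antimono_def)
qed

type_synonym cell = "nat \<times> nat"
type_synonym filling = "cell \<Rightarrow> nat"

abbreviation row :: "cell \<Rightarrow> nat" where "row \<equiv> fst"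
abbreviation col :: "cell \<Rightarrow> nat" where "col \<equiv> snd"

definition diagram :: "partition \<Rightarrow> cell set" where
  "diagram \<alpha> = {(i, j). j < part \<alpha> i}"

text \<open>The skew shape \<open>\<alpha>/\<beta>\<close>, used only when \<open>diagram \<beta> \<subseteq> diagram \<alpha>\<close>.\<close>

definition skew :: "partition \<Rightarrow> partition \<Rightarrow> cell set" where
  "skew \<alpha> \<beta> = diagram \<alpha> - diagram \<beta>"

section \<open>Schur functions and Littlewood--Richardson coefficients\<close>

text \<open>Fillings of a shape are set to 0 outside the shape, so that equal tableaux are equal.\<close>

definition ssyt :: "partition \<Rightarrow> filling set" where
  "ssyt \<alpha> = {T. (\<forall>c. c \<notin> diagram \<alpha> \<longrightarrow> T c = 0) \<and>
     (\<forall>c\<in>diagram \<alpha>. \<forall>d\<in>diagram \<alpha>.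
        (row c = row d \<and> col c < col d \<longrightarrow> T c \<le> T d) \<and>
        (col c = col d \<and> row c < row d \<longrightarrow> T c < T d))}"

text \<open>
  The Schur function in the distinct variables \<open>x 0, x 1, \<dots>\<close>, as the generating function of
  semistandard tableaux by content; the entries are 0, 1, \<dots>.
\<close>

definition schur :: "(nat \<Rightarrow> 'v) \<Rightarrow> partition \<Rightarrow> 'v pser" where
  "schur x \<alpha> = Pser (\<lambda>M. int (card
     {T \<in> ssyt \<alpha>. image_mset (\<lambda>c. x (T c)) (mset_set (diagram \<alpha>)) = M}))"

text \<open>\<open>lr_coeff \<mu> \<nu> \<gamma>\<close> is the coefficient of \<open>s\<^sub>\<gamma>\<close> in \<open>s\<^sub>\<mu> s\<^sub>\<nu>\<close>.\<close>

definition lr_coeff :: "partition \<Rightarrow> partition \<Rightarrow> partition \<Rightarrow> int" where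
  "lr_coeff \<mu> \<nu> \<gamma> = structure_const (schur (\<lambda>i. i)) \<mu> \<nu> \<gamma>"

fun schur2 :: "partition \<times> partition \<Rightarrow> (nat + nat) pser" where
  "schur2 (\<alpha>1, \<alpha>2) = schur Inl \<alpha>1 * schur Inr \<alpha>2"

section \<open>Remmel--Whitney sets\<close>

definition standard_tableaux :: "cell set \<Rightarrow> filling set" where
  "standard_tableaux S = {T. (\<forall>c. c \<notin> S \<longrightarrow> T c = 0) \<and> bij_betw T S {1..card S} \<and>
     (\<forall>c\<in>S. \<forall>d\<in>S.
        (row c = row d \<and> col c < col d \<longrightarrow> T c < T d) \<and>
        (col c = col d \<and> row c < row d \<longrightarrow> T c < T d))}"

text \<open>
  The entry of a cell in the reverse lexicographic filling is its position in the reading order,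
  i.e. the number of cells read no later than it.
\<close>

definition rl :: "cell set \<Rightarrow> filling" where
  "rl S c = card {d \<in> S. row d < row c \<or> (row d = row c \<and> col d \<ge> col c)}"

text \<open>
  The shapes are required to have equally many cells: this is implicit in speaking of the entries
  of \<open>T\<close> corresponding to those of \<open>rl A\<close>, and is what makes every arrow of the quiver below
  decrease the size of the second partition.
\<close>

definition RW :: "cell set \<Rightarrow> cell set \<Rightarrow> filling set" where
  "RW G A = {T \<in> standard_tableaux G. card G = card A \<and>
     (\<forall>a\<in>A. \<forall>b\<in>A. \<forall>c\<in>G. \<forall>d\<in>G. T c = rl A a \<and> T d = rl A b \<longrightarrow>
        (row a = row b \<and> rl A b = Suc (rl A a) \<longrightarrow> col c < col d \<and> row d \<le> row c) \<and>
        (col a = col b \<and> row b = Suc (row a) \<longrightarrow> row c < row d \<and> col d \<le> col c))}"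

section \<open>The Remmel--Whitney quiver and basis\<close>

type_synonym vertex = "partition \<times> partition"

text \<open>An arrow is a triple of source, target and tableau.\<close>

type_synonym arrow = "vertex \<times> vertex \<times> filling"

definition arrows :: "arrow set" where
  "arrows = {((\<alpha>1, \<alpha>2), (\<beta>1, \<beta>2), T) | \<alpha>1 \<alpha>2 \<beta>1 \<beta>2 T.
     (\<alpha>1, \<alpha>2) \<noteq> (\<beta>1, \<beta>2) \<and> diagram \<alpha>1 \<subseteq> diagram \<beta>1 \<and> diagram \<beta>2 \<subseteq> diagram \<alpha>2 \<and>
     T \<in> RW (skew \<beta>1 \<alpha>1) (skew \<alpha>2 \<beta>2)}"

definition source :: "arrow \<Rightarrow> vertex" where "source a = fst a"

definition target :: "arrow \<Rightarrow> vertex" where "target a = fst (snd a)"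

definition Arr :: "vertex \<Rightarrow> arrow set" where
  "Arr v = {a \<in> arrows. source a = v}"

lemma antimono_part: "i \<le> j \<Longrightarrow> part \<alpha> j \<le> part \<alpha> i"
  using part[of \<alpha>] by (auto dest: antimonoD)

lemma finite_diagram: "finite (diagram \<alpha>)"
proof -
  have "diagram \<alpha> \<subseteq> {i. part \<alpha> i \<noteq> 0} \<times> {..<part \<alpha> 0}"
    using antimono_part[of 0 _ \<alpha>] by (auto simp: diagram_def intro: less_le_trans)
  moreover have "finite {i. part \<alpha> i \<noteq> 0}" using part[of \<alpha>] by simp
  ultimately show ?thesis by (meson finite_SigmaI finite_lessThan finite_subset)
qed

lemma inj_diagram: "inj diagram"
proof (rule injI)
  fix \<alpha> \<beta> assume eq: "diagram \<alpha> = diagram \<beta>"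
  have "j < part \<alpha> i \<longleftrightarrow> j < part \<beta> i" for i j
    using eq by (auto simp: diagram_def set_eq_iff)
  hence "part \<alpha> = part \<beta>"
    by (intro ext) (metis linorder_neqE_nat less_irrefl)
  thus "\<alpha> = \<beta>" by (simp add: part_inject)
qed

lemma arrow_facts:
  assumes "a \<in> Arr (\<alpha>1, \<alpha>2)"
  obtains \<beta>1 \<beta>2 T where "a = ((\<alpha>1, \<alpha>2), (\<beta>1, \<beta>2), T)"
    "diagram \<alpha>1 \<subseteq> diagram \<beta>1" "diagram \<beta>2 \<subseteq> diagram \<alpha>2"
    "T \<in> RW (skew \<beta>1 \<alpha>1) (skew \<alpha>2 \<beta>2)" "card (diagram \<beta>2) < card (diagram \<alpha>2)"
    "card (diagram \<beta>1) + card (diagram \<beta>2) = card (diagram \<alpha>1) + card (diagram \<alpha>2)"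
proof -
  from assms obtain \<beta>1 \<beta>2 T where a: "a = ((\<alpha>1, \<alpha>2), (\<beta>1, \<beta>2), T)"
    and ne: "(\<alpha>1, \<alpha>2) \<noteq> (\<beta>1, \<beta>2)"
    and sub: "diagram \<alpha>1 \<subseteq> diagram \<beta>1" "diagram \<beta>2 \<subseteq> diagram \<alpha>2"
    and T: "T \<in> RW (skew \<beta>1 \<alpha>1) (skew \<alpha>2 \<beta>2)"
    by (auto simp: Arr_def arrows_def source_def)
  have "card (skew \<beta>1 \<alpha>1) = card (skew \<alpha>2 \<beta>2)" using T by (simp add: RW_def)
  hence cards: "card (diagram \<beta>1) - card (diagram \<alpha>1) = card (diagram \<alpha>2) - card (diagram \<beta>2)"
    using sub by (simp add: skew_def card_Diff_subset finite_diagram)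
  have le: "card (diagram \<alpha>1) \<le> card (diagram \<beta>1)" "card (diagram \<beta>2) \<le> card (diagram \<alpha>2)"
    using sub by (simp_all add: card_mono finite_diagram)
  have less: "card (diagram \<beta>2) < card (diagram \<alpha>2)"
  proof (rule ccontr)
    assume "\<not> ?thesis"
    hence "card (diagram \<beta>2) = card (diagram \<alpha>2)" "card (diagram \<alpha>1) = card (diagram \<beta>1)"
      using le cards by auto
    hence "diagram \<beta>2 = diagram \<alpha>2" "diagram \<alpha>1 = diagram \<beta>1"
      using sub by (simp_all add: card_subset_eq finite_diagram)
    with ne show False using inj_diagram by (auto dest: injD)
  qed
  show thesis by (rule that[OF a sub T less]) (use le cards in auto)
qed

lemma finite_partitions_of_size: "finite {\<alpha>. card (diagram \<alpha>) = n}"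
proof -
  have "diagram ` {\<alpha>. card (diagram \<alpha>) = n} \<subseteq> Pow ({..<n} \<times> {..<n})"
  proof clarify
    fix \<alpha> i j assume n: "n = card (diagram \<alpha>)" and ij: "(i, j) \<in> diagram \<alpha>"
    have "(\<lambda>k. (k, 0)) ` {..i} \<subseteq> diagram \<alpha>" "(\<lambda>k. (i, k)) ` {..j} \<subseteq> diagram \<alpha>"
      using ij antimono_part[of _ i \<alpha>]
      by (auto simp: diagram_def) (metis gr_zeroI le_zero_eq less_nat_zero_code)
    from card_mono[OF finite_diagram this(1)] card_mono[OF finite_diagram this(2)]
    have "Suc i \<le> card (diagram \<alpha>)" "Suc j \<le> card (diagram \<alpha>)"
      by (simp_all add: card_image inj_on_def)
    thus "i \<in> {..<card (diagram \<alpha>)} \<and> j \<in> {..<card (diagram \<alpha>)}" by auto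
  qed
  hence "finite (diagram ` {\<alpha>. card (diagram \<alpha>) = n})"
    by (rule finite_subset) simp
  thus ?thesis using inj_diagram by (meson finite_imageD inj_on_subset subset_UNIV)
qed

lemma finite_RW:
  assumes "finite G"
  shows "finite (RW G A)"
proof (rule finite_subset)
  show "RW G A \<subseteq> {T. (\<forall>c. (c \<in> G \<longrightarrow> T c \<in> {1..card G}) \<and> (c \<notin> G \<longrightarrow> T c = 0))}"
    by (auto simp: RW_def standard_tableaux_def dest: bij_betwE)
  show "finite {T. (\<forall>c. (c \<in> G \<longrightarrow> T c \<in> {1..card G}) \<and> (c \<notin> G \<longrightarrow> T c = 0))}"
    using assms by (intro finite_set_of_finite_funs) auto
qed

lemma finite_Arr: "finite (Arr v)"
proof -
  obtain \<alpha>1 \<alpha>2 where v: "v = (\<alpha>1, \<alpha>2)" by (cases v)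
  define N where "N = card (diagram \<alpha>1) + card (diagram \<alpha>2)"
  define P where "P = {\<beta>. card (diagram \<beta>) \<le> N}"
  have "P = (\<Union>n\<le>N. {\<beta>. card (diagram \<beta>) = n})" by (auto simp: P_def)
  hence "finite P" by (simp add: finite_partitions_of_size)
  hence "finite (SIGMA s:{v}. SIGMA t:P \<times> P. RW (skew (fst t) \<alpha>1) (skew \<alpha>2 (snd t)))"
    by (intro finite_SigmaI finite_RW) (auto simp: skew_def finite_diagram)
  moreover have "Arr v \<subseteq> (SIGMA s:{v}. SIGMA t:P \<times> P. RW (skew (fst t) \<alpha>1) (skew \<alpha>2 (snd t)))"
    unfolding v by (auto elim!: arrow_facts simp: P_def N_def)
  ultimately show ?thesis by (rule rev_finite_subset)
qed

function rw_basis :: "vertex \<Rightarrow> (nat + nat) pser" where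
  "rw_basis v = schur2 v - (\<Sum>a\<in>Arr v. rw_basis (target a))"
  by auto
termination
proof (relation "measure (\<lambda>v. card (diagram (snd v)))")
  fix v a assume "a \<in> Arr v"
  then show "(target a, v) \<in> measure (\<lambda>v. card (diagram (snd v)))"
    by (cases v) (auto elim!: arrow_facts simp: target_def)
qed simp

declare rw_basis.simps [simp del]

end

theory Submission
  imports Defs "HOL-Library.Multiset_Order" "HOL-Combinatorics.Permutations"
begin

text \<open>
  The substitution \<open>f(x, y) \<mapsto> f(x; y, x)\<close> is a ring endomorphism of
  \<open>\<Lambda>\<^sub>1 \<otimes> \<Lambda>\<^sub>2\<close>. It sends
  \<open>s\<^sub>\<alpha>(x) s\<^sub>\<beta>(y)\<close> to
  \<open>\<Sum>\<^sub>\<delta> s\<^sub>\<alpha>(x) s\<^bsub>\<beta>/\<delta>\<^esub>(x) s\<^sub>\<delta>(y)\<close>, and by the Littlewood--Richardson rule in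
  the form of Remmel and Whitney the coefficient of \<open>s\<^sub>\<gamma>(x)\<close> in
  \<open>s\<^sub>\<alpha>(x) s\<^bsub>\<beta>/\<delta>\<^esub>(x)\<close> is the number of arrows from \<open>(\<alpha>, \<beta>)\<close> to
  \<open>(\<gamma>, \<delta>)\<close>. Hence the endomorphism maps each Remmel--Whitney basis element
  \<open>w\<^sub>v\<close> to the product of Schur functions \<open>s\<^sub>v\<close>; being injective on the span of the latter, it
  transports the structure constants.

  The Littlewood--Richardson rule is obtained by Stembridge's argument: after multiplication by an
  alternant, the tableaux that do not add partitions to partitions cancel in pairs under a partial
  Bender--Knuth involution. All of this takes place in finitely many variables.
\<close>


section \<open>Monomials and substitutions in power series\<close>

text \<open>The substitution merges infinite alphabets, so it is never formed on full power series:
  \<open>double_vars n\<close> keeps \<open>n\<close> variables x and \<open>2 * n\<close> variables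
  y, and identities are compared for all large \<open>n\<close>. In place of injectivity, a
  transport of relations is used. Since every \<open>w\<close> goes to its own \<open>s\<close>, a
  finite relation among the \<open>w\<close> becomes the same relation among the \<open>s\<close>,
  and independence of the \<open>s\<close> pins down its coefficients. That a product of
  \<open>w\<close> has some integral expansion at all is a separate fact, due to the recursion being
  triangular in both directions. Two reading orders meet. Stembridge's flip cuts a filling along a
  column, so its survivors satisfy a condition on final segments of columns, whereas Remmel--Whitney
  tableaux follow the row reading of \<open>rl\<close>. The two lattice conditions are shown
  equivalent for semistandard fillings before fillings are matched with tableaux. Alternants are
  cancelled in variables indexed by \<open>nat\<close>, where monomials are well-ordered, and the
  results are moved to other variables by substitution.\<close>

lemma pser_eqI: "(\<And>M. pcoeff f M = pcoeff g M) \<Longrightarrow> f = g"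
  by (metis ext pcoeff_inject)

lemma pcoeff_Pser [simp]: "pcoeff (Pser f) = f"
  by (simp add: Pser_inverse)

lemma pcoeff_0 [simp]: "pcoeff 0 M = 0"
  by transfer simp

lemma pcoeff_add [simp]: "pcoeff (f + g) M = pcoeff f M + pcoeff g M"
  by transfer simp

lemma pcoeff_uminus [simp]: "pcoeff (- f) M = - pcoeff f M"
  by transfer simp

lemma pcoeff_diff [simp]: "pcoeff (f - g) M = pcoeff f M - pcoeff g M"
  by transfer simp

lemma pcoeff_mult: "pcoeff (f * g) M = (\<Sum>(A, B) | A + B = M. pcoeff f A * pcoeff g B)"
  by transfer simp

lemma pcoeff_sum: "pcoeff (sum f A) M = (\<Sum>a\<in>A. pcoeff (f a) M)"
  by (induction A rule: infinite_finite_induct) auto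

lemma pcoeff_of_nat_mult [simp]: "pcoeff (of_nat c * f) M = int c * pcoeff f M"
  by (induction c) (auto simp: algebra_simps)

lemma pcoeff_of_int_mult [simp]: "pcoeff (of_int c * f) M = c * pcoeff f M"
  by (cases c rule: int_cases2) simp_all

definition pmonom :: "'v multiset \<Rightarrow> 'v pser" where
  "pmonom M = Pser (\<lambda>N. if N = M then 1 else 0)"

lemma pcoeff_pmonom: "pcoeff (pmonom M) N = (if N = M then 1 else 0)"
  by (simp add: pmonom_def)

lemma pmonom_mult: "pmonom A * pmonom B = pmonom (A + B)"
proof (rule pser_eqI)
  fix M
  have "pcoeff (pmonom A * pmonom B) M =
      (\<Sum>p\<in>{(P, Q). P + Q = M}. if p = (A, B) then 1 else 0)"
    unfolding pcoeff_mult by (rule sum.cong) (auto simp: pcoeff_pmonom split: if_splits)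
  also have "\<dots> = (if A + B = M then 1 else 0)"
    using finite_splits[of M] by (subst sum.delta) auto
  finally show "pcoeff (pmonom A * pmonom B) M = pcoeff (pmonom (A + B)) M"
    by (auto simp: pcoeff_pmonom)
qed

lemma finite_multisets_over:
  assumes "finite D"
  shows "finite {N. set_mset N \<subseteq> D \<and> image_mset \<phi> N = M}"
proof (rule finite_subset)
  show "{N. set_mset N \<subseteq> D \<and> image_mset \<phi> N = M} \<subseteq> multisets_of_size D (size M)"
    by (auto simp: multisets_of_size_def)
qed (use assms finite_multisets_of_size in blast)

text \<open>
  All variables outside \<open>D\<close> are set to 0 and \<open>\<phi> v\<close> is substituted for \<open>v\<close>; meaningful for finite
  \<open>D\<close>, since otherwise the sum may be infinite and hence 0.
\<close>

definition psubst :: "'v set \<Rightarrow> ('v \<Rightarrow> 'w) \<Rightarrow> 'v pser \<Rightarrow> 'w pser" where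
  "psubst D \<phi> f = Pser (\<lambda>M. \<Sum>N | set_mset N \<subseteq> D \<and> image_mset \<phi> N = M. pcoeff f N)"

lemma pcoeff_psubst:
  "pcoeff (psubst D \<phi> f) M = (\<Sum>N | set_mset N \<subseteq> D \<and> image_mset \<phi> N = M. pcoeff f N)"
  by (simp add: psubst_def)

lemma psubst_0 [simp]: "psubst D \<phi> 0 = 0"
  by (rule pser_eqI) (simp add: pcoeff_psubst)

lemma psubst_add: "psubst D \<phi> (f + g) = psubst D \<phi> f + psubst D \<phi> g"
  by (rule pser_eqI) (simp add: pcoeff_psubst sum.distrib)

lemma psubst_diff: "psubst D \<phi> (f - g) = psubst D \<phi> f - psubst D \<phi> g"
  by (rule pser_eqI) (simp add: pcoeff_psubst sum_subtractf)

lemma psubst_of_int_mult: "psubst D \<phi> (of_int c * f) = of_int c * psubst D \<phi> f"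
  by (rule pser_eqI) (simp add: pcoeff_psubst sum_distrib_left)

lemma psubst_sum: "psubst D \<phi> (sum f A) = (\<Sum>a\<in>A. psubst D \<phi> (f a))"
  by (induction A rule: infinite_finite_induct) (auto simp: psubst_add)

lemma psubst_pmonom:
  assumes "finite D"
  shows "psubst D \<phi> (pmonom M) = (if set_mset M \<subseteq> D then pmonom (image_mset \<phi> M) else 0)"
proof (rule pser_eqI)
  fix N
  have "pcoeff (psubst D \<phi> (pmonom M)) N =
     (\<Sum>K\<in>{K. set_mset K \<subseteq> D \<and> image_mset \<phi> K = N}. if K = M then 1 else 0)"
    by (simp add: pcoeff_psubst pcoeff_pmonom)
  also have "\<dots> = (if set_mset M \<subseteq> D \<and> image_mset \<phi> M = N then 1 else 0)"
    using finite_multisets_over[OF assms] by (subst sum.delta) auto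
  finally show "pcoeff (psubst D \<phi> (pmonom M)) N =
      pcoeff (if set_mset M \<subseteq> D then pmonom (image_mset \<phi> M) else 0) N"
    by (auto simp: pcoeff_pmonom)
qed

lemma psubst_mult:
  assumes "finite D"
  shows "psubst D \<phi> (f * g) = psubst D \<phi> f * psubst D \<phi> g"
proof (rule pser_eqI)
  fix M
  let ?F = "\<lambda>M. {N. set_mset N \<subseteq> D \<and> image_mset \<phi> N = M}"
  let ?S = "\<lambda>M. {(A, B). A + B = M}"
  have fin: "finite (?F M)" for M
    using assms by (rule finite_multisets_over)
  have "pcoeff (psubst D \<phi> (f * g)) M = (\<Sum>N\<in>?F M. \<Sum>p\<in>?S N. pcoeff f (fst p) * pcoeff g (snd p))"
    by (simp add: pcoeff_psubst pcoeff_mult case_prod_unfold)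
  also have "\<dots> = (\<Sum>z\<in>(SIGMA N:?F M. ?S N). pcoeff f (fst (snd z)) * pcoeff g (snd (snd z)))"
    using fin by (subst sum.Sigma) (auto simp: finite_splits[unfolded case_prod_unfold] case_prod_unfold)
  also have "\<dots> = (\<Sum>z\<in>(SIGMA p:?S M. ?F (fst p) \<times> ?F (snd p)).
      pcoeff f (fst (snd z)) * pcoeff g (snd (snd z)))"
    by (rule sum.reindex_bij_witness
          [where j = "\<lambda>(N, (A, B)). ((image_mset \<phi> A, image_mset \<phi> B), (A, B))"
             and i = "\<lambda>(p, (A, B)). (A + B, (A, B))"]) auto
  also have "\<dots> = (\<Sum>p\<in>?S M. \<Sum>q\<in>?F (fst p) \<times> ?F (snd p). pcoeff f (fst q) * pcoeff g (snd q))"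
    using fin by (subst sum.Sigma) (auto simp: finite_splits[unfolded case_prod_unfold] case_prod_unfold)
  also have "\<dots> = (\<Sum>p\<in>?S M. pcoeff (psubst D \<phi> f) (fst p) * pcoeff (psubst D \<phi> g) (snd p))"
    by (simp add: pcoeff_psubst sum_product sum.cartesian_product case_prod_unfold)
  finally show "pcoeff (psubst D \<phi> (f * g)) M = pcoeff (psubst D \<phi> f * psubst D \<phi> g) M"
    by (simp add: pcoeff_mult case_prod_unfold)
qed

lemma pcoeff_psubst_id:
  "pcoeff (psubst D id f) M = (if set_mset M \<subseteq> D then pcoeff f M else 0)"
proof -
  have "{N. set_mset N \<subseteq> D \<and> image_mset id N = M} = (if set_mset M \<subseteq> D then {M} else {})"
    by auto
  then show ?thesis by (simp add: pcoeff_psubst)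
qed

text \<open>A monomial involves finitely many variables, so the sets \<open>D n\<close> eventually
  contain them all. This lifts truncated identities, valid only from some \<open>n0\<close> on, to
  the full ring.\<close>

lemma pser_eq_if_restrictions_eq:
  assumes eq: "\<And>n::nat. n \<ge> n0 \<Longrightarrow> psubst (D n) id f = psubst (D n) id g"
    and mono: "mono D" and cover: "(\<Union>n. D n) = UNIV"
  shows "f = g"
proof (rule pser_eqI)
  fix M
  have "\<exists>n. set_mset M \<subseteq> D n"
  proof (induction M)
    case empty
    then show ?case by simp
  next
    case (add v M)
    then obtain n where n: "set_mset M \<subseteq> D n" by blast
    obtain m where "v \<in> D m" using cover by blast
    with n have "set_mset (add_mset v M) \<subseteq> D (max n m)"
      using monoD[OF mono, of n "max n m"] monoD[OF mono, of m "max n m"] by auto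
    then show ?case ..
  qed
  then obtain n where "set_mset M \<subseteq> D n" ..
  then have "set_mset M \<subseteq> D (max n n0)"
    using monoD[OF mono, of n "max n n0"] by auto
  with eq[of "max n n0"] show "pcoeff f M = pcoeff g M"
    by (metis max.cobounded2 pcoeff_psubst_id)
qed

text \<open>Multisets of naturals form a well-ordered cancellative monoid, so least monomials multiply.\<close>

lemma least_monomial:
  fixes f :: "nat pser"
  assumes "f \<noteq> 0"
  obtains M where "pcoeff f M \<noteq> 0" "\<And>N. N < M \<Longrightarrow> pcoeff f N = 0"
proof -
  have "\<exists>M. pcoeff f M \<noteq> 0"
    using assms by (metis pcoeff_0 pser_eqI)
  then obtain M where "pcoeff f M \<noteq> 0" "\<And>N. N < M \<Longrightarrow> pcoeff f N = 0"
    using exists_least_iff[of "\<lambda>M. pcoeff f M \<noteq> 0"] by blast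
  then show thesis by (rule that)
qed

lemma nat_pser_no_zero_divisors:
  fixes f g :: "nat pser"
  assumes "f \<noteq> 0" "g \<noteq> 0"
  shows "f * g \<noteq> 0"
proof -
  obtain A where A: "pcoeff f A \<noteq> 0" "\<And>N. N < A \<Longrightarrow> pcoeff f N = 0"
    using least_monomial[OF assms(1)] by blast
  obtain B where B: "pcoeff g B \<noteq> 0" "\<And>N. N < B \<Longrightarrow> pcoeff g N = 0"
    using least_monomial[OF assms(2)] by blast
  have "pcoeff (f * g) (A + B) = (\<Sum>(P, Q)\<in>{(A, B)}. pcoeff f P * pcoeff g Q)"
    unfolding pcoeff_mult
  proof (rule sum.mono_neutral_right)
    show "\<forall>p\<in>{(P, Q). P + Q = A + B} - {(A, B)}. (case p of (P, Q) \<Rightarrow> pcoeff f P * pcoeff g Q) = 0"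
    proof safe
      fix P Q assume eq: "P + Q = A + B" and "pcoeff f P * pcoeff g Q \<noteq> 0"
      then have "A \<le> P" "B \<le> Q"
        using A(2)[of P] B(2)[of Q] by (auto simp: not_less[symmetric])
      with eq show "P = A" "Q = B"
        by (metis add_less_le_mono add_le_less_mono less_irrefl order_le_less)+
    qed
  qed (auto simp: finite_splits)
  with A B have "pcoeff (f * g) (A + B) \<noteq> 0" by simp
  then show ?thesis by auto
qed

text \<open>Used to divide by the alternant of \<open>rho n\<close>, so that Schur polynomials never
  have to be written as quotients.\<close>

lemma nat_pser_mult_left_cancel:
  fixes f g h :: "nat pser"
  assumes "f * g = f * h" "f \<noteq> 0"
  shows "g = h"
  using nat_pser_no_zero_divisors[of f "g - h"] assms by (auto simp: algebra_simps)


section \<open>Semistandard fillings of convex sets of cells\<close>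

text \<open>Both skew shapes and their parts left of a column are convex. This lets the
  Bender--Knuth map act on such parts without describing them as skew shapes.\<close>

definition convex_cells :: "cell set \<Rightarrow> bool" where
  "convex_cells S \<longleftrightarrow> (\<forall>a\<in>S. \<forall>b\<in>S. \<forall>c.
     row a \<le> row c \<and> row c \<le> row b \<and> col a \<le> col c \<and> col c \<le> col b \<longrightarrow> c \<in> S)"

definition semistandard :: "cell set \<Rightarrow> filling \<Rightarrow> bool" where
  "semistandard S T \<longleftrightarrow> (\<forall>c\<in>S. \<forall>d\<in>S.
     (row c = row d \<and> col c < col d \<longrightarrow> T c \<le> T d) \<and>
     (col c = col d \<and> row c < row d \<longrightarrow> T c < T d))"

definition sst :: "nat \<Rightarrow> cell set \<Rightarrow> filling set" where
  "sst n S = {T. (\<forall>c. c \<notin> S \<longrightarrow> T c = 0) \<and> (\<forall>c\<in>S. T c < n) \<and> semistandard S T}"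

definition weight :: "cell set \<Rightarrow> filling \<Rightarrow> nat multiset" where
  "weight S T = image_mset T (mset_set S)"

text \<open>For a diagram this is the Schur polynomial in \<open>n\<close> variables, for a skew
  shape the skew Schur polynomial.\<close>

definition spoly :: "nat \<Rightarrow> (nat \<Rightarrow> 'v) \<Rightarrow> cell set \<Rightarrow> 'v pser" where
  "spoly n x S = (\<Sum>T\<in>sst n S. pmonom (image_mset x (weight S T)))"

lemma convex_cellsD:
  assumes "convex_cells S" "a \<in> S" "b \<in> S" "row a \<le> p" "p \<le> row b" "col a \<le> q" "q \<le> col b"
  shows "(p, q) \<in> S"
  using assms unfolding convex_cells_def by (metis fst_conv snd_conv)

lemma semistandard_row:
  "semistandard S T \<Longrightarrow> c \<in> S \<Longrightarrow> d \<in> S \<Longrightarrow> row c = row d \<Longrightarrow> col c \<le> col d \<Longrightarrow> T c \<le> T d"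
  unfolding semistandard_def by (metis le_neq_implies_less order_refl prod.collapse)

lemma semistandard_col:
  "semistandard S T \<Longrightarrow> c \<in> S \<Longrightarrow> d \<in> S \<Longrightarrow> col c = col d \<Longrightarrow> row c < row d \<Longrightarrow> T c < T d"
  unfolding semistandard_def by blast

text \<open>Convexity supplies the corner cell in the row of \<open>c\<close> and the column of
  \<open>d\<close>; the vertical step from there to \<open>d\<close> gives strictness.\<close>

lemma semistandard_le:
  assumes "convex_cells S" "semistandard S T" "c \<in> S" "d \<in> S" "row c \<le> row d" "col c \<le> col d"
  shows "T c \<le> T d" "row c < row d \<Longrightarrow> T c < T d"
proof -
  have e: "(row c, col d) \<in> S"
    using assms by (intro convex_cellsD[OF assms(1,3,4)]) auto
  have 1: "T c \<le> T (row c, col d)"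
    using semistandard_row[OF assms(2,3) e] assms by auto
  show "T c < T d" if "row c < row d"
    using semistandard_col[OF assms(2) e assms(4)] that 1 by auto
  then show "T c \<le> T d"
    using assms semistandard_row[OF assms(2,3,4)] by (cases "row c = row d") auto
qed

lemma semistandard_subset: "semistandard S T \<Longrightarrow> R \<subseteq> S \<Longrightarrow> semistandard R T"
  unfolding semistandard_def by blast

lemma sst_outside: "T \<in> sst n S \<Longrightarrow> c \<notin> S \<Longrightarrow> T c = 0"
  unfolding sst_def by blast

lemma finite_sst: "finite S \<Longrightarrow> finite (sst n S)"
  by (rule finite_subset[OF _ finite_set_of_finite_funs[of S "{..<n}" 0]]) (auto simp: sst_def)

lemma count_weight: "finite S \<Longrightarrow> count (weight S T) k = card {c \<in> S. T c = k}"
proof (induction S rule: finite_induct)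
  case (insert c S)
  then have "{d \<in> insert c S. T d = k} = (if T c = k then insert c {d \<in> S. T d = k} else {d \<in> S. T d = k})"
    by auto
  with insert show ?case by (auto simp: weight_def)
qed (simp add: weight_def)

lemma set_weight: "finite S \<Longrightarrow> set_mset (weight S T) = T ` S"
  by (simp add: weight_def)

lemma size_weight: "size (weight S T) = card S"
  by (simp add: weight_def)

lemma weight_cong: "(\<And>c. c \<in> S \<Longrightarrow> T c = U c) \<Longrightarrow> weight S T = weight S U"
  unfolding weight_def by (metis elem_mset_set image_mset_cong mset_set.infinite set_mset_empty empty_iff)

lemma weight_union_disjoint:
  assumes "finite A" "finite B" "A \<inter> B = {}"
  shows "weight (A \<union> B) T = weight A T + weight B T"
  using assms by (simp add: weight_def mset_set_Union)

lemma weight_split: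
  "finite S \<Longrightarrow> weight S T = weight {c \<in> S. P c} T + weight {c \<in> S. \<not> P c} T"
  by (subst weight_union_disjoint[symmetric]) (auto intro!: arg_cong[of _ _ "\<lambda>S. weight S T"])

lemma diagram_closed: "(p', q') \<in> diagram \<alpha> \<Longrightarrow> p \<le> p' \<Longrightarrow> q \<le> q' \<Longrightarrow> (p, q) \<in> diagram \<alpha>"
  using antimono_part[of p p' \<alpha>] by (simp add: diagram_def)

lemma convex_skew: "convex_cells (skew \<alpha> \<beta>)"
  unfolding convex_cells_def
proof (intro ballI allI impI)
  fix a b c assume "a \<in> skew \<alpha> \<beta>" "b \<in> skew \<alpha> \<beta>"
    and le: "row a \<le> row c \<and> row c \<le> row b \<and> col a \<le> col c \<and> col c \<le> col b"
  then have "a \<notin> diagram \<beta>" "b \<in> diagram \<alpha>" by (auto simp: skew_def)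
  with le show "c \<in> skew \<alpha> \<beta>"
    using diagram_closed[of "row b" "col b" \<alpha> "row c" "col c"]
      diagram_closed[of "row c" "col c" \<beta> "row a" "col a"] by (auto simp: skew_def)
qed

lemma convex_diagram: "convex_cells (diagram \<alpha>)"
  unfolding convex_cells_def
proof (intro ballI allI impI)
  fix a b c assume "b \<in> diagram \<alpha>"
    and "row a \<le> row c \<and> row c \<le> row b \<and> col a \<le> col c \<and> col c \<le> col b"
  then show "c \<in> diagram \<alpha>"
    using diagram_closed[of "row b" "col b" \<alpha> "row c" "col c"] by simp
qed

lemma finite_skew: "finite (skew \<alpha> \<beta>)"
  by (simp add: skew_def finite_diagram)

lemma convex_cells_left: "convex_cells S \<Longrightarrow> convex_cells {c \<in> S. col c < j}"
  unfolding convex_cells_def by auto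

lemma ssyt_iff_sst: "T \<in> sst n (diagram \<alpha>) \<longleftrightarrow> T \<in> ssyt \<alpha> \<and> (\<forall>c\<in>diagram \<alpha>. T c < n)"
  by (auto simp: sst_def ssyt_def semistandard_def)

text \<open>The bridge from infinite generating functions to finite sums: the monomial of a tableau
  survives the truncation exactly when all its entries are below \<open>n\<close>.\<close>

lemma psubst_schur:
  assumes D: "finite D" "{t. x t \<in> D} = {..<n}"
  shows "psubst D \<phi> (schur x \<alpha>) = spoly n (\<lambda>t. \<phi> (x t)) (diagram \<alpha>)"
proof (rule pser_eqI)
  fix M
  let ?S = "diagram \<alpha>"
  let ?N = "{N. set_mset N \<subseteq> D \<and> image_mset \<phi> N = M}"
  let ?X = "\<lambda>N. {T \<in> ssyt \<alpha>. image_mset (\<lambda>c. x (T c)) (mset_set ?S) = N}"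
  have mem: "T \<in> sst n ?S" if "T \<in> ?X N" "N \<in> ?N" for T N
  proof -
    have "x (T c) \<in> D" if "c \<in> ?S" for c
      using that \<open>T \<in> ?X N\<close> \<open>N \<in> ?N\<close> finite_diagram[of \<alpha>] by auto
    then show ?thesis using D(2) that by (auto simp: ssyt_iff_sst)
  qed
  have finX: "finite (?X N)" if "N \<in> ?N" for N
    by (rule finite_subset[OF _ finite_sst[OF finite_diagram]]) (use mem that in blast)
  have U: "(\<Union>N\<in>?N. ?X N) = {T \<in> sst n ?S. image_mset (\<lambda>t. \<phi> (x t)) (weight ?S T) = M}"
  proof (intro equalityI subsetI)
    fix T assume "T \<in> (\<Union>N\<in>?N. ?X N)"
    then show "T \<in> {T \<in> sst n ?S. image_mset (\<lambda>t. \<phi> (x t)) (weight ?S T) = M}"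
      using mem by (auto simp: weight_def multiset.map_comp comp_def)
  next
    fix T assume T: "T \<in> {T \<in> sst n ?S. image_mset (\<lambda>t. \<phi> (x t)) (weight ?S T) = M}"
    define N where "N = image_mset (\<lambda>c. x (T c)) (mset_set ?S)"
    have "set_mset N \<subseteq> D"
      using T D(2) finite_diagram[of \<alpha>] by (auto simp: N_def sst_def)
    moreover have "image_mset \<phi> N = M"
      using T by (auto simp: N_def weight_def multiset.map_comp comp_def)
    ultimately show "T \<in> (\<Union>N\<in>?N. ?X N)"
      using T by (auto simp: N_def ssyt_iff_sst)
  qed
  have "pcoeff (psubst D \<phi> (schur x \<alpha>)) M = (\<Sum>N\<in>?N. int (card (?X N)))"
    by (simp add: pcoeff_psubst schur_def)
  also have "\<dots> = int (card (\<Union>N\<in>?N. ?X N))"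
    using finite_multisets_over[OF D(1), of \<phi> M] finX
    by (subst card_UN_disjoint) auto
  also have "\<dots> = (\<Sum>T\<in>sst n ?S. if image_mset (\<lambda>t. \<phi> (x t)) (weight ?S T) = M then 1 else 0)"
    unfolding U by (simp add: sum.If_cases finite_sst finite_diagram Int_def)
  also have "\<dots> = pcoeff (spoly n (\<lambda>t. \<phi> (x t)) ?S) M"
    by (auto simp: spoly_def pcoeff_sum pcoeff_pmonom intro!: sum.cong)
  finally show "pcoeff (psubst D \<phi> (schur x \<alpha>)) M = pcoeff (spoly n (\<lambda>t. \<phi> (x t)) ?S) M" .
qed

text \<open>Carries identities from variables in \<open>nat\<close>, where cancellation is
  available, to arbitrary variables.\<close>

lemma psubst_spoly:
  assumes "finite S"
  shows "psubst {..<n} x (spoly n (\<lambda>t. t) S) = spoly n x S"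
  unfolding spoly_def psubst_sum
  using assms by (intro sum.cong) (auto simp: psubst_pmonom set_weight sst_def)

section \<open>Bender--Knuth involutions\<close>

definition free_cells :: "cell set \<Rightarrow> cell set" where
  "free_cells B = {z \<in> B. \<forall>y\<in>B. col y = col z \<longrightarrow> y = z}"

text \<open>Reflection in the midpoint of the free cells of the row. It permutes them because they
  form an interval, see \<open>free_contiguous\<close>.\<close>

definition reflect :: "cell set \<Rightarrow> cell \<Rightarrow> cell" where
  "reflect F z = (row z, Min (col ` {y \<in> F. row y = row z}) + Max (col ` {y \<in> F. row y = row z}) - col z)"

text \<open>
  On the set \<open>B\<close> of cells with entry \<open>k\<close> or \<open>k + 1\<close>, this reverses each row of free cells and swaps
  the two cells of each column containing both entries. It depends on \<open>B\<close> only, which makes the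
  Bender--Knuth map below visibly an involution.
\<close>

definition bk_perm :: "cell set \<Rightarrow> cell \<Rightarrow> cell" where
  "bk_perm B z = (if z \<notin> B then z else if z \<in> free_cells B then reflect (free_cells B) z
     else (SOME y. y \<in> B \<and> col y = col z \<and> y \<noteq> z))"

definition active :: "nat \<Rightarrow> cell set \<Rightarrow> filling \<Rightarrow> cell set" where
  "active k S T = {z \<in> S. T z = k \<or> T z = Suc k}"

text \<open>A free row with r entries k followed by s entries k + 1 becomes, after reversal and
  exchange of the two values, s entries k followed by r entries k + 1. In a column containing both
  values, the exchange of cells undoes the exchange of values.\<close>

definition bk :: "nat \<Rightarrow> cell set \<Rightarrow> filling \<Rightarrow> filling" where
  "bk k S T z = (if z \<in> S then transpose k (Suc k) (T (bk_perm (active k S T) z)) else T z)"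

context
  fixes k :: nat and S :: "cell set" and T :: filling
  assumes fin: "finite S" and conv: "convex_cells S" and ss: "semistandard S T"
begin

private abbreviation "B \<equiv> active k S T"
private abbreviation "F \<equiv> free_cells B"

lemma active_col: 
  assumes "y \<in> B" "z \<in> B" "col y = col z" "row y < row z"
  shows "T y = k" "T z = Suc k"
  using assms semistandard_col[OF ss, of y z] by (auto simp: active_def)

lemma active_col_cases:
  assumes "y \<in> B" "z \<in> B" "col y = col z" "y \<noteq> z"
  shows "(T y = k \<and> T z = Suc k \<and> row y < row z) \<or> (T y = Suc k \<and> T z = k \<and> row z < row y)"
  using active_col[of y z] active_col[of z y] assms by (metis linorder_neqE_nat prod_eq_iff)

text \<open>The cell \<open>?w\<close> below \<open>z'\<close>, in the row of the partner of
  \<open>z\<close>, is squeezed to the value k + 1, so \<open>z'\<close> is paired too. Hence the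
  paired entries k of a row stand left of its free cells; \<open>paired_right\<close> is the mirror
  image.\<close>

lemma paired_left:
  assumes "z \<in> B" "T z = k" "z \<notin> F" "z' \<in> B" "row z' = row z" "col z' \<le> col z"
  shows "z' \<notin> F"
proof
  assume F: "z' \<in> F"
  obtain y where y: "y \<in> B" "col y = col z" "y \<noteq> z"
    using assms by (auto simp: free_cells_def)
  then have y': "T y = Suc k" "row z < row y"
    using active_col_cases[of y z] assms by auto
  let ?w = "(row y, col z')"
  have mem: "z \<in> S" "z' \<in> S" "y \<in> S" using assms y by (auto simp: active_def)
  have w: "?w \<in> S"
    using assms y y' mem by (intro convex_cellsD[OF conv, of z' y]) auto
  have "T z' = k"
    using semistandard_row[OF ss, of z' z] assms mem by (auto simp: active_def)
  moreover have "T z' < T ?w" "T ?w \<le> T y"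
    using semistandard_col[OF ss mem(2) w] semistandard_row[OF ss w mem(3)] y' y assms by auto
  ultimately have "?w \<in> B" using w y' by (auto simp: active_def)
  with F have "?w = z'" by (auto simp: free_cells_def)
  then have "row y = row z'" by (metis fst_conv)
  with y' assms(5) show False by simp
qed

lemma paired_right:
  assumes "z \<in> B" "T z = Suc k" "z \<notin> F" "z' \<in> B" "row z' = row z" "col z \<le> col z'"
  shows "z' \<notin> F"
proof
  assume F: "z' \<in> F"
  obtain y where y: "y \<in> B" "col y = col z" "y \<noteq> z"
    using assms by (auto simp: free_cells_def)
  then have y': "T y = k" "row y < row z"
    using active_col_cases[of y z] assms by auto
  let ?w = "(row y, col z')"
  have mem: "z \<in> S" "z' \<in> S" "y \<in> S" using assms y by (auto simp: active_def)
  have w: "?w \<in> S"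
    using assms y y' mem by (intro convex_cellsD[OF conv, of y z']) auto
  have "T z' = Suc k"
    using semistandard_row[OF ss, of z z'] assms mem by (auto simp: active_def)
  moreover have "T ?w < T z'" "T y \<le> T ?w"
    using semistandard_col[OF ss w mem(2)] semistandard_row[OF ss mem(3) w] y' y assms by auto
  ultimately have "?w \<in> B" using w y' by (auto simp: active_def)
  with F have "?w = z'" by (auto simp: free_cells_def)
  then have "row y = row z'" by (metis fst_conv)
  with y' assms(5) show False by simp
qed

text \<open>A paired cell between two free cells of a row would force the left one (if it holds k)
  or the right one (if it holds k + 1) to be paired.\<close>

lemma free_contiguous:
  assumes "a \<in> F" "b \<in> F" "row a = p" "row b = p" "col a \<le> q" "q \<le> col b"
  shows "(p, q) \<in> F"
proof (rule ccontr)
  assume n: "(p, q) \<notin> F"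
  have mem: "a \<in> B" "b \<in> B" "a \<in> S" "b \<in> S"
    using assms by (auto simp: free_cells_def active_def)
  have z: "(p, q) \<in> S"
    using assms mem by (intro convex_cellsD[OF conv, of a b]) auto
  have "T a \<le> T (p, q)" "T (p, q) \<le> T b"
    using semistandard_row[OF ss mem(3) z] semistandard_row[OF ss z mem(4)] assms by auto
  then have B: "(p, q) \<in> B" using mem z by (auto simp: active_def)
  then consider "T (p, q) = k" | "T (p, q) = Suc k" by (auto simp: active_def)
  then show False
    using paired_left[OF B _ n mem(1)] paired_right[OF B _ n mem(2)] assms by cases auto
qed

lemma finite_free: "finite F"
  using fin by (auto simp: free_cells_def active_def)

lemma reflect_free:
  assumes "z \<in> F"
  shows "reflect F z \<in> F" "row (reflect F z) = row z" "reflect F (reflect F z) = z"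
    and "y \<in> F \<Longrightarrow> row y = row z \<Longrightarrow> col y < col z \<Longrightarrow> col (reflect F z) < col (reflect F y)"
proof -
  define Q where "Q = col ` {y \<in> F. row y = row z}"
  have fQ: "finite Q" using finite_free by (simp add: Q_def)
  have zQ: "col z \<in> Q" using assms by (auto simp: Q_def)
  define l r where "l = Min Q" and "r = Max Q"
  have l: "l \<in> Q" "l \<le> col z" and r: "r \<in> Q" "col z \<le> r"
    using fQ zQ Min_in[of Q] Max_in[of Q] Min_le[of Q "col z"] Max_ge[of Q "col z"]
    unfolding l_def r_def by blast+
  have R: "reflect F y = (row z, l + r - col y)" if "row y = row z" for y
    using that by (simp add: reflect_def Q_def l_def r_def)
  obtain a b where ab: "a \<in> F" "row a = row z" "col a = l" "b \<in> F" "row b = row z" "col b = r"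
    using l r unfolding Q_def by blast
  show "reflect F z \<in> F"
    unfolding R[OF refl] using l r ab by (intro free_contiguous[of a b]) auto
  show "row (reflect F z) = row z" by (simp add: R)
  show "reflect F (reflect F z) = z"
    using R[of z] R[of "reflect F z"] l r by (auto simp: prod_eq_iff)
  show "col (reflect F z) < col (reflect F y)" if "y \<in> F" "row y = row z" "col y < col z"
    using R[of z] R[of y] that l r by auto
qed

lemma partner:
  assumes "z \<in> B" "z \<notin> F"
  shows "bk_perm B z \<in> B" "col (bk_perm B z) = col z" "bk_perm B z \<noteq> z" "bk_perm B z \<notin> F"
    "T (bk_perm B z) = transpose k (Suc k) (T z)" "bk_perm B (bk_perm B z) = z"
proof -
  have P: "\<exists>y. y \<in> B \<and> col y = col z \<and> y \<noteq> z"
    using assms by (auto simp: free_cells_def)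
  have eq: "bk_perm B z = (SOME y. y \<in> B \<and> col y = col z \<and> y \<noteq> z)"
    using assms by (simp add: bk_perm_def)
  show 1: "bk_perm B z \<in> B" "col (bk_perm B z) = col z" "bk_perm B z \<noteq> z"
    using someI_ex[OF P] unfolding eq by auto
  show 2: "bk_perm B z \<notin> F"
    using 1 assms by (auto simp: free_cells_def)
  show "T (bk_perm B z) = transpose k (Suc k) (T z)"
    using active_col_cases[OF 1(1) assms(1) 1(2,3)] by (auto simp: transpose_def)
  \<comment> \<open>Three cells of one column would need three different entries, but only k and k +
    1 are available.\<close>
  have uniq: "w = z" if "w \<in> B" "col w = col z" "w \<noteq> bk_perm B z" for w
  proof (rule ccontr)
    assume "w \<noteq> z"
    then show False
      using active_col_cases[of w z] active_col_cases[of w "bk_perm B z"]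
        active_col_cases[OF 1(1) assms(1) 1(2,3)] that 1 assms by auto
  qed
  have "bk_perm B (bk_perm B z) = (SOME y. y \<in> B \<and> col y = col (bk_perm B z) \<and> y \<noteq> bk_perm B z)"
    using 1 2 by (simp add: bk_perm_def)
  also have "\<dots> = z"
    by (rule some_equality) (use 1 assms uniq in auto)
  finally show "bk_perm B (bk_perm B z) = z" .
qed

lemma bk_perm_free: "z \<in> F \<Longrightarrow> bk_perm B z = reflect F z"
  by (auto simp: bk_perm_def free_cells_def)

lemma bk_perm_inactive: "z \<notin> B \<Longrightarrow> bk_perm B z = z"
  by (auto simp: bk_perm_def)

lemma bk_perm_involution: "bk_perm B (bk_perm B z) = z"
proof -
  consider "z \<in> F" | "z \<in> B" "z \<notin> F" | "z \<notin> B" by blast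
  then show ?thesis
  proof cases
    case 1
    show ?thesis
      unfolding bk_perm_free[OF 1] bk_perm_free[OF reflect_free(1)[OF 1]] by (rule reflect_free(3)[OF 1])
  next
    case 2
    then show ?thesis by (rule partner(6))
  next
    case 3
    show ?thesis unfolding bk_perm_inactive[OF 3] ..
  qed
qed

lemma bk_perm_active: "bk_perm B z \<in> B \<longleftrightarrow> z \<in> B"
proof -
  have "z \<in> B \<Longrightarrow> bk_perm B z \<in> B" for z
    using partner(1)[of z] bk_perm_free[of z] reflect_free(1)[of z]
    by (cases "z \<in> F") (auto simp: free_cells_def)
  then show ?thesis using bk_perm_involution by metis
qed

lemma bk_perm_mem: "bk_perm B z \<in> S \<longleftrightarrow> z \<in> S"
  using bk_perm_active[of z] bk_perm_inactive[of z] by (cases "z \<in> B") (auto simp: active_def)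

lemma bk_nonfree: "z \<notin> F \<Longrightarrow> bk k S T z = T z"
  using partner(5)[of z] bk_perm_inactive[of z]
  by (cases "z \<in> B") (auto simp: bk_def active_def transpose_def)

lemma bk_free: "z \<in> F \<Longrightarrow> bk k S T z = transpose k (Suc k) (T (reflect F z))"
  using bk_perm_free by (auto simp: bk_def active_def free_cells_def)

lemma bk_free_values: "z \<in> F \<Longrightarrow> bk k S T z \<in> {k, Suc k}"
  using bk_free[of z] reflect_free(1)[of z] by (auto simp: free_cells_def active_def)

lemma active_bk: "active k S (bk k S T) = B"
proof -
  have "z \<in> active k S (bk k S T) \<longleftrightarrow> z \<in> B" for z
    using bk_free_values[of z] bk_nonfree[of z]
    by (cases "z \<in> F") (auto simp: active_def free_cells_def)
  then show ?thesis by blast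
qed

lemma bk_involution: "bk k S (bk k S T) = T"
  by (rule ext) (simp add: bk_def[of k S "bk k S T"] active_bk,
    simp add: bk_def bk_perm_mem bk_perm_involution)

lemma weight_bk: "weight S (bk k S T) = image_mset (transpose k (Suc k)) (weight S T)"
proof -
  have bij: "bij_betw (bk_perm B) S S"
    by (rule bij_betw_byWitness[where f' = "bk_perm B"]) (auto simp: bk_perm_involution bk_perm_mem)
  have "image_mset (bk_perm B) (mset_set S) = mset_set S"
    using bij by (metis bij_betw_def image_mset_mset_set)
  then have "image_mset (transpose k (Suc k)) (weight S T)
      = image_mset (\<lambda>z. transpose k (Suc k) (T z)) (image_mset (bk_perm B) (mset_set S))"
    by (simp add: weight_def multiset.map_comp comp_def)
  also have "\<dots> = weight S (bk k S T)"
    unfolding weight_def multiset.map_comp comp_def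
    by (intro image_mset_cong) (use fin in \<open>auto simp: bk_def\<close>)
  finally show ?thesis by simp
qed

text \<open>In a row, reflection reverses the free cells and the exchange of values restores their
  order. By \<open>paired_left\<close> and \<open>paired_right\<close>, no k that is not free stands
  right of a free cell and no such k + 1 stands left of one, so either value is safe there. The
  column of a free cell has no other entry k or k + 1.\<close>

lemma semistandard_bk: "semistandard S (bk k S T)"
  unfolding semistandard_def
proof (intro ballI conjI impI; elim conjE)
  fix y z assume yz: "y \<in> S" "z \<in> S" "row y = row z" "col y < col z"
  have le: "T y \<le> T z" using semistandard_row[OF ss] yz by auto
  consider "y \<in> F" "z \<in> F" | "y \<in> F" "z \<notin> F" | "y \<notin> F" "z \<in> F" | "y \<notin> F" "z \<notin> F" by blast
  then show "bk k S T y \<le> bk k S T z"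
  proof cases
    case 1
    have "T (reflect F z) \<le> T (reflect F y)"
      using reflect_free[OF 1(1)] reflect_free[OF 1(2)] reflect_free(4)[OF 1(2,1)] yz
      by (intro semistandard_row[OF ss]) (auto simp: free_cells_def active_def)
    moreover have "T (reflect F z) \<in> {k, Suc k}" "T (reflect F y) \<in> {k, Suc k}"
      using reflect_free(1)[OF 1(1)] reflect_free(1)[OF 1(2)] by (auto simp: free_cells_def active_def)
    ultimately show ?thesis unfolding bk_free[OF 1(1)] bk_free[OF 1(2)] by auto
  next
    case 2
    have "T z \<noteq> k"
      using paired_left[of z y] 2 yz by (auto simp: free_cells_def active_def)
    then show ?thesis
      using bk_free_values[OF 2(1)] bk_nonfree[OF 2(2)] le 2(1) by (auto simp: free_cells_def active_def)
  next
    case 3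
    have "T y \<noteq> Suc k"
      using paired_right[of y z] 3 yz by (auto simp: free_cells_def active_def)
    then show ?thesis
      using bk_free_values[OF 3(2)] bk_nonfree[OF 3(1)] le 3(2) by (auto simp: free_cells_def active_def)
  next
    case 4
    then show ?thesis using le bk_nonfree by simp
  qed
next
  fix y z assume yz: "y \<in> S" "z \<in> S" "col y = col z" "row y < row z"
  have less: "T y < T z" using semistandard_col[OF ss] yz by auto
  have ne: "y \<noteq> z" using yz by auto
  consider "y \<in> F" "z \<in> F" | "y \<in> F" "z \<notin> F" | "y \<notin> F" "z \<in> F" | "y \<notin> F" "z \<notin> F" by blast
  then show "bk k S T y < bk k S T z"
  proof cases
    case 1
    then show ?thesis using yz ne by (auto simp: free_cells_def)
  next
    case 2
    then have "z \<notin> B" "y \<in> B" using yz ne by (auto simp: free_cells_def)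
    then show ?thesis
      using bk_free_values[OF 2(1)] bk_nonfree[OF 2(2)] less yz by (auto simp: active_def)
  next
    case 3
    then have "y \<notin> B" "z \<in> B" using yz ne by (auto simp: free_cells_def)
    then show ?thesis
      using bk_free_values[OF 3(2)] bk_nonfree[OF 3(1)] less yz by (auto simp: active_def)
  next
    case 4
    then show ?thesis using less bk_nonfree by simp
  qed
qed

end

lemma bk_sst:
  assumes "finite S" "convex_cells S" "Suc k < n" "T \<in> sst n S"
  shows "bk k S T \<in> sst n S"
proof -
  have ss: "semistandard S T" using assms by (simp add: sst_def)
  have "bk k S T z < n" if "z \<in> S" for z
  proof -
    have "bk_perm (active k S T) z \<in> S"
      using bk_perm_mem[OF assms(1,2) ss] that by auto
    then have "T (bk_perm (active k S T) z) < n" using assms by (auto simp: sst_def)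
    then show ?thesis using assms(3) that by (auto simp: bk_def transpose_def)
  qed
  then show ?thesis
    using semistandard_bk[OF assms(1,2) ss] assms by (auto simp: sst_def bk_def)
qed


section \<open>Alternants\<close>

lemma count_image_mset_inj: "inj f \<Longrightarrow> count (image_mset f M) (f x) = count M x"
  by (induction M) (auto simp: inj_eq)

text \<open>Symmetry of Schur polynomials as a bijection on fillings. Adjacent transpositions are
  realised by \<open>bk\<close>; the others arise by repeated conjugation with adjacent
  ones.\<close>

lemma weight_symmetric_transpose:
  assumes S: "finite S" "convex_cells S" and ab: "a < n" "b < n"
  shows "\<exists>h. bij_betw h (sst n S) (sst n S) \<and>
    (\<forall>T\<in>sst n S. weight S (h T) = image_mset (transpose a b) (weight S T))"
proof -
  let ?Q = "\<lambda>\<pi>. \<exists>h. bij_betw h (sst n S) (sst n S) \<and>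
    (\<forall>T\<in>sst n S. weight S (h T) = image_mset \<pi> (weight S T))"
  have adj: "?Q (transpose k (Suc k))" if "Suc k < n" for k
  proof (intro exI[of _ "bk k S"] conjI ballI)
    have inv: "bk k S (bk k S T) = T" if "T \<in> sst n S" for T
      using that by (intro bk_involution[OF S]) (simp add: sst_def)
    show "bij_betw (bk k S) (sst n S) (sst n S)"
      by (rule bij_betw_byWitness[where f' = "bk k S"]) (auto simp: bk_sst[OF S that] inv)
    show "weight S (bk k S T) = image_mset (transpose k (Suc k)) (weight S T)" if "T \<in> sst n S" for T
      using that by (intro weight_bk[OF S]) (auto simp: sst_def)
  qed
  have comp: "?Q (\<pi> \<circ> \<sigma>)" if "?Q \<pi>" "?Q \<sigma>" for \<pi> \<sigma>
  proof -
    from that obtain g h where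
      g: "bij_betw g (sst n S) (sst n S)" "\<forall>T\<in>sst n S. weight S (g T) = image_mset \<pi> (weight S T)" and
      h: "bij_betw h (sst n S) (sst n S)" "\<forall>T\<in>sst n S. weight S (h T) = image_mset \<sigma> (weight S T)"
      by blast
    have "weight S ((g \<circ> h) T) = image_mset (\<pi> \<circ> \<sigma>) (weight S T)" if "T \<in> sst n S" for T
      using g(2) h(2) bij_betwE[OF h(1)] that by (simp add: multiset.map_comp)
    then show ?thesis using bij_betw_trans[OF h(1) g(1)] by blast
  qed
  have "?Q (transpose a (a + Suc d))" if "a + Suc d < n" for a d
    using that
  proof (induction d)
    case 0
    then show ?case using adj[of a] by simp
  next
    case (Suc d)
    let ?m = "a + Suc d"
    have "?Q (transpose ?m (Suc ?m) \<circ> transpose a ?m \<circ> transpose ?m (Suc ?m))"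
      using Suc adj[of ?m] by (intro comp) auto
    also have "transpose ?m (Suc ?m) \<circ> transpose a ?m \<circ> transpose ?m (Suc ?m) = transpose a (Suc ?m)"
      by (auto simp: fun_eq_iff transpose_def)
    finally show ?case by simp
  qed
  then have less: "?Q (transpose a b)" if "a < b" "b < n" for a b
    using that by (metis add_Suc_right less_imp_Suc_add)
  have id: "?Q id"
    by (rule exI[of _ "\<lambda>T. T"]) (simp add: bij_betw_def)
  consider "a < b" | "b < a" | "a = b" by linarith
  then show ?thesis
  proof cases
    case 2
    then show ?thesis using less[of b a] ab by (simp add: transpose_commute)
  next
    case 3
    then have "transpose a b = id" by simp
    then show ?thesis using id by (simp only:)
  qed (use less ab in blast)
qed

lemma weight_symmetric:
  assumes S: "finite S" "convex_cells S" and "\<pi> permutes {..<n}"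
  shows "\<exists>h. bij_betw h (sst n S) (sst n S) \<and>
    (\<forall>T\<in>sst n S. weight S (h T) = image_mset \<pi> (weight S T))"
  using assms(3) finite_lessThan
proof (induction rule: permutes_induct)
  case id
  show ?case
    by (rule exI[of _ "\<lambda>T. T"]) (simp add: bij_betw_def)
next
  case (swap a b p)
  obtain g where g: "bij_betw g (sst n S) (sst n S)"
      "\<forall>T\<in>sst n S. weight S (g T) = image_mset (transpose a b) (weight S T)"
    using weight_symmetric_transpose[OF S, of a n b] swap by blast
  obtain h where h: "bij_betw h (sst n S) (sst n S)"
      "\<forall>T\<in>sst n S. weight S (h T) = image_mset p (weight S T)"
    using swap by blast
  have "weight S ((g \<circ> h) T) = image_mset (transpose a b \<circ> p) (weight S T)" if "T \<in> sst n S" for T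
    using g(2) h(2) bij_betwE[OF h(1)] that by (simp add: multiset.map_comp)
  then show ?case using bij_betw_trans[OF h(1) g(1)] by blast
qed

text \<open>For \<open>M\<close> with entries below \<open>n\<close> this is the determinant of the
  powers x_i^(e_j), where e_j is the multiplicity of j in \<open>M\<close>.\<close>

definition alternant :: "nat \<Rightarrow> nat multiset \<Rightarrow> nat pser" where
  "alternant n M = (\<Sum>\<pi> | \<pi> permutes {..<n}. of_int (sign \<pi>) * pmonom (image_mset \<pi> M))"

lemma alternant_permute:
  assumes "\<tau> permutes {..<n}"
  shows "alternant n (image_mset \<tau> M) = of_int (sign \<tau>) * alternant n M"
proof -
  let ?P = "{\<pi>. \<pi> permutes {..<n}}"
  have "alternant n M = (\<Sum>\<pi>\<in>?P. of_int (sign (\<pi> \<circ> \<tau>)) * pmonom (image_mset (\<pi> \<circ> \<tau>) M))"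
    unfolding alternant_def by (rule sum_permutations_compose_right[OF assms])
  also have "\<dots> = (\<Sum>\<pi>\<in>?P. of_int (sign \<tau>) * (of_int (sign \<pi>) * pmonom (image_mset \<pi> (image_mset \<tau> M))))"
    using assms permutes_imp_permutation[OF finite_lessThan, of _ n]
    by (intro sum.cong) (auto simp: sign_compose multiset.map_comp)
  also have "\<dots> = of_int (sign \<tau>) * alternant n (image_mset \<tau> M)"
    by (simp add: alternant_def sum_distrib_left)
  finally have "of_int (sign \<tau>) * alternant n M =
      of_int (sign \<tau>) * (of_int (sign \<tau>) * alternant n (image_mset \<tau> M))"
    by simp
  also have "\<dots> = of_int (sign \<tau> * sign \<tau>) * alternant n (image_mset \<tau> M)"
    by (simp only: of_int_mult mult.assoc)
  finally show ?thesis by simp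
qed

text \<open>By symmetry, the fillings in the summand of \<pi> may be permuted so that their weights
  are replaced by the images under \<pi>; the monomials then regroup into alternants.\<close>

lemma alternant_mult_spoly:
  assumes "finite S" "convex_cells S"
  shows "alternant n M * spoly n (\<lambda>t. t) S = (\<Sum>T\<in>sst n S. alternant n (M + weight S T))"
proof -
  have sym: "(\<Sum>T\<in>sst n S. pmonom (image_mset \<pi> M + weight S T)) =
      (\<Sum>T\<in>sst n S. pmonom (image_mset \<pi> (M + weight S T)))" if \<pi>: "\<pi> permutes {..<n}" for \<pi>
  proof -
    obtain h where h: "bij_betw h (sst n S) (sst n S)"
      "\<forall>T\<in>sst n S. weight S (h T) = image_mset \<pi> (weight S T)"
      using weight_symmetric[OF assms \<pi>] by blast
    have "(\<Sum>T\<in>sst n S. pmonom (image_mset \<pi> M + weight S T)) =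
        (\<Sum>T\<in>sst n S. pmonom (image_mset \<pi> M + weight S (h T)))"
      by (rule sum.reindex_bij_betw[OF h(1), symmetric])
    with h(2) show ?thesis by simp
  qed
  have "alternant n M * spoly n (\<lambda>t. t) S = (\<Sum>\<pi> | \<pi> permutes {..<n}.
      of_int (sign \<pi>) * (\<Sum>T\<in>sst n S. pmonom (image_mset \<pi> M + weight S T)))"
    by (simp add: alternant_def spoly_def sum_distrib_right sum_distrib_left mult.assoc pmonom_mult)
      (rule sum.swap)
  also have "\<dots> = (\<Sum>\<pi> | \<pi> permutes {..<n}.
      of_int (sign \<pi>) * (\<Sum>T\<in>sst n S. pmonom (image_mset \<pi> (M + weight S T))))"
    using sym by (intro sum.cong) auto
  also have "\<dots> = (\<Sum>T\<in>sst n S. alternant n (M + weight S T))"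
    unfolding alternant_def sum_distrib_left by (rule sum.swap)
  finally show ?thesis .
qed

text \<open>The staircase of exponents n - 1, ..., 1, 0, whose alternant is the Vandermonde
  determinant. Its steps of size one are what the cancellation below relies on.\<close>

definition rho :: "nat \<Rightarrow> nat multiset" where
  "rho n = (\<Sum>k<n. replicate_mset (n - 1 - k) k)"

lemma count_rho: "count (rho n) k = n - 1 - k"
proof -
  have "count (rho n) k = (\<Sum>i<n. if i = k then n - 1 - k else 0)"
    unfolding rho_def count_sum by (intro sum.cong) auto
  then show ?thesis by auto
qed

text \<open>The exponents are pairwise distinct, so only the identity fixes \<open>rho n\<close>,
  and the coefficient of that monomial is 1.\<close>

lemma alternant_rho_nonzero: "alternant n (rho n) \<noteq> 0"
proof -
  let ?P = "{\<pi>. \<pi> permutes {..<n}}"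
  have fix_rho: "\<pi> = id" if \<pi>: "\<pi> permutes {..<n}" and eq: "image_mset \<pi> (rho n) = rho n" for \<pi>
  proof
    fix k
    show "\<pi> k = id k"
    proof (cases "k < n")
      case True
      have "count (rho n) (\<pi> k) = count (rho n) k"
        using count_image_mset_inj[OF permutes_inj[OF \<pi>], of "rho n" k] eq by simp
      moreover have "\<pi> k < n" using permutes_in_image[OF \<pi>] True by auto
      ultimately show ?thesis using True by (simp add: count_rho)
    next
      case False
      then show ?thesis using \<pi> by (simp add: permutes_def)
    qed
  qed
  have "pcoeff (alternant n (rho n)) (rho n) = (\<Sum>\<pi>\<in>?P. if \<pi> = id then 1 else 0)"
    unfolding alternant_def pcoeff_sum
    using fix_rho by (intro sum.cong) (auto simp: pcoeff_pmonom)
  also have "\<dots> = 1"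
    using finite_permutations[OF finite_lessThan, of n] permutes_id by (subst sum.delta) auto
  finally show ?thesis by auto
qed

section \<open>Stembridge's cancellation\<close>

text \<open>The partition \<open>\<mu>\<close> stays a partition when the columns of \<open>T\<close> are added to it from right to left.\<close>

definition col_lattice :: "partition \<Rightarrow> cell set \<Rightarrow> filling \<Rightarrow> bool" where
  "col_lattice \<mu> S T \<longleftrightarrow> (\<forall>j k.
     part \<mu> (Suc k) + card {c \<in> S. j \<le> col c \<and> T c = Suc k} \<le> part \<mu> k + card {c \<in> S. j \<le> col c \<and> T c = k})"

definition shape_content :: "partition \<Rightarrow> nat multiset" where
  "shape_content \<mu> = weight (diagram \<mu>) row"

lemma count_shape_content: "count (shape_content \<mu>) k = part \<mu> k"
proof -
  have "{c \<in> diagram \<mu>. row c = k} = {k} \<times> {..<part \<mu> k}"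
    by (auto simp: diagram_def)
  then show ?thesis
    by (simp add: shape_content_def count_weight finite_diagram card_cartesian_product)
qed

lemma shape_content_inj: "shape_content \<mu> = shape_content \<nu> \<Longrightarrow> \<mu> = \<nu>"
  by (metis count_shape_content ext part_inject)

context
  fixes \<mu> :: partition and S :: "cell set" and n :: nat
  assumes S: "finite S" "convex_cells S" and \<mu>: "part \<mu> n = 0"
begin

private definition col_count :: "filling \<Rightarrow> nat \<Rightarrow> nat \<Rightarrow> nat" where
  "col_count T j k = card {c \<in> S. j \<le> col c \<and> T c = k}"

private definition violation :: "filling \<Rightarrow> nat \<Rightarrow> nat \<Rightarrow> bool" where
  "violation T j k \<longleftrightarrow> part \<mu> k + col_count T j k < part \<mu> (Suc k) + col_count T j (Suc k)"

text \<open>Taking the rightmost bad column first, and then the least value, makes the choice depend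
  only on the columns from \<open>j\<close> on, which the flip leaves alone.\<close>

private definition critical :: "filling \<Rightarrow> nat \<times> nat \<Rightarrow> bool" where
  "critical T = (\<lambda>(j, k). violation T j k \<and> (\<forall>j'>j. \<forall>k'. \<not> violation T j' k') \<and> (\<forall>k'<k. \<not> violation T j k'))"

lemma not_col_lattice: "\<not> col_lattice \<mu> S T \<longleftrightarrow> (\<exists>j k. violation T j k)"
  by (auto simp: col_lattice_def violation_def col_count_def not_le)

lemma critical_unique: "critical T x \<Longrightarrow> critical T y \<Longrightarrow> x = y"
proof -
  assume xy: "critical T x" "critical T y"
  obtain i k j l where [simp]: "x = (i, k)" "y = (j, l)" by fastforce
  have "i = j"
    using xy by (simp add: critical_def) (metis linorder_neqE_nat)
  then have "k = l"
    using xy by (simp add: critical_def) (metis linorder_neqE_nat)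
  with \<open>i = j\<close> show "x = y" by simp
qed

text \<open>Beyond the last column of \<open>S\<close> nothing is violated because \<mu> is a
  partition, so a rightmost violation exists.\<close>

lemma critical_exists:
  assumes "violation T j k"
  shows "\<exists>x. critical T x"
proof -
  obtain m where m: "\<forall>c\<in>S. col c < m"
    using iffD1[OF finite_nat_set_iff_bounded finite_imageI[OF S(1)]] by blast
  have above: "\<not> violation T j k" if "m \<le> j" for j k
  proof -
    have "\<not> j \<le> col c" if "c \<in> S" for c
      using bspec[OF m that] \<open>m \<le> j\<close> by simp
    then have "{c \<in> S. j \<le> col c \<and> T c = Suc k} = {}" by blast
    then have "col_count T j (Suc k) = 0" by (simp only: col_count_def card.empty)
    then show ?thesis using antimono_part[of k "Suc k" \<mu>] by (simp add: violation_def)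
  qed
  have bound: "j \<le> m" if "\<exists>k. violation T j k" for j
  proof (rule ccontr)
    assume "\<not> j \<le> m"
    then have "m \<le> j" by simp
    with that show False using above by blast
  qed
  define j0 where "j0 = (GREATEST j. \<exists>k. violation T j k)"
  have j0: "\<exists>k. violation T j0 k"
  proof -
    have "\<exists>k. violation T j k" using assms ..
    from GreatestI_nat[of "\<lambda>j. \<exists>k. violation T j k", OF this bound] show ?thesis
      by (simp add: j0_def)
  qed
  have "\<not> violation T j' k'" if "j0 < j'" for j' k'
  proof
    assume "violation T j' k'"
    then have "\<exists>k. violation T j' k" ..
    from Greatest_le_nat[of "\<lambda>j. \<exists>k. violation T j k", OF this bound]
    show False using that by (simp add: j0_def)
  qed
  moreover obtain k0 where "violation T j0 k0" "\<And>k'. k' < k0 \<Longrightarrow> \<not> violation T j0 k'"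
    using j0 exists_least_iff[of "violation T j0"] by blast
  ultimately have "critical T (j0, k0)"
    by (simp add: critical_def)
  then show ?thesis ..
qed

lemma col_count_step:
  "col_count T j k = col_count T (Suc j) k + card {c \<in> S. col c = j \<and> T c = k}"
proof -
  have "{c \<in> S. j \<le> col c \<and> T c = k} = {c \<in> S. Suc j \<le> col c \<and> T c = k} \<union> {c \<in> S. col c = j \<and> T c = k}"
    by auto
  moreover have "card ({c \<in> S. Suc j \<le> col c \<and> T c = k} \<union> {c \<in> S. col c = j \<and> T c = k}) =
      card {c \<in> S. Suc j \<le> col c \<and> T c = k} + card {c \<in> S. col c = j \<and> T c = k}"
    using S(1) by (intro card_Un_disjoint) auto
  ultimately show ?thesis by (simp only: col_count_def)
qed

text \<open>Just right of column \<open>j\<close> the inequality still holds, and a column contains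
  each value at most once. So column \<open>j\<close> must contain k + 1 but not k, and the excess
  is exactly one.\<close>

lemma critical_column:
  assumes T: "T \<in> sst n S" and crit: "critical T (j, k)"
  shows "Suc k < n" "part \<mu> k + col_count T j k + 1 = part \<mu> (Suc k) + col_count T j (Suc k)"
    "\<And>c. c \<in> S \<Longrightarrow> col c = j \<Longrightarrow> T c \<noteq> k"
proof -
  have ss: "semistandard S T" using T by (simp add: sst_def)
  let ?C = "\<lambda>k. {c \<in> S. col c = j \<and> T c = k}"
  have fin: "finite (?C k)" for k using S by simp
  have one: "card (?C k) \<le> 1" for k
  proof -
    have "c = d" if "c \<in> ?C k" "d \<in> ?C k" for c d
    proof -
      from that have cd: "c \<in> S" "d \<in> S" "col c = col d" "T c = T d" by auto
      have "\<not> row c < row d" "\<not> row d < row c"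
        using semistandard_col[OF ss cd(1-3)] semistandard_col[OF ss cd(2,1) cd(3)[symmetric]] cd(4)
        by auto
      with cd(3) show "c = d" by (simp add: prod_eq_iff)
    qed
    then show ?thesis using fin[of k] by (simp add: card_le_Suc0_iff_eq)
  qed
  have viol: "part \<mu> k + col_count T j k < part \<mu> (Suc k) + col_count T j (Suc k)"
    and no: "\<not> part \<mu> k + col_count T (Suc j) k < part \<mu> (Suc k) + col_count T (Suc j) (Suc k)"
    using crit by (auto simp: critical_def violation_def)
  have C: "card (?C k) = 0"  and eq: "part \<mu> k + col_count T j k + 1 = part \<mu> (Suc k) + col_count T j (Suc k)"
    using viol no one[of k] one[of "Suc k"] col_count_step[of T j k] col_count_step[of T j "Suc k"] by linarith+
  show "part \<mu> k + col_count T j k + 1 = part \<mu> (Suc k) + col_count T j (Suc k)" by (fact eq)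
  show "T c \<noteq> k" if "c \<in> S" "col c = j" for c
  proof
    assume "T c = k"
    with that have "c \<in> ?C k" by simp
    with C fin[of k] show False by (metis card_0_eq empty_iff)
  qed
  have "col_count T j (Suc k) > 0"
    using viol antimono_part[of k "Suc k" \<mu>] by linarith
  then obtain c where "c \<in> S" "T c = Suc k"
    unfolding col_count_def card_gt_0_iff by blast
  then show "Suc k < n" using T unfolding sst_def by force
qed

private definition flip_left :: "filling \<Rightarrow> filling" where
  "flip_left T = (case (SOME x. critical T x) of (j, k) \<Rightarrow> bk k {c \<in> S. col c < j} T)"

lemma flip_left_eq: "critical T (j, k) \<Longrightarrow> flip_left T = bk k {c \<in> S. col c < j} T"
  unfolding flip_left_def using critical_unique someI[of "critical T"]
  by (metis (mono_tags, lifting) case_prod_conv)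

text \<open>The exponents contributed by \<open>rho n\<close>, \<mu> and the columns from
  \<open>j\<close> on have equal multiplicities at k and k + 1, hence are invariant under exchanging
  the two. The flip exchanges them in the remaining weight, so it acts on the whole exponent
  multiset by a transposition and the alternant changes sign.\<close>

lemma flip_left_props:
  assumes T: "T \<in> sst n S" and crit: "critical T (j, k)"
  shows "flip_left T \<in> sst n S" "critical (flip_left T) (j, k)" "flip_left (flip_left T) = T"
    "alternant n (rho n + shape_content \<mu> + weight S (flip_left T)) =
      - alternant n (rho n + shape_content \<mu> + weight S T)"
proof -
  let ?L = "{c \<in> S. col c < j}"
  let ?R = "{c \<in> S. \<not> col c < j}"
  let ?U = "flip_left T"
  have U: "?U = bk k ?L T" by (rule flip_left_eq[OF crit])
  have ss: "semistandard S T" using T by (simp add: sst_def)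
  have ssL: "semistandard ?L T" by (rule semistandard_subset[OF ss]) auto
  have L: "finite ?L" "convex_cells ?L" using S convex_cells_left by auto
  note k = critical_column[OF T crit]
  have right: "?U c = T c" if "\<not> col c < j" for c
    using that by (simp add: U bk_def)
  have act: "active k ?L ?U = active k ?L T" unfolding U by (rule active_bk[OF L ssL])
  have bk_vals: "?U c \<in> {k, Suc k}" if "c \<in> ?L" "T c \<in> {k, Suc k}" for c
    using act that by (auto simp: active_def)
  have unchanged: "?U c = T c" if "T c \<notin> {k, Suc k}" for c
    unfolding U using that
    by (intro bk_nonfree[OF L ssL]) (auto simp: free_cells_def active_def)
  have ssU: "semistandard ?L ?U"
    unfolding U by (rule semistandard_bk[OF L ssL])
  have "semistandard S ?U"
    unfolding semistandard_def
  proof (intro ballI conjI impI; elim conjE)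
    fix y z assume yz: "y \<in> S" "z \<in> S" "row y = row z" "col y < col z"
    have le: "T y \<le> T z" using semistandard_row[OF ss] yz by auto
    consider "col z < j" | "\<not> col y < j" | "col y < j" "\<not> col z < j" by blast
    then show "?U y \<le> ?U z"
    proof cases
      case 1
      then show ?thesis using yz semistandard_row[OF ssU, of y z] by simp
    next
      case 2
      then show ?thesis using yz le right by simp
    next
      case 3
      \<comment> \<open>The only danger for a row crossing the cut is an entry k on the left raised
        to k + 1 before an entry k on the right. Convexity would then put an entry k into column
        \<open>j\<close>.\<close>
      have "T z \<noteq> k" if "T y = k"
      proof
        assume "T z = k"
        have m: "(row y, j) \<in> S"
          using yz 3 by (intro convex_cellsD[OF S(2) yz(1,2)]) auto
        have "T y \<le> T (row y, j)" "T (row y, j) \<le> T z"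
          using semistandard_row[OF ss yz(1) m] semistandard_row[OF ss m yz(2)] yz 3 by auto
        with k(3)[OF m] \<open>T y = k\<close> \<open>T z = k\<close> show False by simp
      qed
      then show ?thesis
        using bk_vals[of y] unchanged[of y] right[of z] yz 3 le by (cases "T y \<in> {k, Suc k}") auto
    qed
  next
    fix y z assume yz: "y \<in> S" "z \<in> S" "col y = col z" "row y < row z"
    show "?U y < ?U z"
    proof (cases "col y < j")
      case True
      then show ?thesis using yz by (intro semistandard_col[OF ssU]) auto
    next
      case False
      then have "?U y = T y" "?U z = T z" using right[of y] right[of z] yz(3) by auto
      then show ?thesis using semistandard_col[OF ss yz] by (simp only:)
    qed
  qed
  moreover have "?U c < n" if "c \<in> S" for c
  proof (cases "T c \<in> {k, Suc k} \<and> c \<in> ?L")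
    case True
    then show ?thesis using bk_vals[of c] k(1) by auto
  next
    case False
    then have "?U c = T c" using unchanged[of c] right[of c] that by auto
    then show ?thesis using T that by (simp add: sst_def)
  qed
  moreover have "?U c = 0" if "c \<notin> S" for c
  proof -
    have "T c = 0" using T that unfolding sst_def by blast
    then show ?thesis using that by (simp add: U bk_def)
  qed
  ultimately show "?U \<in> sst n S" by (simp add: sst_def)
  have "col_count ?U j' k' = col_count T j' k'" if "j \<le> j'" for j' k'
    unfolding col_count_def using that right by (intro arg_cong[of _ _ card]) auto
  then have "violation ?U j' k' = violation T j' k'" if "j \<le> j'" for j' k'
    using that by (simp add: violation_def)
  then show critU: "critical ?U (j, k)"
    using crit unfolding critical_def by force
  show "flip_left ?U = T"
    unfolding flip_left_eq[OF critU] unfolding U by (rule bk_involution[OF L ssL])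
  let ?s = "transpose k (Suc k)"
  define M where "M = rho n + shape_content \<mu> + weight ?R T"
  have "{c \<in> ?R. T c = i} = {c \<in> S. j \<le> col c \<and> T c = i}" for i by auto
  then have cnt: "count M i = (n - 1 - i) + part \<mu> i + col_count T j i" for i
    using S(1) by (simp add: M_def count_rho count_shape_content count_weight col_count_def)
  \<comment> \<open>As \<open>Suc k < n\<close>, the truncated difference in \<open>rho\<close>
    drops by exactly one, which offsets the excess of one at the critical column.\<close>
  have cnt_eq: "count M (Suc k) = count M k"
    using k(1,2) unfolding cnt by simp
  have inv: "image_mset ?s M = M"
  proof (rule multiset_eqI)
    fix i
    have "count (image_mset ?s M) i = count M (?s i)"
      using count_image_mset_inj[OF inj_transpose, of k "Suc k" M "?s i"] by simp
    also have "\<dots> = count M i" using cnt_eq by (simp add: transpose_def)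
    finally show "count (image_mset ?s M) i = count M i" .
  qed
  have wL: "weight ?L ?U = image_mset ?s (weight ?L T)"
    unfolding U by (rule weight_bk[OF L ssL])
  have wR: "weight ?R ?U = weight ?R T"
    by (rule weight_cong) (use right in auto)
  have "rho n + shape_content \<mu> + weight S ?U = M + image_mset ?s (weight ?L T)"
    unfolding M_def weight_split[OF S(1), of ?U "\<lambda>c. col c < j"] wL wR by (simp only: ac_simps)
  also have "\<dots> = image_mset ?s (M + weight ?L T)"
    unfolding image_mset_union[of ?s M] inv ..
  also have "M + weight ?L T = rho n + shape_content \<mu> + weight S T"
    unfolding M_def weight_split[OF S(1), of T "\<lambda>c. col c < j"] by (simp only: ac_simps)
  finally have "rho n + shape_content \<mu> + weight S ?U = image_mset ?s (rho n + shape_content \<mu> + weight S T)" .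
  moreover have "?s permutes {..<n}" using k(1) by (intro permutes_swap_id) auto
  ultimately show "alternant n (rho n + shape_content \<mu> + weight S ?U) =
      - alternant n (rho n + shape_content \<mu> + weight S T)"
    by (simp only: alternant_permute) (simp add: sign_swap_id)
qed

lemma stembridge:
  "alternant n (rho n + shape_content \<mu>) * spoly n (\<lambda>t. t) S =
     (\<Sum>T | T \<in> sst n S \<and> col_lattice \<mu> S T. alternant n (rho n + shape_content \<mu> + weight S T))"
proof -
  let ?A = "\<lambda>T. alternant n (rho n + shape_content \<mu> + weight S T)"
  let ?good = "{T \<in> sst n S. col_lattice \<mu> S T}"
  let ?bad = "{T \<in> sst n S. \<not> col_lattice \<mu> S T}"
  have crit: "\<exists>j k. critical T (j, k)" if "T \<in> ?bad" for T
    using that critical_exists by (auto simp: not_col_lattice)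
  have bad: "flip_left T \<in> ?bad" "flip_left (flip_left T) = T" "?A (flip_left T) = - ?A T"
    if "T \<in> ?bad" for T
  proof -
    from crit[OF that] obtain j k where "critical T (j, k)" by blast
    note p = flip_left_props[OF _ this]
    have T: "T \<in> sst n S" using that by simp
    show "flip_left T \<in> ?bad"
      using p(1,2)[OF T] not_col_lattice by (auto simp: critical_def)
    show "flip_left (flip_left T) = T" "?A (flip_left T) = - ?A T"
      by (rule p[OF T])+
  qed
  have "(\<Sum>T\<in>?bad. ?A T) = (\<Sum>T\<in>?bad. - ?A T)"
    by (rule sum.reindex_bij_witness[where i = flip_left and j = flip_left]) (use bad in auto)
  then have "(\<Sum>T\<in>?bad. ?A T) = - (\<Sum>T\<in>?bad. ?A T)" by (simp add: sum_negf)
  moreover have "f = 0" if "f = - f" for f :: "nat pser"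
  proof (rule pser_eqI)
    show "pcoeff f M = pcoeff 0 M" for M
      using pcoeff_uminus[of f M] that by simp
  qed
  ultimately have 0: "(\<Sum>T\<in>?bad. ?A T) = 0" by blast
  have "(\<Sum>T\<in>sst n S. ?A T) = (\<Sum>T\<in>?good. ?A T) + (\<Sum>T\<in>?bad. ?A T)"
  proof -
    have "sst n S = ?good \<union> ?bad" by blast
    moreover have "sum ?A (?good \<union> ?bad) = sum ?A ?good + sum ?A ?bad"
      using finite_sst[OF S(1), of n] by (intro sum.union_disjoint) auto
    ultimately show ?thesis by (simp only:)
  qed
  with 0 show ?thesis by (simp add: alternant_mult_spoly[OF S])
qed

end


section \<open>Adding the content of a lattice filling to a partition\<close>

lemma col_latticeD:
  "col_lattice \<mu> S T \<Longrightarrow>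
    part \<mu> (Suc k) + card {c \<in> S. j \<le> col c \<and> T c = Suc k} \<le> part \<mu> k + card {c \<in> S. j \<le> col c \<and> T c = k}"
  unfolding col_lattice_def by blast

definition add_shape :: "partition \<Rightarrow> cell set \<Rightarrow> filling \<Rightarrow> partition" where
  "add_shape \<mu> S T = Partition (\<lambda>k. part \<mu> k + card {c \<in> S. T c = k})"

text \<open>At column 0 the lattice condition counts the whole filling and so makes the new row
  lengths weakly decreasing, as \<open>Partition\<close> requires.\<close>

lemma part_add_shape:
  assumes "finite S" "col_lattice \<mu> S T"
  shows "part (add_shape \<mu> S T) k = part \<mu> k + card {c \<in> S. T c = k}"
proof -
  let ?f = "\<lambda>k. part \<mu> k + card {c \<in> S. T c = k}"
  have "?f (Suc k) \<le> ?f k" for k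
    using col_latticeD[OF assms(2), of k 0] by simp
  then have "antimono ?f" unfolding antimono_iff_le_Suc by blast
  moreover have "finite {k. ?f k \<noteq> 0}"
  proof (rule finite_subset)
    show "{k. ?f k \<noteq> 0} \<subseteq> {k. part \<mu> k \<noteq> 0} \<union> T ` S"
    proof
      fix k assume "k \<in> {k. ?f k \<noteq> 0}"
      then have "part \<mu> k \<noteq> 0 \<or> {c \<in> S. T c = k} \<noteq> {}" by (auto simp del: Collect_empty_eq)
      then show "k \<in> {k. part \<mu> k \<noteq> 0} \<union> T ` S" by auto
    qed
    show "finite ({k. part \<mu> k \<noteq> 0} \<union> T ` S)"
      using part[of \<mu>] assms(1) by simp
  qed
  ultimately show ?thesis
    unfolding add_shape_def by (subst Partition_inverse) auto
qed

lemma shape_content_add_shape: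
  assumes "finite S" "col_lattice \<mu> S T"
  shows "shape_content (add_shape \<mu> S T) = shape_content \<mu> + weight S T"
  by (rule multiset_eqI) (simp add: count_shape_content part_add_shape[OF assms] count_weight assms)

lemma card_add_shape:
  assumes "finite S" "col_lattice \<mu> S T"
  shows "card (diagram (add_shape \<mu> S T)) = card (diagram \<mu>) + card S"
  using arg_cong[OF shape_content_add_shape[OF assms], of size]
  by (simp add: shape_content_def size_weight)

lemma diagram_subset_iff: "diagram \<alpha> \<subseteq> diagram \<beta> \<longleftrightarrow> (\<forall>k. part \<alpha> k \<le> part \<beta> k)"
proof
  assume sub: "diagram \<alpha> \<subseteq> diagram \<beta>"
  show "\<forall>k. part \<alpha> k \<le> part \<beta> k"
  proof (rule allI, rule ccontr)
    fix k assume "\<not> part \<alpha> k \<le> part \<beta> k"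
    then have "(k, part \<beta> k) \<in> diagram \<alpha>" "(k, part \<beta> k) \<notin> diagram \<beta>"
      by (simp_all add: diagram_def)
    with sub show False by blast
  qed
next
  assume "\<forall>k. part \<alpha> k \<le> part \<beta> k"
  then show "diagram \<alpha> \<subseteq> diagram \<beta>"
    unfolding diagram_def by (auto intro: less_le_trans)
qed

lemma part_eq_0I:
  assumes "card (diagram \<alpha>) \<le> n"
  shows "part \<alpha> n = 0"
proof (rule ccontr)
  assume "part \<alpha> n \<noteq> 0"
  then have "(\<lambda>k. (k, 0)) ` {..n} \<subseteq> diagram \<alpha>"
    using antimono_part[of _ n \<alpha>] by (force simp: diagram_def)
  from card_mono[OF finite_diagram this] have "Suc n \<le> card (diagram \<alpha>)"
    by (simp add: card_image inj_on_def)
  with assms show False by simp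
qed

lemma row_less: "part \<alpha> n = 0 \<Longrightarrow> c \<in> diagram \<alpha> \<Longrightarrow> row c < n"
  using antimono_part[of n "row c" \<alpha>] by (cases "row c < n") (auto simp: diagram_def)

section \<open>The bialternant formula and products with Schur polynomials\<close>

definition empty_partition :: partition where
  "empty_partition = Partition (\<lambda>_. 0)"

lemma part_empty [simp]: "part empty_partition k = 0"
  unfolding empty_partition_def by (subst Partition_inverse) (auto simp: antimono_def)

lemma diagram_empty [simp]: "diagram empty_partition = {}"
  by (simp add: diagram_def)

definition row_tableau :: "partition \<Rightarrow> filling" where
  "row_tableau \<alpha> c = (if c \<in> diagram \<alpha> then row c else 0)"

text \<open>Strict columns force every entry to be at least its row index. If an entry in row
  \<open>p\<close> were k + 1 > \<open>p\<close>, the lattice condition would provide an entry k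
  weakly to the right: in row \<open>p\<close> or below it would be too small, and higher up the
  rows hold their own indices, all less than \<open>p\<close>.\<close>

lemma col_lattice_empty_iff:
  assumes n: "part \<alpha> n = 0" and T: "T \<in> sst n (diagram \<alpha>)"
  shows "col_lattice empty_partition (diagram \<alpha>) T \<longleftrightarrow> T = row_tableau \<alpha>"
proof
  let ?D = "diagram \<alpha>"
  have ss: "semistandard ?D T" and zero: "\<And>c. c \<notin> ?D \<Longrightarrow> T c = 0"
    using T unfolding sst_def by blast+
  assume lat: "col_lattice empty_partition ?D T"
  have "T (p, q) = p" if "(p, q) \<in> ?D" for p q
    using that
  proof (induction p arbitrary: q rule: less_induct)
    case (less p)
    have ge: "p \<le> T (p, q)"
    proof (cases p)
      case (Suc p')
      have "(p', q) \<in> ?D" using less.prems Suc by (auto intro: diagram_closed)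
      then have "T (p', q) < T (p, q)" "T (p', q) = p'"
        using semistandard_col[OF ss _ less.prems, of "(p', q)"] less.IH[of p' q] Suc by auto
      with Suc show ?thesis by simp
    qed simp
    show ?case
    proof (rule ccontr)
      assume "T (p, q) \<noteq> p"
      with ge obtain k where k: "T (p, q) = Suc k" "p \<le> k" by (cases "T (p, q)") auto
      have "card {c \<in> ?D. q \<le> col c \<and> T c = Suc k} > 0"
        using less.prems k finite_diagram[of \<alpha>] by (auto simp: card_gt_0_iff)
      then have "card {c \<in> ?D. q \<le> col c \<and> T c = k} > 0"
        using col_latticeD[OF lat, of k q] by simp
      then obtain c where c: "c \<in> ?D" "q \<le> col c" "T c = k"
        by (auto simp: card_gt_0_iff)
      have "row c < p"
      proof (rule ccontr)
        assume "\<not> row c < p"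
        then have "T (p, q) \<le> T c"
          using semistandard_le(1)[OF convex_diagram ss less.prems c(1)] c(2) by simp
        with c k show False by simp
      qed
      with less.IH[of "row c" "col c"] c k show False by simp
    qed
  qed
  then show "T = row_tableau \<alpha>"
    using zero by (auto simp: row_tableau_def fun_eq_iff)
next
  assume T: "T = row_tableau \<alpha>"
  have "{c \<in> diagram \<alpha>. j \<le> col c \<and> T c = k} = {k} \<times> {j..<part \<alpha> k}" for j k
    unfolding T by (auto simp: row_tableau_def diagram_def)
  then show "col_lattice empty_partition (diagram \<alpha>) T"
    unfolding col_lattice_def
    by (simp add: card_cartesian_product diff_le_mono antimono_part)
qed

lemma row_tableau_sst:
  assumes "part \<alpha> n = 0"
  shows "row_tableau \<alpha> \<in> sst n (diagram \<alpha>)"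
  using row_less[OF assms] by (simp add: sst_def row_tableau_def semistandard_def)

lemma weight_row_tableau: "weight (diagram \<alpha>) (row_tableau \<alpha>) = shape_content \<alpha>"
  unfolding shape_content_def by (rule weight_cong) (simp add: row_tableau_def)

text \<open>The bialternant formula, as Stembridge's identity at the empty partition: only the
  tableau with every entry equal to its row index survives.\<close>

lemma alternant_rho_mult_spoly:
  assumes "part \<alpha> n = 0"
  shows "alternant n (rho n) * spoly n (\<lambda>t. t) (diagram \<alpha>) = alternant n (rho n + shape_content \<alpha>)"
proof -
  have 0: "shape_content empty_partition = {#}" by (simp add: shape_content_def weight_def)
  have "{T. T \<in> sst n (diagram \<alpha>) \<and> col_lattice empty_partition (diagram \<alpha>) T} = {row_tableau \<alpha>}"
    using col_lattice_empty_iff[OF assms] row_tableau_sst[OF assms] by blast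
  with stembridge[OF finite_diagram convex_diagram, of empty_partition n \<alpha>] show ?thesis
    by (simp add: 0 weight_row_tableau)
qed

text \<open>After multiplication by the alternant of \<open>rho n\<close>, the bialternant formula
  turns each surviving alternant back into a Schur polynomial, and the common factor is
  cancelled.\<close>

lemma spoly_mult_lattice:
  assumes S: "finite S" "convex_cells S" and \<mu>: "part \<mu> n = 0"
  shows "spoly n x (diagram \<mu>) * spoly n x S =
    (\<Sum>T | T \<in> sst n S \<and> col_lattice \<mu> S T. spoly n x (diagram (add_shape \<mu> S T)))"
proof -
  let ?G = "{T. T \<in> sst n S \<and> col_lattice \<mu> S T}"
  let ?s = "\<lambda>S. spoly n (\<lambda>t. t) S"
  have "alternant n (rho n) * (?s (diagram \<mu>) * ?s S) = (\<Sum>T\<in>?G. alternant n (rho n + shape_content \<mu> + weight S T))"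
    by (simp add: mult.assoc[symmetric] alternant_rho_mult_spoly[OF \<mu>] stembridge[OF S \<mu>])
  also have "\<dots> = (\<Sum>T\<in>?G. alternant n (rho n) * ?s (diagram (add_shape \<mu> S T)))"
  proof (rule sum.cong)
    fix T assume T: "T \<in> ?G"
    then have "\<forall>c\<in>S. T c < n" unfolding sst_def by blast
    \<comment> \<open>Entries stay below \<open>n\<close>, so row \<open>n\<close> of the new
      partition remains empty and the bialternant formula applies to it.\<close>
    then have "{c \<in> S. T c = n} = {}" by auto
    then have "part (add_shape \<mu> S T) n = 0"
      using T \<mu> by (simp add: part_add_shape S(1))
    with T show "alternant n (rho n + shape_content \<mu> + weight S T) =
        alternant n (rho n) * ?s (diagram (add_shape \<mu> S T))"
      by (simp add: alternant_rho_mult_spoly shape_content_add_shape S(1) add.assoc)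
  qed simp
  finally have "?s (diagram \<mu>) * ?s S = (\<Sum>T\<in>?G. ?s (diagram (add_shape \<mu> S T)))"
    unfolding sum_distrib_left[symmetric] by (rule nat_pser_mult_left_cancel[OF _ alternant_rho_nonzero])
  then have "psubst {..<n} x (?s (diagram \<mu>) * ?s S) =
      psubst {..<n} x (\<Sum>T\<in>?G. ?s (diagram (add_shape \<mu> S T)))" by (simp only:)
  then show ?thesis
    unfolding psubst_mult[OF finite_lessThan] psubst_sum psubst_spoly[OF finite_diagram] psubst_spoly[OF S(1)] .
qed


section \<open>Reading order and lattice fillings\<close>

definition reads_le :: "cell \<Rightarrow> cell \<Rightarrow> bool" where
  "reads_le d c \<longleftrightarrow> row d < row c \<or> (row d = row c \<and> col c \<le> col d)"

lemma reads_le_refl [simp]: "reads_le c c"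
  by (simp add: reads_le_def)

lemma reads_le_trans: "reads_le a b \<Longrightarrow> reads_le b c \<Longrightarrow> reads_le a c"
  by (auto simp: reads_le_def)

lemma reads_le_linear: "reads_le a b \<or> reads_le b a"
  by (auto simp: reads_le_def)

lemma reads_le_antisym: "reads_le a b \<Longrightarrow> reads_le b a \<Longrightarrow> a = b"
  by (auto simp: reads_le_def prod_eq_iff)

lemma rl_eq: "rl S c = card {d \<in> S. reads_le d c}"
  unfolding rl_def reads_le_def by simp

lemma rl_le_iff:
  assumes "finite S" "c \<in> S" "d \<in> S"
  shows "rl S d \<le> rl S c \<longleftrightarrow> reads_le d c"
proof
  assume "reads_le d c"
  then have "{e \<in> S. reads_le e d} \<subseteq> {e \<in> S. reads_le e c}"
    using reads_le_trans by blast
  then show "rl S d \<le> rl S c"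
    unfolding rl_eq using assms(1) by (intro card_mono) auto
next
  assume le: "rl S d \<le> rl S c"
  show "reads_le d c"
  proof (rule ccontr)
    assume n: "\<not> reads_le d c"
    then have "reads_le c d" using reads_le_linear by blast
    then have "{e \<in> S. reads_le e c} \<subset> {e \<in> S. reads_le e d}"
      using n assms reads_le_trans reads_le_refl by blast
    then have "rl S c < rl S d"
      unfolding rl_eq using assms(1) by (intro psubset_card_mono) auto
    with le show False by simp
  qed
qed

lemma rl_inj: "finite S \<Longrightarrow> inj_on (rl S) S"
  by (rule inj_onI) (metis order_refl reads_le_antisym rl_le_iff)

lemma rl_bij:
  assumes "finite S"
  shows "bij_betw (rl S) S {1..card S}"
proof -
  have "rl S ` S \<subseteq> {1..card S}"
  proof
    fix i assume "i \<in> rl S ` S"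
    then obtain c where c: "c \<in> S" "i = card {d \<in> S. reads_le d c}" by (auto simp: rl_eq)
    have "c \<in> {d \<in> S. reads_le d c}" "finite {d \<in> S. reads_le d c}" using c assms by auto
    then have "i > 0" unfolding c(2) card_gt_0_iff by blast
    moreover have "i \<le> card S" unfolding c(2) using assms by (intro card_mono) auto
    ultimately show "i \<in> {1..card S}" by simp
  qed
  moreover have "card (rl S ` S) = card {1..card S}"
    using card_image[OF rl_inj[OF assms]] by simp
  ultimately have "rl S ` S = {1..card S}"
    by (intro card_subset_eq) auto
  then show ?thesis using rl_inj[OF assms] by (simp add: bij_betw_def)
qed

lemma rl_left_neighbour:
  assumes "finite S" "(p, q) \<in> S" "(p, Suc q) \<in> S"
  shows "rl S (p, q) = Suc (rl S (p, Suc q))"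
proof -
  have "{d \<in> S. reads_le d (p, q)} = insert (p, q) {d \<in> S. reads_le d (p, Suc q)}"
    using assms(2) by (auto simp: reads_le_def)
  moreover have "(p, q) \<notin> {d \<in> S. reads_le d (p, Suc q)}" by (simp add: reads_le_def)
  ultimately show ?thesis using assms(1) by (simp add: rl_eq)
qed

text \<open>The reading-order counterpart of \<^const>\<open>col_lattice\<close>.\<close>

definition row_lattice :: "partition \<Rightarrow> cell set \<Rightarrow> filling \<Rightarrow> bool" where
  "row_lattice \<mu> S T \<longleftrightarrow> (\<forall>a\<in>S. \<forall>k. T a = Suc k \<longrightarrow>
     part \<mu> (Suc k) + card {c \<in> S. reads_le c a \<and> T c = Suc k} \<le>
     part \<mu> k + card {c \<in> S. reads_le c a \<and> T c = k})"

lemma row_latticeD: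
  "row_lattice \<mu> S T \<Longrightarrow> a \<in> S \<Longrightarrow> T a = Suc k \<Longrightarrow>
     part \<mu> (Suc k) + card {c \<in> S. reads_le c a \<and> T c = Suc k} \<le>
     part \<mu> k + card {c \<in> S. reads_le c a \<and> T c = k}"
  unfolding row_lattice_def by blast

context
  fixes S :: "cell set" and T :: filling
  assumes fin: "finite S" and conv: "convex_cells S" and ss: "semistandard S T"
begin

text \<open>Compare with the column condition at \<open>col a\<close>, for \<open>a\<close> holding
  k + 1. Entries k + 1 read by then cannot lie strictly to the left, since they would be strictly
  northwest of \<open>a\<close>; entries k in those columns lie strictly above \<open>a\<close>,
  hence are already read.\<close>

lemma col_lattice_imp_row_lattice:
  assumes "col_lattice \<mu> S T"
  shows "row_lattice \<mu> S T"
  unfolding row_lattice_def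
proof (intro ballI allI impI)
  fix a k assume a: "a \<in> S" "T a = Suc k"
  have "{c \<in> S. reads_le c a \<and> T c = Suc k} \<subseteq> {c \<in> S. col a \<le> col c \<and> T c = Suc k}"
  proof
    fix c assume "c \<in> {c \<in> S. reads_le c a \<and> T c = Suc k}"
    then have c: "c \<in> S" "reads_le c a" "T c = Suc k" by auto
    have "col a \<le> col c"
    proof (rule ccontr)
      assume n: "\<not> col a \<le> col c"
      then have "row c < row a" using c(2) by (auto simp: reads_le_def)
      then have "T c < T a" using n by (intro semistandard_le(2)[OF conv ss c(1) a(1)]) auto
      with a c show False by simp
    qed
    with c show "c \<in> {c \<in> S. col a \<le> col c \<and> T c = Suc k}" by simp
  qed
  then have 1: "card {c \<in> S. reads_le c a \<and> T c = Suc k} \<le> card {c \<in> S. col a \<le> col c \<and> T c = Suc k}"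
    using fin by (intro card_mono) auto
  have "{c \<in> S. col a \<le> col c \<and> T c = k} \<subseteq> {c \<in> S. reads_le c a \<and> T c = k}"
  proof
    fix c assume "c \<in> {c \<in> S. col a \<le> col c \<and> T c = k}"
    then have c: "c \<in> S" "col a \<le> col c" "T c = k" by auto
    have "row c < row a"
    proof (rule ccontr)
      assume n: "\<not> row c < row a"
      then have "T a \<le> T c" using c by (intro semistandard_le(1)[OF conv ss a(1) c(1)]) auto
      with a c show False by simp
    qed
    with c show "c \<in> {c \<in> S. reads_le c a \<and> T c = k}" by (simp add: reads_le_def)
  qed
  then have 2: "card {c \<in> S. col a \<le> col c \<and> T c = k} \<le> card {c \<in> S. reads_le c a \<and> T c = k}"
    using fin by (intro card_mono) auto
  show "part \<mu> (Suc k) + card {c \<in> S. reads_le c a \<and> T c = Suc k} \<le>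
      part \<mu> k + card {c \<in> S. reads_le c a \<and> T c = k}"
    using col_latticeD[OF assms, of k "col a"] 1 2 by linarith
qed

text \<open>Read up to the leftmost k + 1 in the lowest row \<open>p\<close> that has a k + 1 in
  columns from \<open>j\<close> on. Besides the entries counted by columns, the reading counts at
  least the k + 1 in \<open>C\<close> and at most the k in \<open>A\<close>, all left of column
  \<open>j\<close>; the excess on the side of k is harmless because \<open>A\<close> injects into
  \<open>C\<close>.\<close>

lemma row_lattice_imp_col_lattice:
  assumes lat: "row_lattice \<mu> S T"
  shows "col_lattice \<mu> S T"
  unfolding col_lattice_def
proof (intro allI)
  fix j k
  define X where "X = {c \<in> S. j \<le> col c \<and> T c = Suc k}"
  have finX: "finite X" using fin by (simp add: X_def)
  show "part \<mu> (Suc k) + card {c \<in> S. j \<le> col c \<and> T c = Suc k} \<le> part \<mu> k + card {c \<in> S. j \<le> col c \<and> T c = k}"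
  proof (cases "X = {}")
    case True
    then have "card {c \<in> S. j \<le> col c \<and> T c = Suc k} = 0" by (simp only: X_def card.empty)
    then show ?thesis using antimono_part[of k "Suc k" \<mu>] by linarith
  next
    case False
    define p where "p = Max (row ` X)"
    have "p \<in> row ` X" unfolding p_def using finX False by (intro Max_in) auto
    then obtain x where x: "x \<in> X" "row x = p" by blast
    have Xp: "row c \<le> p" if "c \<in> X" for c
      unfolding p_def using finX that by (intro Max_ge) auto
    define R where "R = {c \<in> S. row c = p \<and> T c = Suc k}"
    have R: "finite R" "x \<in> R" using fin x by (auto simp: R_def X_def)
    have "Min (col ` R) \<in> col ` R" using R by (intro Min_in) auto
    then obtain a where a: "a \<in> R" "col a = Min (col ` R)" by force
    have amin: "col a \<le> col c" if "c \<in> R" for c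
      unfolding a(2) using R that by (intro Min_le) auto
    have aS: "a \<in> S" "row a = p" "T a = Suc k" using a(1) by (auto simp: R_def)
    define A where "A = {c \<in> S. row c < p \<and> col c < j \<and> T c = k}"
    define C where "C = {c \<in> S. row c = p \<and> col c < j \<and> T c = Suc k}"
    \<comment> \<open>Move straight down to row \<open>p\<close>: the cell reached lies in
      \<open>S\<close> by convexity, and its entry exceeds k but is at most the k + 1 in
      \<open>x\<close>.\<close>
    have "card A \<le> card C"
    proof (rule card_inj_on_le)
      show "inj_on (\<lambda>c. (p, col c)) A"
      proof (rule inj_onI)
        fix c d assume cd: "c \<in> A" "d \<in> A" "(p, col c) = (p, col d)"
        then have mem: "c \<in> S" "d \<in> S" "T c = T d" "col c = col d" by (auto simp: A_def)
        have "\<not> row c < row d" "\<not> row d < row c"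
          using semistandard_col[OF ss mem(1,2,4)] semistandard_col[OF ss mem(2,1) mem(4)[symmetric]] mem(3)
          by auto
        with mem(4) show "c = d" by (simp add: prod_eq_iff)
      qed
      show "(\<lambda>c. (p, col c)) ` A \<subseteq> C"
      proof clarify
        fix r q assume "(r, q) \<in> A"
        then have rq: "(r, q) \<in> S" "r < p" "q < j" "T (r, q) = k" by (auto simp: A_def)
        have xS: "x \<in> S" "T x = Suc k" "j \<le> col x" using x by (auto simp: X_def)
        have m: "(p, q) \<in> S"
          using rq xS x by (intro convex_cellsD[OF conv rq(1) xS(1)]) auto
        have "T (r, q) < T (p, q)" "T (p, q) \<le> T x"
          using semistandard_col[OF ss rq(1) m] semistandard_row[OF ss m xS(1)] rq xS x by auto
        with rq xS m show "(p, col (r, q)) \<in> C" by (simp add: C_def)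
      qed
      show "finite C" using fin by (simp add: C_def)
    qed
    moreover have "card X + card C \<le> card {c \<in> S. reads_le c a \<and> T c = Suc k}"
    proof -
      have "X \<union> C \<subseteq> {c \<in> S. reads_le c a \<and> T c = Suc k}"
      proof
        fix c assume c: "c \<in> X \<union> C"
        then have "row c \<le> p" "c \<in> S" "T c = Suc k" using Xp[of c] by (auto simp: C_def X_def)
        moreover have "col a \<le> col c" if "row c = p"
          using amin[of c] that calculation by (simp add: R_def)
        ultimately show "c \<in> {c \<in> S. reads_le c a \<and> T c = Suc k}"
          using aS(2) by (auto simp: reads_le_def)
      qed
      then have "card (X \<union> C) \<le> card {c \<in> S. reads_le c a \<and> T c = Suc k}"
        using fin by (intro card_mono) auto
      moreover have "card (X \<union> C) = card X + card C"
        using fin by (intro card_Un_disjoint) (auto simp: X_def C_def)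
      ultimately show ?thesis by simp
    qed
    moreover have "card {c \<in> S. reads_le c a \<and> T c = k} \<le> card {c \<in> S. j \<le> col c \<and> T c = k} + card A"
    proof -
      have "{c \<in> S. reads_le c a \<and> T c = k} \<subseteq> {c \<in> S. j \<le> col c \<and> T c = k} \<union> A"
      proof
        fix c assume "c \<in> {c \<in> S. reads_le c a \<and> T c = k}"
        then have c: "c \<in> S" "reads_le c a" "T c = k" by auto
        have "row c < p"
        proof (rule ccontr)
          assume "\<not> row c < p"
          then have "row c = p" "col a \<le> col c" using c(2) aS(2) by (auto simp: reads_le_def)
          then have "T a \<le> T c" using semistandard_row[OF ss aS(1) c(1)] aS(2) by simp
          with aS c show False by simp
        qed
        with c show "c \<in> {c \<in> S. j \<le> col c \<and> T c = k} \<union> A" by (auto simp: A_def)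
      qed
      then have "card {c \<in> S. reads_le c a \<and> T c = k} \<le> card ({c \<in> S. j \<le> col c \<and> T c = k} \<union> A)"
        using fin by (intro card_mono) (auto simp: A_def)
      also have "\<dots> \<le> card {c \<in> S. j \<le> col c \<and> T c = k} + card A" by (rule card_Un_le)
      finally show ?thesis .
    qed
    ultimately have "part \<mu> (Suc k) + card X \<le> part \<mu> k + card {c \<in> S. j \<le> col c \<and> T c = k}"
      using row_latticeD[OF lat aS(1,3)] by linarith
    then show ?thesis by (simp only: X_def)
  qed
qed

end

section \<open>Remmel--Whitney tableaux count lattice fillings\<close>

lemma skew_iff:
  "diagram \<mu> \<subseteq> diagram \<gamma> \<Longrightarrow> (r, c) \<in> skew \<gamma> \<mu> \<longleftrightarrow> part \<mu> r \<le> c \<and> c < part \<gamma> r"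
  by (auto simp: skew_def diagram_def)

lemma card_skew_row:
  "diagram \<mu> \<subseteq> diagram \<gamma> \<Longrightarrow> card {y \<in> skew \<gamma> \<mu>. row y = r} = part \<gamma> r - part \<mu> r"
proof -
  assume "diagram \<mu> \<subseteq> diagram \<gamma>"
  then have "{y \<in> skew \<gamma> \<mu>. row y = r} = {r} \<times> {part \<mu> r..<part \<gamma> r}"
    by (auto simp: skew_iff)
  then show ?thesis by (simp add: card_cartesian_product)
qed

lemma standard_imp_semistandard: "U \<in> standard_tableaux G \<Longrightarrow> semistandard G U"
  unfolding standard_tableaux_def semistandard_def using less_imp_le by blast

lemma standard_outside: "U \<in> standard_tableaux G \<Longrightarrow> z \<notin> G \<Longrightarrow> U z = 0"
  unfolding standard_tableaux_def by blast

lemma standard_row_le_iff: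
  assumes "U \<in> standard_tableaux G" "y \<in> G" "z \<in> G" "row y = row z"
  shows "U y \<le> U z \<longleftrightarrow> col y \<le> col z"
proof -
  have "U c < U d" if "c \<in> G" "d \<in> G" "row c = row d" "col c < col d" for c d
    using assms(1) that unfolding standard_tableaux_def by blast
  note less = this[of y z] this[of z y]
  consider "col y < col z" | "col z < col y" | "y = z"
    using assms(4) by (metis linorder_neqE_nat prod_eq_iff)
  then show ?thesis
  proof cases
    case 1
    then show ?thesis using less(1) assms by simp
  next
    case 2
    then show ?thesis using less(2) assms by simp
  qed simp
qed

text \<open>A cell's position in its row is the rank of its entry there. So a standard tableau can
  be recovered from the sequence of rows in which 1, 2, ... are entered.\<close>

lemma standard_row_count:
  assumes "diagram \<mu> \<subseteq> diagram \<gamma>" "U \<in> standard_tableaux (skew \<gamma> \<mu>)" "z \<in> skew \<gamma> \<mu>"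
  shows "card {y \<in> skew \<gamma> \<mu>. row y = row z \<and> U y \<le> U z} = Suc (col z) - part \<mu> (row z)"
proof -
  have z: "col z < part \<gamma> (row z)" using assms(3) skew_iff[OF assms(1), of "row z" "col z"] by simp
  have "{y \<in> skew \<gamma> \<mu>. row y = row z \<and> U y \<le> U z} = {y \<in> skew \<gamma> \<mu>. row y = row z \<and> col y \<le> col z}"
    using standard_row_le_iff[OF assms(2) _ assms(3)] by blast
  also have "\<dots> = {row z} \<times> {part \<mu> (row z)..<Suc (col z)}"
    using skew_iff[OF assms(1)] z by auto
  finally show ?thesis by (simp add: card_cartesian_product)
qed

context
  fixes \<mu> \<gamma> :: partition and S :: "cell set" and n :: nat
  assumes S: "finite S" "convex_cells S"
    and sub: "diagram \<mu> \<subseteq> diagram \<gamma>" and \<gamma>: "part \<gamma> n = 0"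
begin

private abbreviation "G \<equiv> skew \<gamma> \<mu>"

private definition cell_of :: "filling \<Rightarrow> cell \<Rightarrow> cell" where
  "cell_of U a = the_inv_into G U (rl S a)"

text \<open>The companion filling: \<open>a\<close> receives the row in which \<open>U\<close>
  enters the number that \<open>rl\<close> writes into \<open>a\<close>. Conditions (i) and (ii)
  make its rows weak and its columns strict, and the columns of \<open>U\<close> being increasing
  becomes the lattice condition.\<close>

private definition row_filling :: "filling \<Rightarrow> filling" where
  "row_filling U a = (if a \<in> S then row (cell_of U a) else 0)"

lemma cell_of_bij:
  assumes "U \<in> standard_tableaux G" "card G = card S"
  shows "bij_betw (cell_of U) S G"
proof -
  have "bij_betw U G {1..card S}" using assms by (simp add: standard_tableaux_def)
  from bij_betw_trans[OF rl_bij[OF S(1)] bij_betw_the_inv_into[OF this]]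
  have "bij_betw (the_inv_into G U \<circ> rl S) S G" .
  moreover have "cell_of U = the_inv_into G U \<circ> rl S" by (rule ext) (simp add: cell_of_def)
  ultimately show ?thesis by (simp only:)
qed

lemma cell_of_entry:
  assumes "U \<in> standard_tableaux G" "card G = card S" "a \<in> S"
  shows "U (cell_of U a) = rl S a"
proof -
  have "bij_betw U G {1..card S}" using assms by (simp add: standard_tableaux_def)
  moreover have "rl S a \<in> {1..card S}" using bij_betwE[OF rl_bij[OF S(1)]] assms by blast
  ultimately show ?thesis unfolding cell_of_def by (rule f_the_inv_into_f_bij_betw)
qed

lemma row_filling_count:
  assumes U: "U \<in> standard_tableaux G" "card G = card S" and a: "a \<in> S"
  shows "card {c \<in> S. reads_le c a \<and> row_filling U c = k} = card {y \<in> G. row y = k \<and> U y \<le> rl S a}"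
proof -
  have iff: "U (cell_of U c) \<le> rl S a \<longleftrightarrow> reads_le c a" if "c \<in> S" for c
    unfolding cell_of_entry[OF U that] by (rule rl_le_iff[OF S(1) a that])
  have bij: "inj_on (cell_of U) S" "cell_of U ` S = G"
    using cell_of_bij[OF U] by (simp_all add: bij_betw_def)
  let ?L = "{c \<in> S. reads_le c a \<and> row_filling U c = k}" and ?R = "{y \<in> G. row y = k \<and> U y \<le> rl S a}"
  have "cell_of U ` ?L = ?R"
  proof (intro equalityI subsetI)
    fix y assume "y \<in> cell_of U ` ?L"
    then obtain c where "c \<in> S" "reads_le c a" "row_filling U c = k" "y = cell_of U c" by blast
    then show "y \<in> ?R" using iff[of c] bij(2) by (auto simp: row_filling_def)
  next
    fix y assume y: "y \<in> ?R"
    then obtain c where c: "c \<in> S" "y = cell_of U c" using bij(2) by blast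
    then have "c \<in> ?L" using iff[of c] y by (simp add: row_filling_def)
    with c(2) show "y \<in> cell_of U ` ?L" by blast
  qed
  moreover have "inj_on (cell_of U) ?L" using bij(1) by (rule inj_on_subset) blast
  ultimately show ?thesis using card_image[of "cell_of U" ?L] by (simp only:)
qed

lemma row_filling_position:
  assumes U: "U \<in> standard_tableaux G" "card G = card S" and a: "a \<in> S"
  shows "card {c \<in> S. reads_le c a \<and> row_filling U c = row_filling U a} =
    Suc (col (cell_of U a)) - part \<mu> (row_filling U a)"
proof -
  have r: "row_filling U a = row (cell_of U a)" using a by (simp add: row_filling_def)
  have "cell_of U a \<in> G" using bij_betwE[OF cell_of_bij[OF U]] a by blast
  then show ?thesis
    using row_filling_count[OF U a, of "row_filling U a"] standard_row_count[OF sub U(1), of "cell_of U a"]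
    by (simp only: r cell_of_entry[OF U a])
qed

text \<open>If \<open>U\<close> and \<open>U'\<close> place the numbers of \<open>a\<close> and
  \<open>b\<close> at the same cell, then \<open>a\<close> and \<open>b\<close> have the same value
  and the same rank among the cells with that value, so they coincide.\<close>

lemma row_filling_inj:
  assumes "U \<in> standard_tableaux G" "U' \<in> standard_tableaux G" "card G = card S"
    and eq: "row_filling U = row_filling U'"
  shows "U = U'"
proof
  fix z
  let ?F = "row_filling U"
  show "U z = U' z"
  proof (cases "z \<in> G")
    case False
    show ?thesis
      using standard_outside[OF assms(1) False] standard_outside[OF assms(2) False] by simp
  next
    case True
    have "z \<in> cell_of U ` S" "z \<in> cell_of U' ` S"
      using True cell_of_bij[OF assms(1,3)] cell_of_bij[OF assms(2,3)] by (simp_all only: bij_betw_def)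
    then obtain a b where a: "a \<in> S" "cell_of U a = z" and b: "b \<in> S" "cell_of U' b = z"
      unfolding image_iff by metis
    have "row_filling U' b = row z" using b by (simp add: row_filling_def)
    then have rows: "?F a = row z" "?F b = row z"
      unfolding eq[symmetric] using a by (simp_all add: row_filling_def)
    let ?P = "\<lambda>a. {c \<in> S. reads_le c a \<and> ?F c = row z}"
    have card: "card (?P a) = card (?P b)"
      using row_filling_position[OF assms(1,3) a(1)] row_filling_position[OF assms(2,3) b(1)]
      unfolding eq[symmetric] rows a(2) b(2) by (simp only:)
    have later: "reads_le y x" if "reads_le x y" "y \<in> S" "?F y = row z" "card (?P x) = card (?P y)" for x y
    proof -
      have "?P x \<subseteq> ?P y" using reads_le_trans[OF _ that(1)] by blast
      then have "?P x = ?P y" using that(4) S(1) by (intro card_subset_eq) auto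
      moreover have "y \<in> ?P y" using that by simp
      ultimately show ?thesis by blast
    qed
    have "reads_le a b" "reads_le b a"
      using later[OF _ b(1) rows(2) card] later[OF _ a(1) rows(1) card[symmetric]]
        reads_le_linear[of a b] by blast+
    then have "a = b" by (rule reads_le_antisym)
    then show ?thesis
      using cell_of_entry[OF assms(1,3) a(1)] cell_of_entry[OF assms(2,3) b(1)] a b by simp
  qed
qed

lemma row_filling_RW:
  assumes U: "U \<in> RW G S"
  shows "row_filling U \<in> sst n S" "row_lattice \<mu> S (row_filling U)"
    "part \<mu> k + card {c \<in> S. row_filling U c = k} = part \<gamma> k"
proof -
  let ?F = "row_filling U"
  have st: "U \<in> standard_tableaux G" and card: "card G = card S" using U by (simp_all add: RW_def)
  have cell: "cell_of U a \<in> G" "?F a = row (cell_of U a)" "U (cell_of U a) = rl S a" if "a \<in> S" for a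
    using bij_betwE[OF cell_of_bij[OF st card]] cell_of_entry[OF st card that] that
    by (simp_all add: row_filling_def)
  have conds: "(row a = row b \<and> rl S b = Suc (rl S a) \<longrightarrow> ?F b \<le> ?F a) \<and>
      (col a = col b \<and> row b = Suc (row a) \<longrightarrow> ?F a < ?F b)" if "a \<in> S" "b \<in> S" for a b
  proof -
    have "\<forall>a\<in>S. \<forall>b\<in>S. \<forall>c\<in>G. \<forall>d\<in>G. U c = rl S a \<and> U d = rl S b \<longrightarrow>
        (row a = row b \<and> rl S b = Suc (rl S a) \<longrightarrow> col c < col d \<and> row d \<le> row c) \<and>
        (col a = col b \<and> row b = Suc (row a) \<longrightarrow> row c < row d \<and> col d \<le> col c)"
      using U unfolding RW_def by blast
    from bspec[OF bspec[OF bspec[OF bspec[OF this that(1)] that(2)] cell(1)[OF that(1)]] cell(1)[OF that(2)]]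
    show ?thesis using cell[OF that(1)] cell[OF that(2)] by simp
  qed
  \<comment> \<open>Conditions (i) and (ii) speak of neighbouring cells only; convexity provides the
    cells between two distant ones.\<close>
  have rows: "?F (p, q) \<le> ?F (p, q + d)" if "(p, q) \<in> S" "(p, q + d) \<in> S" for p q d
    using that
  proof (induction d)
    case (Suc d)
    have m: "(p, q + d) \<in> S"
      by (rule convex_cellsD[OF S(2) Suc.prems]) auto
    have "rl S (p, q + d) = Suc (rl S (p, Suc (q + d)))"
      using m Suc.prems by (intro rl_left_neighbour[OF S(1)]) auto
    then have "?F (p, q + d) \<le> ?F (p, q + Suc d)"
      using conds[OF Suc.prems(2) m] by simp
    with Suc.IH[OF Suc.prems(1) m] show ?case by simp
  qed simp
  have cols: "?F (p, q) < ?F (p + Suc d, q)" if "(p, q) \<in> S" "(p + Suc d, q) \<in> S" for p q d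
    using that
  proof (induction d)
    case 0
    then show ?case using conds[of "(p, q)" "(p + Suc 0, q)"] by simp
  next
    case (Suc d)
    have m: "(p + Suc d, q) \<in> S"
      by (rule convex_cellsD[OF S(2) Suc.prems]) auto
    have "?F (p + Suc d, q) < ?F (p + Suc (Suc d), q)"
      using conds[OF m Suc.prems(2)] by simp
    with Suc.IH[OF Suc.prems(1) m] show ?case by simp
  qed
  have "semistandard S ?F"
    unfolding semistandard_def
  proof (intro ballI conjI impI; elim conjE)
    fix c d assume cd: "c \<in> S" "d \<in> S" "row c = row d" "col c < col d"
    then obtain p q q' where "c = (p, q)" "d = (p, q')" by (metis prod.collapse)
    then show "?F c \<le> ?F d" using rows[of p q "q' - q"] cd by simp
  next
    fix c d assume cd: "c \<in> S" "d \<in> S" "col c = col d" "row c < row d"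
    then obtain p p' q where "c = (p, q)" "d = (p', q)" by (metis prod.collapse)
    then show "?F c < ?F d" using cols[of p q "p' - p - 1"] cd by simp
  qed
  moreover have "?F c < n" if "c \<in> S" for c
    using cell(1,2)[OF that] row_less[OF \<gamma>, of "cell_of U c"] by (simp add: skew_def)
  moreover have "?F c = 0" if "c \<notin> S" for c
    using that by (simp add: row_filling_def)
  ultimately show "?F \<in> sst n S" by (simp add: sst_def)
  have bij: "bij_betw (cell_of U) {c \<in> S. ?F c = k} {y \<in> G. row y = k}" for k
  proof -
    have "inj_on (cell_of U) S" "cell_of U ` S = G"
      using cell_of_bij[OF st card] by (simp_all add: bij_betw_def)
    moreover have "cell_of U ` {c \<in> S. ?F c = k} = {y \<in> cell_of U ` S. row y = k}"
      using cell(2) by auto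
    ultimately show ?thesis by (auto simp: bij_betw_def intro: inj_on_subset)
  qed
  show "part \<mu> k + card {c \<in> S. ?F c = k} = part \<gamma> k"
    using bij_betw_same_card[OF bij[of k]] card_skew_row[OF sub, of k] sub
    by (simp add: diagram_subset_iff)
  show "row_lattice \<mu> S ?F"
    unfolding row_lattice_def
  proof (intro ballI allI impI)
    fix a k assume a: "a \<in> S" "?F a = Suc k"
    let ?z = "cell_of U a"
    define c where "c = col ?z"
    have z: "?z = (Suc k, c)" using cell(2)[OF a(1)] a(2) by (simp add: c_def prod_eq_iff)
    have zG: "(Suc k, c) \<in> G" using cell(1)[OF a(1)] by (simp only: z)
    have 1: "card {c \<in> S. reads_le c a \<and> ?F c = Suc k} = Suc c - part \<mu> (Suc k)"
      using row_filling_position[OF st card a(1)] a(2) by (simp add: c_def)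
    have 2: "part \<mu> (Suc k) \<le> c" using zG skew_iff[OF sub] by simp
    \<comment> \<open>The cell above (k + 1, c) either belongs to \<mu> or carries a smaller number,
      so by then row k is already longer than c.\<close>
    have "Suc c \<le> part \<mu> k + card {y \<in> G. row y = k \<and> U y \<le> rl S a}"
    proof (cases "c < part \<mu> k")
      case False
      then have kc: "(k, c) \<in> G"
        using zG skew_iff[OF sub] antimono_part[of k "Suc k" \<gamma>] by auto
      have "U (k, c) < U (Suc k, c)"
        using st kc zG unfolding standard_tableaux_def by auto
      then have le: "U (k, c) \<le> rl S a" using cell(3)[OF a(1)] by (simp only: z)
      have "{y \<in> G. row y = row (k, c) \<and> U y \<le> U (k, c)} \<subseteq> {y \<in> G. row y = k \<and> U y \<le> rl S a}"
        using le by auto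
      then have "card {y \<in> G. row y = row (k, c) \<and> U y \<le> U (k, c)} \<le> card {y \<in> G. row y = k \<and> U y \<le> rl S a}"
        using finite_skew by (intro card_mono) auto
      then show ?thesis using standard_row_count[OF sub st kc] False by simp
    qed simp
    then show "part \<mu> (Suc k) + card {c \<in> S. reads_le c a \<and> ?F c = Suc k} \<le>
        part \<mu> k + card {c \<in> S. reads_le c a \<and> ?F c = k}"
      using 1 2 row_filling_count[OF st card a(1), of k] by simp
  qed
qed

section \<open>The inverse map, from lattice fillings to Remmel--Whitney tableaux\<close>

context
  fixes T :: filling
  assumes T: "T \<in> sst n S" and lat: "row_lattice \<mu> S T"
    and cnt: "\<And>k. part \<mu> k + card {c \<in> S. T c = k} = part \<gamma> k"
begin

text \<open>The cell added to \<open>\<mu>\<close> when the entry of \<open>a\<close> is read; as \<open>a\<close> itself is counted, nothing is truncated.\<close>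

private definition place :: "cell \<Rightarrow> cell" where
  "place a = (T a, part \<mu> (T a) + card {c \<in> S. reads_le c a \<and> T c = T a} - 1)"

private definition tab :: filling where
  "tab z = (if z \<in> G then rl S (the_inv_into S place z) else 0)"

lemma semistandard_T: "semistandard S T"
  using T unfolding sst_def by blast

lemma row_place: "row (place a) = T a"
  by (simp add: place_def)

lemma Suc_col_place:
  assumes "a \<in> S"
  shows "Suc (col (place a)) = part \<mu> (T a) + card {c \<in> S. reads_le c a \<and> T c = T a}"
proof -
  have "a \<in> {c \<in> S. reads_le c a \<and> T c = T a}" "finite {c \<in> S. reads_le c a \<and> T c = T a}"
    using assms S(1) by simp_all
  then have "card {c \<in> S. reads_le c a \<and> T c = T a} > 0"
    unfolding card_gt_0_iff by blast
  then show ?thesis by (simp add: place_def)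
qed

lemma place_mem:
  assumes "a \<in> S"
  shows "place a \<in> G"
proof -
  have "a \<in> {c \<in> S. reads_le c a \<and> T c = T a}" "finite {c \<in> S. reads_le c a \<and> T c = T a}"
    using assms S(1) by simp_all
  then have "card {c \<in> S. reads_le c a \<and> T c = T a} > 0"
    unfolding card_gt_0_iff by blast
  moreover have "card {c \<in> S. reads_le c a \<and> T c = T a} \<le> card {c \<in> S. T c = T a}"
    using S(1) by (intro card_mono) auto
  ultimately show ?thesis
    unfolding place_def skew_iff[OF sub] using cnt[of "T a"] by linarith
qed

lemma col_place_le_iff:
  assumes "a \<in> S" "b \<in> S" "T a = T b"
  shows "col (place a) \<le> col (place b) \<longleftrightarrow> reads_le a b"
proof -
  let ?P = "\<lambda>x. {c \<in> S. reads_le c x \<and> T c = T b}"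
  have fin: "finite (?P x)" for x using S(1) by simp
  have "col (place a) \<le> col (place b) \<longleftrightarrow> card (?P a) \<le> card (?P b)"
    using Suc_col_place[OF assms(1)] Suc_col_place[OF assms(2)] unfolding assms(3) by linarith
  also have "\<dots> \<longleftrightarrow> reads_le a b"
  proof
    assume "reads_le a b"
    then have "?P a \<subseteq> ?P b" using reads_le_trans[of _ a b] by blast
    then show "card (?P a) \<le> card (?P b)" by (rule card_mono[OF fin])
  next
    assume le: "card (?P a) \<le> card (?P b)"
    show "reads_le a b"
    proof (rule ccontr)
      assume n: "\<not> reads_le a b"
      then have ba: "reads_le b a" using reads_le_linear[of a b] by blast
      have "?P b \<subseteq> ?P a" using reads_le_trans[OF _ ba] by blast
      moreover have "a \<in> ?P a" "a \<notin> ?P b" using n assms by simp_all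
      ultimately have "?P b \<subset> ?P a" by blast
      then have "card (?P b) < card (?P a)" by (rule psubset_card_mono[OF fin])
      with le show False by simp
    qed
  qed
  finally show ?thesis .
qed

lemma place_inj: "inj_on place S"
proof (rule inj_onI)
  fix a b assume ab: "a \<in> S" "b \<in> S" "place a = place b"
  then have "T a = T b" using row_place[of a] row_place[of b] by simp
  then have "reads_le a b" "reads_le b a"
    using col_place_le_iff[OF ab(1,2)] col_place_le_iff[OF ab(2,1)] ab(3) by simp_all
  then show "a = b" by (rule reads_le_antisym)
qed

lemma card_G: "card G = card S"
proof -
  have "shape_content \<gamma> = shape_content \<mu> + weight S T"
    by (rule multiset_eqI) (simp add: count_shape_content count_weight[OF S(1)] cnt)
  from arg_cong[OF this, of size] have "card (diagram \<gamma>) = card (diagram \<mu>) + card S"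
    by (simp add: shape_content_def size_weight)
  then show ?thesis
    using sub by (simp add: skew_def card_Diff_subset finite_diagram)
qed

lemma place_surj: "place ` S = G"
proof (rule card_subset_eq)
  show "card (place ` S) = card G" using card_image[OF place_inj] card_G by simp
qed (use place_mem finite_skew in auto)

lemma tab_place: "a \<in> S \<Longrightarrow> tab (place a) = rl S a"
  using place_mem by (simp add: tab_def the_inv_into_f_f[OF place_inj])

lemma obtain_place:
  assumes "z \<in> G"
  obtains a where "a \<in> S" "z = place a"
  using assms unfolding place_surj[symmetric] by (rule imageE) (rule that)

lemma tab_row_less:
  assumes "y \<in> G" "z \<in> G" "row y = row z" "col y < col z"
  shows "tab y < tab z"
proof -
  obtain a where a: "a \<in> S" "y = place a" using assms(1) by (rule obtain_place)
  obtain b where b: "b \<in> S" "z = place b" using assms(2) by (rule obtain_place)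
  have "T b = T a" using assms(3) unfolding a(2) b(2) row_place by simp
  then have "\<not> reads_le b a"
    using col_place_le_iff[OF b(1) a(1)] assms(4) unfolding a(2) b(2) by simp
  then show ?thesis
    unfolding a(2) b(2) tab_place[OF a(1)] tab_place[OF b(1)]
    using rl_le_iff[OF S(1) a(1) b(1)] by simp
qed

text \<open>When \<open>b\<close> adds the cell in row r + 1 and column c, the lattice condition
  says that row r already has more than c cells. So the cell in column c of row r, added by
  \<open>a\<close>, came earlier.\<close>

lemma tab_col_less_Suc:
  assumes "(r, c) \<in> G" "(Suc r, c) \<in> G"
  shows "tab (r, c) < tab (Suc r, c)"
proof -
  obtain a where a: "a \<in> S" "(r, c) = place a" using assms(1) by (rule obtain_place)
  obtain b where b: "b \<in> S" "(Suc r, c) = place b" using assms(2) by (rule obtain_place)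
  have Ta: "T a = r" "col (place a) = c" using row_place[of a] a(2)[symmetric] by simp_all
  have Tb: "T b = Suc r" "col (place b) = c" using row_place[of b] b(2)[symmetric] by simp_all
  have "Suc c \<le> part \<mu> r + card {x \<in> S. reads_le x b \<and> T x = r}"
    using row_latticeD[OF lat b(1) Tb(1)] Suc_col_place[OF b(1)] Tb by simp
  then have le: "card {x \<in> S. reads_le x a \<and> T x = r} \<le> card {x \<in> S. reads_le x b \<and> T x = r}"
    using Suc_col_place[OF a(1)] Ta by simp
  have "\<not> reads_le b a"
  proof
    assume ba: "reads_le b a"
    have "{x \<in> S. reads_le x b \<and> T x = r} \<subseteq> {x \<in> S. reads_le x a \<and> T x = r}"
      using reads_le_trans[OF _ ba] by blast
    moreover have "a \<notin> {x \<in> S. reads_le x b \<and> T x = r}"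
    proof
      assume "a \<in> {x \<in> S. reads_le x b \<and> T x = r}"
      then have "a = b" using reads_le_antisym[OF _ ba] by blast
      with Ta Tb show False by simp
    qed
    moreover have "a \<in> {x \<in> S. reads_le x a \<and> T x = r}" using a Ta by simp
    ultimately have "{x \<in> S. reads_le x b \<and> T x = r} \<subset> {x \<in> S. reads_le x a \<and> T x = r}" by blast
    then have "card {x \<in> S. reads_le x b \<and> T x = r} < card {x \<in> S. reads_le x a \<and> T x = r}"
      using S(1) by (intro psubset_card_mono) auto
    with le show False by simp
  qed
  then show ?thesis
    unfolding a(2) b(2) tab_place[OF a(1)] tab_place[OF b(1)]
    using rl_le_iff[OF S(1) a(1) b(1)] by simp
qed

lemma tab_standard: "tab \<in> standard_tableaux G"
proof -
  have col_less: "tab (r, c) < tab (r + Suc d, c)" if "(r, c) \<in> G" "(r + Suc d, c) \<in> G" for r c d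
    using that
  proof (induction d)
    case 0
    then show ?case using tab_col_less_Suc[of r c] by simp
  next
    case (Suc d)
    have m: "(r + Suc d, c) \<in> G"
      by (rule convex_cellsD[OF convex_skew Suc.prems]) auto
    show ?case
      using Suc.IH[OF Suc.prems(1) m] tab_col_less_Suc[OF m] Suc.prems(2) by simp
  qed
  have "bij_betw place S G" using place_inj place_surj by (simp add: bij_betw_def)
  from bij_betw_trans[OF bij_betw_the_inv_into[OF this] rl_bij[OF S(1)]]
  have "bij_betw (rl S \<circ> the_inv_into S place) G {1..card G}" by (simp only: card_G)
  then have bij: "bij_betw tab G {1..card G}"
    by (rule bij_betw_cong[THEN iffD1, rotated]) (simp add: tab_def)
  have "tab c < tab d" if cd: "c \<in> G" "d \<in> G" "col c = col d" "row c < row d" for c d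
  proof -
    obtain r r' q where "c = (r, q)" "d = (r', q)" using cd(3) by (metis prod.collapse)
    then show ?thesis using col_less[of r q "r' - r - 1"] cd by simp
  qed
  with bij tab_row_less show ?thesis
    unfolding standard_tableaux_def tab_def[abs_def] by simp
qed

lemma tab_le:
  assumes "y \<in> G" "z \<in> G" "row y \<le> row z" "col y \<le> col z"
  shows "tab y \<le> tab z" "row y < row z \<Longrightarrow> tab y < tab z"
  using semistandard_le[OF convex_skew standard_imp_semistandard[OF tab_standard] assms] by blast+

lemma rl_le_if_place_le:
  assumes "a \<in> S" "b \<in> S" "T a \<le> T b" "col (place a) \<le> col (place b)"
  shows "rl S a \<le> rl S b" "T a < T b \<Longrightarrow> rl S a < rl S b"
  using tab_le[OF place_mem[OF assms(1)] place_mem[OF assms(2)]] assms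
  unfolding row_place tab_place[OF assms(1)] tab_place[OF assms(2)] by blast+

text \<open>
  A violation at vertically adjacent cells \<open>a\<close>, \<open>b\<close> forces one at their right neighbours, so there is
  none.
\<close>

lemma col_place_vertical:
  assumes "a \<in> S" "b \<in> S" "a = (p, q)" "b = (Suc p, q)"
  shows "col (place b) \<le> col (place a)"
proof -
  obtain m where m: "\<forall>c\<in>S. col c < m"
    using iffD1[OF finite_nat_set_iff_bounded finite_imageI[OF S(1)]] by blast
  show ?thesis
    using assms
  proof (induction "m - q" arbitrary: a b q rule: less_induct)
    case less
    note a = \<open>a \<in> S\<close> and b = \<open>b \<in> S\<close> and ap = \<open>a = (p, q)\<close> and bp = \<open>b = (Suc p, q)\<close>
    show ?case
    proof (rule ccontr)
      assume n: "\<not> col (place b) \<le> col (place a)"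
      have Tab: "T a < T b"
        by (rule semistandard_col[OF semistandard_T a b]) (simp_all add: ap bp)
      \<comment> \<open>The cell left of \<open>place b\<close> lies weakly southeast of
        \<open>place a\<close>. The cell \<open>l\<close> placed there is read after
        \<open>a\<close> and before \<open>b\<close>, which forces it into the row of
        \<open>b\<close>, to the right of \<open>b\<close>.\<close>
      have zG: "(T b, col (place b) - 1) \<in> G"
        by (rule convex_cellsD[OF convex_skew place_mem[OF a] place_mem[OF b]])
          (use n Tab in \<open>auto simp: row_place\<close>)
      then obtain l where l: "l \<in> S" "(T b, col (place b) - 1) = place l" by (rule obtain_place)
      have Tl: "T l = T b" "col (place l) = col (place b) - 1"
        using row_place[of l] l(2)[symmetric] by simp_all
      have lb: "reads_le l b" "l \<noteq> b"
        using col_place_le_iff[OF l(1) b Tl(1)] Tl(2) n by auto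
      have "rl S a \<le> rl S l"
        by (rule rl_le_if_place_le(1)[OF a l(1)]) (use Tl Tab n in auto)
      then have al: "reads_le a l" using rl_le_iff[OF S(1) l(1) a] by blast
      have row_l: "row l = Suc p"
      proof (rule ccontr)
        assume "row l \<noteq> Suc p"
        then have "row l = p" "col l \<le> q"
          using lb(1) al ap bp by (auto simp: reads_le_def)
        then have "T l \<le> T a"
          using ap by (intro semistandard_row[OF semistandard_T l(1) a]) auto
        with Tl Tab show False by simp
      qed
      have col_l: "q < col l"
        using lb row_l bp by (auto simp: reads_le_def prod_eq_iff)
      let ?a = "(p, Suc q)" and ?b = "(Suc p, Suc q)"
      have b1: "?b \<in> S"
        by (rule convex_cellsD[OF S(2) b l(1)]) (use bp row_l col_l in auto)
      have a1: "?a \<in> S"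
        by (rule convex_cellsD[OF S(2) a b1]) (use ap in auto)
      have "T b \<le> T ?b" "T ?b \<le> T l"
        using semistandard_row[OF semistandard_T b b1] semistandard_row[OF semistandard_T b1 l(1)] bp row_l col_l by auto
      then have Tb1: "T ?b = T b" using Tl by simp
      have "reads_le l ?b" using row_l col_l by (simp add: reads_le_def)
      then have "col (place l) \<le> col (place ?b)"
        using col_place_le_iff[OF l(1) b1] Tl Tb1 by simp
      then have *: "col (place a) \<le> col (place ?b)" using Tl n by simp
      have Ta1: "T a \<le> T ?a"
        using semistandard_row[OF semistandard_T a a1] ap by simp
      \<comment> \<open>\<open>a\<close> is read after its right neighbour, so by monotonicity of
        \<open>tab\<close> the place of \<open>?a\<close> must lie left of that of \<open>a\<close>.
        The violation thus moves one column to the right, which cannot go on forever in a finite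
        shape.\<close>
      have "\<not> rl S a \<le> rl S ?a"
        using rl_le_iff[OF S(1) a1 a] ap by (simp add: reads_le_def)
      then have "col (place ?a) < col (place a)"
        using rl_le_if_place_le(1)[OF a a1 Ta1] by linarith
      with * have "\<not> col (place ?b) \<le> col (place ?a)" by simp
      moreover have "m - Suc q < m - q" using bspec[OF m a] ap by simp
      ultimately show False using less.hyps[OF _ a1 b1 refl refl] by blast
    qed
  qed
qed

text \<open>Condition (i) and the strict part of (ii) follow from semistandardness of
  \<open>T\<close> and monotonicity of \<open>tab\<close>; the comparison of columns in (ii) is
  \<open>col_place_vertical\<close>.\<close>

lemma tab_RW: "tab \<in> RW G S"
proof -
  have "(row a = row b \<and> rl S b = Suc (rl S a) \<longrightarrow> col c < col d \<and> row d \<le> row c) \<and>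
        (col a = col b \<and> row b = Suc (row a) \<longrightarrow> row c < row d \<and> col d \<le> col c)"
    if ab: "a \<in> S" "b \<in> S" and cd: "c \<in> G" "d \<in> G" and eq: "tab c = rl S a" "tab d = rl S b" for a b c d
  proof -
    obtain a' where a': "a' \<in> S" "c = place a'" using cd(1) by (rule obtain_place)
    obtain b' where b': "b' \<in> S" "d = place b'" using cd(2) by (rule obtain_place)
    have "rl S a' = rl S a" "rl S b' = rl S b"
      using eq unfolding a'(2) b'(2) tab_place[OF a'(1)] tab_place[OF b'(1)] by blast+
    then have "a' = a" "b' = b"
      using inj_onD[OF rl_inj[OF S(1)]] a'(1) b'(1) ab by blast+
    then have c: "c = place a" and d: "d = place b" using a' b' by simp_all
    have "col c < col d \<and> row d \<le> row c" if h: "row a = row b" "rl S b = Suc (rl S a)"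
    proof -
      have "\<not> reads_le b a" using rl_le_iff[OF S(1) ab] h(2) by simp
      then have "col b \<le> col a" using h(1) by (auto simp: reads_le_def)
      then have le: "T b \<le> T a" using h(1) by (intro semistandard_row[OF semistandard_T ab(2,1)]) auto
      have "\<not> rl S b \<le> rl S a" using h(2) by simp
      then have "\<not> col (place b) \<le> col (place a)"
        using rl_le_if_place_le(1)[OF ab(2,1) le] by blast
      with le show ?thesis unfolding c d row_place by simp
    qed
    moreover have "row c < row d \<and> col d \<le> col c" if h: "col a = col b" "row b = Suc (row a)"
    proof
      show "row c < row d" unfolding c d row_place
        by (rule semistandard_col[OF semistandard_T ab]) (use h in auto)
      show "col d \<le> col c" unfolding c d
        by (rule col_place_vertical[OF ab, of "row a" "col a"]) (use h in \<open>auto simp: prod_eq_iff\<close>)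
    qed
    ultimately show ?thesis by blast
  qed
  then show ?thesis unfolding RW_def using tab_standard card_G by blast
qed

lemma row_filling_tab: "row_filling tab = T"
proof
  fix a
  show "row_filling tab a = T a"
  proof (cases "a \<in> S")
    case True
    have "inj_on tab G" using tab_standard by (simp add: standard_tableaux_def bij_betw_def)
    then have "cell_of tab a = place a"
      unfolding cell_of_def by (rule the_inv_into_f_eq) (fact tab_place[OF True] place_mem[OF True])+
    with True show ?thesis by (simp add: row_filling_def row_place)
  next
    case False
    moreover have "T a = 0" using T False unfolding sst_def by blast
    ultimately show ?thesis by (simp add: row_filling_def)
  qed
qed

lemma row_filling_surj: "T \<in> row_filling ` RW G S"
  using tab_RW row_filling_tab by (metis imageI)

end

lemma card_RW:
  "card (RW (skew \<gamma> \<mu>) S) = card {T \<in> sst n S. col_lattice \<mu> S T \<and> add_shape \<mu> S T = \<gamma>}"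
proof (rule bij_betw_same_card)
  let ?L = "{T \<in> sst n S. col_lattice \<mu> S T \<and> add_shape \<mu> S T = \<gamma>}"
  have "row_filling U \<in> ?L" if "U \<in> RW G S" for U
  proof -
    note F = row_filling_RW[OF that]
    have "semistandard S (row_filling U)" using F(1) unfolding sst_def by blast
    then have lat: "col_lattice \<mu> S (row_filling U)"
      by (rule row_lattice_imp_col_lattice[OF S _ F(2)])
    have "part (add_shape \<mu> S (row_filling U)) = part \<gamma>"
      by (rule ext) (simp add: part_add_shape[OF S(1) lat] F(3))
    with F(1) lat show ?thesis by (simp add: part_inject)
  qed
  moreover have "T \<in> row_filling ` RW G S" if "T \<in> ?L" for T
  proof (rule row_filling_surj)
    show T: "T \<in> sst n S" using that by simp
    then have "semistandard S T" unfolding sst_def by blast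
    then show "row_lattice \<mu> S T"
      using that by (intro col_lattice_imp_row_lattice[OF S]) auto
    show "part \<mu> k + card {c \<in> S. T c = k} = part \<gamma> k" for k
      using that part_add_shape[OF S(1), of \<mu> T k] by auto
  qed
  ultimately have "row_filling ` RW G S = ?L" by blast
  moreover have "inj_on row_filling (RW G S)"
    by (rule inj_onI) (rule row_filling_inj, auto simp: RW_def)
  ultimately show "bij_betw row_filling (RW (skew \<gamma> \<mu>) S) ?L" by (simp add: bij_betw_def)
qed

end


section \<open>Products and coproducts of Schur functions\<close>

definition outer :: "partition \<Rightarrow> nat \<Rightarrow> partition set" where
  "outer \<mu> m = {\<gamma>. diagram \<mu> \<subseteq> diagram \<gamma> \<and> card (diagram \<gamma>) = card (diagram \<mu>) + m}"

lemma finite_outer: "finite (outer \<mu> m)"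
  unfolding outer_def by (rule finite_subset[OF _ finite_partitions_of_size]) auto

text \<open>Lattice fillings are grouped by the partition they produce. The bound on
  \<open>n\<close> keeps row \<open>n\<close> of every such partition empty, as
  \<open>card_RW\<close> demands.\<close>

lemma spoly_mult_RW:
  assumes S: "finite S" "convex_cells S" and n: "card (diagram \<mu>) + card S \<le> n"
  shows "spoly n x (diagram \<mu>) * spoly n x S =
    (\<Sum>\<gamma>\<in>outer \<mu> (card S). of_nat (card (RW (skew \<gamma> \<mu>) S)) * spoly n x (diagram \<gamma>))"
proof -
  let ?G = "{T. T \<in> sst n S \<and> col_lattice \<mu> S T}"
  have fin: "finite ?G" by (rule finite_subset[OF _ finite_sst[OF S(1)]]) auto
  have img: "add_shape \<mu> S ` ?G \<subseteq> outer \<mu> (card S)"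
    using card_add_shape[OF S(1)] part_add_shape[OF S(1)]
    by (auto simp: outer_def diagram_subset_iff)
  have "spoly n x (diagram \<mu>) * spoly n x S = (\<Sum>T\<in>?G. spoly n x (diagram (add_shape \<mu> S T)))"
    using n by (intro spoly_mult_lattice[OF S]) (auto intro: part_eq_0I)
  also have "\<dots> = (\<Sum>\<gamma>\<in>outer \<mu> (card S).
      \<Sum>T\<in>{T \<in> ?G. add_shape \<mu> S T = \<gamma>}. spoly n x (diagram (add_shape \<mu> S T)))"
    by (rule sum.group[symmetric, OF fin finite_outer img])
  also have "\<dots> = (\<Sum>\<gamma>\<in>outer \<mu> (card S). of_nat (card (RW (skew \<gamma> \<mu>) S)) * spoly n x (diagram \<gamma>))"
  proof (rule sum.cong)
    fix \<gamma> assume \<gamma>: "\<gamma> \<in> outer \<mu> (card S)"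
    then have sub: "diagram \<mu> \<subseteq> diagram \<gamma>" and "card (diagram \<gamma>) \<le> n" using n by (auto simp: outer_def)
    then have "part \<gamma> n = 0" by (intro part_eq_0I)
    from card_RW[OF S sub this]
    have "card {T \<in> ?G. add_shape \<mu> S T = \<gamma>} = card (RW (skew \<gamma> \<mu>) S)" by simp
    moreover have "(\<Sum>T\<in>{T \<in> ?G. add_shape \<mu> S T = \<gamma>}. spoly n x (diagram (add_shape \<mu> S T))) =
        of_nat (card {T \<in> ?G. add_shape \<mu> S T = \<gamma>}) * spoly n x (diagram \<gamma>)"
      by simp
    ultimately show "(\<Sum>T\<in>{T \<in> ?G. add_shape \<mu> S T = \<gamma>}. spoly n x (diagram (add_shape \<mu> S T))) =
        of_nat (card (RW (skew \<gamma> \<mu>) S)) * spoly n x (diagram \<gamma>)" by (simp only:)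
  qed simp
  finally show ?thesis .
qed

text \<open>The exhaustion \<open>D\<close> is abstract so that one proof serves the alphabet
  \<open>nat\<close> and each of the two alphabets inside \<open>nat + nat\<close>.\<close>

lemma schur_mult_RW:
  fixes x :: "nat \<Rightarrow> 'v" and D :: "nat \<Rightarrow> 'v set"
  assumes D: "\<And>n. finite (D n)" "mono D" "(\<Union>n. D n) = UNIV" and x: "\<And>n. {t. x t \<in> D n} = {..<n}"
  shows "schur x \<mu> * schur x \<nu> =
    (\<Sum>\<gamma>\<in>outer \<mu> (card (diagram \<nu>)). of_nat (card (RW (skew \<gamma> \<mu>) (diagram \<nu>))) * schur x \<gamma>)"
proof (rule pser_eq_if_restrictions_eq[OF _ D(2,3)])
  fix n assume n: "n \<ge> card (diagram \<mu>) + card (diagram \<nu>)"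
  have r: "psubst (D n) id (schur x \<alpha>) = spoly n x (diagram \<alpha>)" for \<alpha>
    using psubst_schur[OF D(1) x, of n id \<alpha>] by simp
  have of_nat: "psubst (D n) id (of_nat k * f) = of_nat k * psubst (D n) id f" for k and f :: "'v pser"
    using psubst_of_int_mult[of "D n" id "int k" f] by simp
  show "psubst (D n) id (schur x \<mu> * schur x \<nu>) = psubst (D n) id
      (\<Sum>\<gamma>\<in>outer \<mu> (card (diagram \<nu>)). of_nat (card (RW (skew \<gamma> \<mu>) (diagram \<nu>))) * schur x \<gamma>)"
    unfolding psubst_sum of_nat
    unfolding psubst_mult[OF D(1)] r
    by (rule spoly_mult_RW[OF finite_diagram convex_diagram n])
qed

section \<open>Splitting a Schur polynomial over two alphabets\<close>

lemma diagram_of_down_closed: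
  assumes fin: "finite D" and down: "\<And>p q p' q'. (p', q') \<in> D \<Longrightarrow> p \<le> p' \<Longrightarrow> q \<le> q' \<Longrightarrow> (p, q) \<in> D"
  shows "D \<in> range diagram"
proof -
  have "\<exists>m. \<forall>q. (p, q) \<in> D \<longleftrightarrow> q < m" for p
  proof -
    have "finite {q. (p, q) \<in> D}"
      by (rule finite_subset[OF _ finite_imageI[OF fin, of col]]) force
    then have "\<exists>q. (p, q) \<notin> D" by (metis (mono_tags) ex_new_if_finite infinite_UNIV_nat mem_Collect_eq)
    then obtain m where m: "(p, m) \<notin> D" "\<And>q. q < m \<Longrightarrow> (p, q) \<in> D"
      using exists_least_iff[of "\<lambda>q. (p, q) \<notin> D"] by blast
    have "q < m" if "(p, q) \<in> D" for q
      using down[OF that, of p m] m(1) by (cases "q < m") auto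
    with m(2) show ?thesis by blast
  qed
  then obtain f where f: "\<And>p q. (p, q) \<in> D \<longleftrightarrow> q < f p" by metis
  have "f p' \<le> f p" if "p \<le> p'" for p p'
  proof (rule ccontr)
    assume "\<not> f p' \<le> f p"
    then have "(p', f p) \<in> D" by (simp add: f)
    from down[OF this that order_refl] show False by (simp add: f)
  qed
  then have "antimono f" by (simp add: antimono_def)
  moreover have "finite {p. f p \<noteq> 0}"
  proof (rule finite_subset[OF _ finite_imageI[OF fin, of row]])
    show "{p. f p \<noteq> 0} \<subseteq> row ` D"
    proof
      fix p assume "p \<in> {p. f p \<noteq> 0}"
      then have "(p, 0) \<in> D" by (simp add: f)
      then show "p \<in> row ` D" by (rule image_eqI[rotated]) simp
    qed
  qed
  ultimately have "part (Partition f) = f" by (intro Partition_inverse) simp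
  then have "diagram (Partition f) = D" by (auto simp: diagram_def f)
  then show ?thesis by (metis rangeI)
qed

lemma finite_subpartitions: "finite {\<beta>. diagram \<beta> \<subseteq> diagram \<alpha>}"
proof (rule finite_imageD)
  show "finite (diagram ` {\<beta>. diagram \<beta> \<subseteq> diagram \<alpha>})"
    by (rule finite_subset[of _ "Pow (diagram \<alpha>)"]) (auto simp: finite_diagram)
  show "inj_on diagram {\<beta>. diagram \<beta> \<subseteq> diagram \<alpha>}"
    using inj_diagram by (rule inj_on_subset) simp
qed

text \<open>The \<open>n\<close> smallest entries go to the variables \<open>y\<close>, the next \<open>n\<close> to the variables \<open>x\<close>.\<close>

definition merge_vars :: "nat \<Rightarrow> nat \<Rightarrow> nat + nat" where
  "merge_vars n t = (if t < n then Inr t else Inl (t - n))"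

text \<open>The cells with entries below \<open>n\<close> are closed towards the northwest and so
  form the diagram of some \<beta>; the remaining entries, lowered by \<open>n\<close>, fill the
  skew shape.\<close>

lemma spoly_coproduct:
  "spoly (n + n) (merge_vars n) (diagram \<alpha>) =
    (\<Sum>\<beta> | diagram \<beta> \<subseteq> diagram \<alpha>. spoly n Inl (skew \<alpha> \<beta>) * spoly n Inr (diagram \<beta>))"
proof -
  let ?D = "diagram \<alpha>"
  let ?P = "{\<beta>. diagram \<beta> \<subseteq> ?D}"
  let ?Z = "SIGMA \<beta>:?P. sst n (skew \<alpha> \<beta>) \<times> sst n (diagram \<beta>)"
  define small where "small T = inv diagram {c \<in> ?D. T c < n}" for T :: filling
  define join where "join = (\<lambda>(\<beta>, T1, T2) c. if c \<in> diagram \<beta> then T2 c else if c \<in> ?D then n + T1 c else 0 :: nat)"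
  define split where "split T = (small T, (\<lambda>c. if c \<in> skew \<alpha> (small T) then T c - n else 0),
      (\<lambda>c. if c \<in> diagram (small T) then T c else 0))" for T :: filling
  have fin: "finite (sst n (skew \<alpha> \<beta>))" "finite (sst n (diagram \<beta>))" for \<beta>
    using finite_sst finite_skew finite_diagram by blast+
  have small: "diagram (small T) = {c \<in> ?D. T c < n}" if T: "T \<in> sst (n + n) ?D" for T
    unfolding small_def
  proof (rule f_inv_into_f, rule diagram_of_down_closed)
    show "finite {c \<in> ?D. T c < n}" using finite_diagram[of \<alpha>] by simp
    have ss: "semistandard ?D T" using T unfolding sst_def by blast
    fix p q p' q' assume a: "(p', q') \<in> {c \<in> ?D. T c < n}" "p \<le> p'" "q \<le> q'"
    then have m: "(p, q) \<in> ?D" "(p', q') \<in> ?D" by (auto intro: diagram_closed)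
    have "T (p, q) \<le> T (p', q')"
      using semistandard_le(1)[OF convex_diagram ss m] a by simp
    with a m show "(p, q) \<in> {c \<in> ?D. T c < n}" by simp
  qed
  have split_mem: "split T \<in> ?Z" if T: "T \<in> sst (n + n) ?D" for T
  proof -
    have ss: "semistandard ?D T" and lt: "\<forall>c\<in>?D. T c < n + n" using T unfolding sst_def by blast+
    note s = small[OF T]
    have sk: "skew \<alpha> (small T) = {c \<in> ?D. n \<le> T c}" unfolding skew_def s by auto
    have "(\<lambda>c. if c \<in> diagram (small T) then T c else 0) \<in> sst n (diagram (small T))"
      unfolding s using ss by (simp add: sst_def semistandard_def)
    moreover have "(\<lambda>c. if c \<in> skew \<alpha> (small T) then T c - n else 0) \<in> sst n (skew \<alpha> (small T))"
    proof -
      have "T c - n < n" if "c \<in> ?D" "n \<le> T c" for c using bspec[OF lt that(1)] that(2) by linarith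
      then show ?thesis
        unfolding sk using ss
        by (simp add: sst_def semistandard_def diff_le_mono diff_less_mono)
    qed
    moreover have "small T \<in> ?P" using s by auto
    ultimately show ?thesis by (simp add: split_def)
  qed
  have join_mem: "join (\<beta>, T1, T2) \<in> sst (n + n) ?D" and join_split: "split (join (\<beta>, T1, T2)) = (\<beta>, T1, T2)"
    and join_mono: "pmonom (image_mset Inl (weight (skew \<alpha> \<beta>) T1)) * pmonom (image_mset Inr (weight (diagram \<beta>) T2)) =
      pmonom (image_mset (merge_vars n) (weight ?D (join (\<beta>, T1, T2))))"
    if sub: "diagram \<beta> \<subseteq> ?D" and T1: "T1 \<in> sst n (skew \<alpha> \<beta>)" and T2: "T2 \<in> sst n (diagram \<beta>)" for \<beta> T1 T2
  proof -
    let ?T = "join (\<beta>, T1, T2)"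
    have b: "?T c = T2 c" "T2 c < n" if "c \<in> diagram \<beta>" for c
      using that T2 by (simp_all add: join_def sst_def)
    have s: "?T c = n + T1 c" "T1 c < n" if "c \<in> skew \<alpha> \<beta>" for c
      using that T1 by (simp_all add: join_def sst_def skew_def)
    have o: "?T c = 0" if "c \<notin> ?D" for c using that sub by (auto simp: join_def)
    have cases: "c \<in> diagram \<beta> \<or> c \<in> skew \<alpha> \<beta>" if "c \<in> ?D" for c using that by (simp add: skew_def)
    have ss: "semistandard (skew \<alpha> \<beta>) T1" "semistandard (diagram \<beta>) T2"
      using T1 T2 unfolding sst_def by blast+
    have before: "c \<in> diagram \<beta>" if "d \<in> diagram \<beta>" "row c \<le> row d" "col c \<le> col d" for c d
      using diagram_closed[of "row d" "col d" \<beta> "row c" "col c"] that by simp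
    have "?T c < n + n" if "c \<in> ?D" for c
      using cases[OF that] b[of c] s[of c] by auto
    moreover have "semistandard ?D ?T"
      unfolding semistandard_def
    proof (intro ballI conjI impI; elim conjE)
      fix c d assume cd: "c \<in> ?D" "d \<in> ?D" "row c = row d" "col c < col d"
      consider "d \<in> diagram \<beta>" "c \<in> diagram \<beta>" | "d \<in> skew \<alpha> \<beta>" "c \<in> diagram \<beta>" | "d \<in> skew \<alpha> \<beta>" "c \<in> skew \<alpha> \<beta>"
        using cases[OF cd(1)] cases[OF cd(2)] before[of d c] cd by auto
      then show "?T c \<le> ?T d"
      proof cases
        case 1
        then show ?thesis using semistandard_row[OF ss(2) 1(2,1)] cd b by simp
      next
        case 2
        then show ?thesis using b[OF 2(2)] s[OF 2(1)] by simp
      next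
        case 3
        then show ?thesis using semistandard_row[OF ss(1) 3(2,1)] cd s by simp
      qed
    next
      fix c d assume cd: "c \<in> ?D" "d \<in> ?D" "col c = col d" "row c < row d"
      consider "d \<in> diagram \<beta>" "c \<in> diagram \<beta>" | "d \<in> skew \<alpha> \<beta>" "c \<in> diagram \<beta>" | "d \<in> skew \<alpha> \<beta>" "c \<in> skew \<alpha> \<beta>"
        using cases[OF cd(1)] cases[OF cd(2)] before[of d c] cd by auto
      then show "?T c < ?T d"
      proof cases
        case 1
        then show ?thesis using semistandard_col[OF ss(2) 1(2,1)] cd b by simp
      next
        case 2
        then show ?thesis using b[OF 2(2)] s[OF 2(1)] by simp
      next
        case 3
        then show ?thesis using semistandard_col[OF ss(1) 3(2,1)] cd s by simp
      qed
    qed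
    ultimately show mem: "?T \<in> sst (n + n) ?D" using o by (simp add: sst_def)
    have "{c \<in> ?D. ?T c < n} = diagram \<beta>"
    proof (intro equalityI subsetI)
      fix c assume "c \<in> {c \<in> ?D. ?T c < n}"
      then show "c \<in> diagram \<beta>" using cases[of c] s(1)[of c] by auto
    next
      fix c assume "c \<in> diagram \<beta>"
      then show "c \<in> {c \<in> ?D. ?T c < n}" using b[of c] sub by auto
    qed
    then have small: "small ?T = \<beta>"
      unfolding small_def using inj_diagram by (simp only: inv_f_f)
    have "(\<lambda>c. if c \<in> skew \<alpha> \<beta> then ?T c - n else 0) = T1"
    proof
      show "(if c \<in> skew \<alpha> \<beta> then ?T c - n else 0) = T1 c" for c
        using s(1)[of c] sst_outside[OF T1] by (cases "c \<in> skew \<alpha> \<beta>") simp_all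
    qed
    moreover have "(\<lambda>c. if c \<in> diagram \<beta> then ?T c else 0) = T2"
    proof
      show "(if c \<in> diagram \<beta> then ?T c else 0) = T2 c" for c
        using b(1)[of c] sst_outside[OF T2] by (cases "c \<in> diagram \<beta>") simp_all
    qed
    ultimately show "split ?T = (\<beta>, T1, T2)" unfolding split_def small by simp
    have D: "?D = skew \<alpha> \<beta> \<union> diagram \<beta>" and disj: "skew \<alpha> \<beta> \<inter> diagram \<beta> = {}"
      using sub by (auto simp: skew_def)
    from weight_union_disjoint[OF finite_skew finite_diagram disj, of ?T]
    have "weight ?D ?T = weight (skew \<alpha> \<beta>) ?T + weight (diagram \<beta>) ?T"
      by (simp only: D)
    moreover have "image_mset (merge_vars n) (weight (skew \<alpha> \<beta>) ?T) = image_mset Inl (weight (skew \<alpha> \<beta>) T1)"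
      unfolding weight_def multiset.map_comp
      by (rule image_mset_cong) (use s in \<open>auto simp: finite_skew merge_vars_def\<close>)
    moreover have "image_mset (merge_vars n) (weight (diagram \<beta>) ?T) = image_mset Inr (weight (diagram \<beta>) T2)"
      unfolding weight_def multiset.map_comp
      by (rule image_mset_cong) (use b in \<open>auto simp: finite_diagram merge_vars_def\<close>)
    ultimately show "pmonom (image_mset Inl (weight (skew \<alpha> \<beta>) T1)) * pmonom (image_mset Inr (weight (diagram \<beta>) T2)) =
      pmonom (image_mset (merge_vars n) (weight ?D ?T))"
      by (simp add: pmonom_mult)
  qed
  have split_join: "join (split T) = T" if T: "T \<in> sst (n + n) ?D" for T
  proof
    fix c
    have "T c = 0" if "c \<notin> ?D" using T that unfolding sst_def by blast
    then show "join (split T) c = T c"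
      using small[OF T] by (auto simp: join_def split_def skew_def)
  qed
  have "(\<Sum>\<beta>\<in>?P. spoly n Inl (skew \<alpha> \<beta>) * spoly n Inr (diagram \<beta>)) =
    (\<Sum>\<beta>\<in>?P. \<Sum>p\<in>sst n (skew \<alpha> \<beta>) \<times> sst n (diagram \<beta>).
      pmonom (image_mset Inl (weight (skew \<alpha> \<beta>) (fst p))) * pmonom (image_mset Inr (weight (diagram \<beta>) (snd p))))"
    by (simp add: spoly_def sum_product sum.cartesian_product case_prod_unfold)
  also have "\<dots> = (\<Sum>z\<in>?Z. pmonom (image_mset Inl (weight (skew \<alpha> (fst z)) (fst (snd z)))) *
      pmonom (image_mset Inr (weight (diagram (fst z)) (snd (snd z)))))"
    using finite_subpartitions[of \<alpha>] fin by (subst sum.Sigma) (simp_all add: case_prod_unfold)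
  also have "\<dots> = (\<Sum>T\<in>sst (n + n) ?D. pmonom (image_mset (merge_vars n) (weight ?D T)))"
  proof (rule sum.reindex_bij_witness[where i = split and j = join])
    fix z assume "z \<in> ?Z"
    then obtain \<beta> T1 T2 where z: "z = (\<beta>, T1, T2)" "diagram \<beta> \<subseteq> ?D" "T1 \<in> sst n (skew \<alpha> \<beta>)" "T2 \<in> sst n (diagram \<beta>)"
      by auto
    show "split (join z) = z" "join z \<in> sst (n + n) ?D"
      "pmonom (image_mset (merge_vars n) (weight ?D (join z))) =
        pmonom (image_mset Inl (weight (skew \<alpha> (fst z)) (fst (snd z)))) *
        pmonom (image_mset Inr (weight (diagram (fst z)) (snd (snd z))))"
      unfolding z(1) using join_split[OF z(2-4)] join_mem[OF z(2-4)] join_mono[OF z(2-4)] by simp_all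
  qed (use split_mem split_join in blast)+
  finally show ?thesis by (simp add: spoly_def)
qed


section \<open>Integral bases and coordinates\<close>

definition independent_family :: "('i \<Rightarrow> 'v pser) \<Rightarrow> bool" where
  "independent_family b \<longleftrightarrow> (\<forall>A c. finite A \<longrightarrow> (\<Sum>i\<in>A. of_int (c i) * b i) = 0 \<longrightarrow> (\<forall>i\<in>A. c i = 0))"

definition in_span :: "('i \<Rightarrow> 'v pser) \<Rightarrow> 'v pser \<Rightarrow> bool" where
  "in_span b f \<longleftrightarrow> (\<exists>A c. finite A \<and> f = (\<Sum>i\<in>A. of_int (c i) * b i))"

lemma independent_familyD:
  "independent_family b \<Longrightarrow> finite A \<Longrightarrow> (\<Sum>i\<in>A. of_int (c i) * b i) = 0 \<Longrightarrow> i \<in> A \<Longrightarrow> c i = 0"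
  unfolding independent_family_def by blast

lemma sum_support:
  fixes b :: "'i \<Rightarrow> 'v pser"
  assumes "finite A" "{i. c i \<noteq> 0} \<subseteq> A"
  shows "(\<Sum>i | c i \<noteq> 0. of_int (c i) * b i) = (\<Sum>i\<in>A. of_int (c i) * b i)"
  using assms by (intro sum.mono_neutral_left) auto

lemma coordinates_eqI:
  assumes ind: "independent_family b" and c: "finite {i. c i \<noteq> 0}" "f = (\<Sum>i | c i \<noteq> 0. of_int (c i) * b i)"
  shows "coordinates b f = c"
  unfolding coordinates_def
proof (rule the_equality)
  fix d assume d: "finite {i. d i \<noteq> 0} \<and> f = (\<Sum>i | d i \<noteq> 0. of_int (d i) * b i)"
  let ?A = "{i. c i \<noteq> 0} \<union> {i. d i \<noteq> 0}"
  have fin: "finite ?A" using c d by simp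
  have "(\<Sum>i\<in>?A. of_int (d i - c i) * b i) = (\<Sum>i\<in>?A. of_int (d i) * b i) - (\<Sum>i\<in>?A. of_int (c i) * b i)"
    by (simp add: left_diff_distrib sum_subtractf)
  also have "(\<Sum>i\<in>?A. of_int (d i) * b i) = f"
    using trans[OF conjunct2[OF d] sum_support[OF fin Un_upper2]] by (rule sym)
  also have "(\<Sum>i\<in>?A. of_int (c i) * b i) = f"
    using trans[OF c(2) sum_support[OF fin Un_upper1]] by (rule sym)
  finally have z: "(\<Sum>i\<in>?A. of_int (d i - c i) * b i) = 0" by simp
  show "d = c"
  proof
    fix i
    show "d i = c i"
    proof (cases "i \<in> ?A")
      case True
      then show ?thesis using independent_familyD[OF ind fin z] by simp
    qed simp
  qed
qed (use c in simp)

lemma in_span_base: "in_span b (b i)"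
  unfolding in_span_def by (rule exI[of _ "{i}"], rule exI[of _ "\<lambda>_. 1"]) simp

lemma in_span_add:
  assumes "in_span b f" "in_span b g"
  shows "in_span b (f + g)"
proof -
  obtain A c where A: "finite A" "f = (\<Sum>i\<in>A. of_int (c i) * b i)" using assms(1) unfolding in_span_def by blast
  obtain B d where B: "finite B" "g = (\<Sum>i\<in>B. of_int (d i) * b i)" using assms(2) unfolding in_span_def by blast
  let ?c = "\<lambda>i. if i \<in> A then c i else 0" and ?d = "\<lambda>i. if i \<in> B then d i else 0"
  have "f = (\<Sum>i\<in>A \<union> B. of_int (?c i) * b i)"
    unfolding A(2) using A(1) B(1) by (intro sum.mono_neutral_cong_left) auto
  moreover have "g = (\<Sum>i\<in>A \<union> B. of_int (?d i) * b i)"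
    unfolding B(2) using A(1) B(1) by (intro sum.mono_neutral_cong_left) auto
  ultimately have "f + g = (\<Sum>i\<in>A \<union> B. of_int (?c i + ?d i) * b i)"
    unfolding of_int_add distrib_right sum.distrib by (rule arg_cong2[of _ _ _ _ "(+)"])
  with finite_UnI[OF A(1) B(1)] show ?thesis
    unfolding in_span_def by (intro exI[of _ "A \<union> B"] exI[of _ "\<lambda>i. ?c i + ?d i"] conjI)
qed

lemma in_span_0: "in_span b 0"
  unfolding in_span_def by (rule exI[of _ "{}"]) simp

lemma in_span_of_int_mult: "in_span b f \<Longrightarrow> in_span b (of_int k * f)"
proof -
  assume "in_span b f"
  then obtain A c where A: "finite A" "f = (\<Sum>i\<in>A. of_int (c i) * b i)" unfolding in_span_def by blast
  have "of_int k * f = (\<Sum>i\<in>A. of_int (k * c i) * b i)"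
    unfolding A(2) by (simp add: sum_distrib_left mult.assoc)
  with A(1) show ?thesis
    unfolding in_span_def by (intro exI[of _ A] exI[of _ "\<lambda>i. k * c i"] conjI)
qed

lemma in_span_sum: "(\<And>i. i \<in> A \<Longrightarrow> in_span b (f i)) \<Longrightarrow> in_span b (sum f A)"
  by (induction A rule: infinite_finite_induct) (simp_all add: in_span_0 in_span_add)

lemma in_span_diff: "in_span b f \<Longrightarrow> in_span b g \<Longrightarrow> in_span b (f - g)"
  using in_span_add[of b f "of_int (- 1) * g"] in_span_of_int_mult[of b g "- 1"] by simp

lemma in_span_trans: "in_span b f \<Longrightarrow> (\<And>i. in_span b' (b i)) \<Longrightarrow> in_span b' f"
proof -
  assume "in_span b f" and b: "\<And>i. in_span b' (b i)"
  then obtain A c where "f = (\<Sum>i\<in>A. of_int (c i) * b i)" unfolding in_span_def by blast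
  then show ?thesis by (simp only:) (intro in_span_sum in_span_of_int_mult b)
qed

lemma in_span_mult:
  assumes "in_span b f" "in_span b g" "\<And>i j. in_span b (b i * b j)"
  shows "in_span b (f * g)"
proof -
  obtain A c where A: "finite A" "f = (\<Sum>i\<in>A. of_int (c i) * b i)" using assms(1) unfolding in_span_def by blast
  obtain B d where B: "finite B" "g = (\<Sum>i\<in>B. of_int (d i) * b i)" using assms(2) unfolding in_span_def by blast
  have "f * g = (\<Sum>i\<in>A. \<Sum>j\<in>B. of_int (c i * d j) * (b i * b j))"
    unfolding A(2) B(2) sum_product by (simp add: mult_ac)
  then show ?thesis by (simp only:) (intro in_span_sum in_span_of_int_mult assms(3))
qed

text \<open>Among the indices with nonzero coefficient take one with least \<open>m\<close>: at its
  monomial no other member contributes. The key \<open>m\<close> is kept apart from \<open>M\<close>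
  so that monomials in two alphabets can be compared through one ordered quantity.\<close>

lemma independent_if_leading_monomials:
  fixes m :: "'i \<Rightarrow> 'o::linorder"
  assumes lead: "\<And>i. pcoeff (b i) (M i) \<noteq> 0"
    and least: "\<And>i j. pcoeff (b i) (M j) \<noteq> 0 \<Longrightarrow> m i \<le> m j" "\<And>i j. pcoeff (b i) (M j) \<noteq> 0 \<Longrightarrow> m i = m j \<Longrightarrow> i = j"
  shows "independent_family b"
  unfolding independent_family_def
proof (intro allI impI ballI)
  fix A c i assume A: "finite A" and z: "(\<Sum>i\<in>A. of_int (c i) * b i) = 0" and i: "i \<in> A"
  show "c i = 0"
  proof (rule ccontr)
    assume "c i \<noteq> 0"
    define B where "B = {i \<in> A. c i \<noteq> 0}"
    have B: "finite B" "i \<in> B" using A i \<open>c i \<noteq> 0\<close> by (simp_all add: B_def)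
    have "Min (m ` B) \<in> m ` B" using B by (intro Min_in) auto
    then obtain j where j: "j \<in> B" "Min (m ` B) = m j" by blast
    have jmin: "m j \<le> m k" if "k \<in> B" for k
      using B(1) that unfolding j(2)[symmetric] by (intro Min_le) auto
    have "c k * pcoeff (b k) (M j) = 0" if "k \<in> A - {j}" for k
    proof (rule ccontr)
      assume n: "c k * pcoeff (b k) (M j) \<noteq> 0"
      then have "k \<in> B" "pcoeff (b k) (M j) \<noteq> 0" using that by (simp_all add: B_def)
      then have "k = j" using least[of k j] jmin[of k] by simp
      with that show False by simp
    qed
    then have "(\<Sum>k\<in>A. c k * pcoeff (b k) (M j)) = (\<Sum>k\<in>{j}. c k * pcoeff (b k) (M j))"
      using A j by (intro sum.mono_neutral_right) (auto simp: B_def)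
    moreover have "(\<Sum>k\<in>A. c k * pcoeff (b k) (M j)) = 0"
      using arg_cong[OF z, of "\<lambda>f. pcoeff f (M j)"] by (simp add: pcoeff_sum)
    ultimately have "c j * pcoeff (b j) (M j) = 0" by simp
    with j lead[of j] show False by (simp add: B_def)
  qed
qed

section \<open>Linear independence of Schur functions\<close>

lemma image_mset_mono:
  fixes f g :: "'a \<Rightarrow> nat"
  assumes "\<And>x. x \<in># A \<Longrightarrow> f x \<le> g x"
  shows "image_mset f A \<le> image_mset g A"
  using assms
proof (induction A)
  case (add x A)
  have "f x \<le> g x" using add.prems[of x] by simp
  then have "{#f x#} \<le> {#g x#}" by auto
  moreover have "image_mset f A \<le> image_mset g A" using add.prems by (intro add.IH) simp
  ultimately have "{#f x#} + image_mset f A \<le> {#g x#} + image_mset g A" by (rule add_mono)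
  then show ?case by simp
qed simp

lemma image_mset_mono_eqD:
  fixes f g :: "'a \<Rightarrow> nat"
  assumes "\<And>x. x \<in># A \<Longrightarrow> f x \<le> g x" "image_mset f A = image_mset g A" "x \<in># A"
  shows "f x = g x"
proof (rule ccontr)
  assume "f x \<noteq> g x"
  with assms have "f x < g x" by (metis le_neq_implies_less)
  then have less: "{#f x#} < {#g x#}" by simp
  obtain B where B: "A = add_mset x B" using assms(3) by (meson multi_member_split)
  have "image_mset f B \<le> image_mset g B" using assms(1) by (intro image_mset_mono) (simp add: B)
  with less have "{#f x#} + image_mset f B < {#g x#} + image_mset g B" by (rule add_less_le_mono)
  with assms(2) show False by (simp add: B)
qed

lemma ssyt_row_le:
  assumes "T \<in> ssyt \<alpha>" "(p, q) \<in> diagram \<alpha>"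
  shows "p \<le> T (p, q)"
  using assms(2)
proof (induction p)
  case (Suc p)
  have "(p, q) \<in> diagram \<alpha>" using Suc.prems by (auto intro: diagram_closed)
  moreover from this have "T (p, q) < T (Suc p, q)"
    using assms(1) Suc.prems unfolding ssyt_def by auto
  ultimately show ?case using Suc.IH by simp
qed simp

lemma pcoeff_schur_inj:
  assumes "inj x"
  shows "pcoeff (schur x \<alpha>) (image_mset x M) = int (card {T \<in> ssyt \<alpha>. weight (diagram \<alpha>) T = M})"
proof -
  have "image_mset (\<lambda>c. x (T c)) (mset_set (diagram \<alpha>)) = image_mset x (weight (diagram \<alpha>) T)" for T
    by (simp add: weight_def multiset.map_comp comp_def)
  then have "image_mset (\<lambda>c. x (T c)) (mset_set (diagram \<alpha>)) = image_mset x M \<longleftrightarrow> weight (diagram \<alpha>) T = M" for T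
    by (simp only: inj_eq[OF multiset.inj_map[OF assms]])
  then show ?thesis by (simp add: schur_def)
qed

lemma pcoeff_schur_range:
  assumes "pcoeff (schur x \<alpha>) M \<noteq> 0"
  shows "set_mset M \<subseteq> range x"
proof -
  have "{T \<in> ssyt \<alpha>. image_mset (\<lambda>c. x (T c)) (mset_set (diagram \<alpha>)) = M} \<noteq> {}"
    using assms by (auto simp: schur_def simp del: Collect_empty_eq)
  then show ?thesis by auto
qed

lemma row_tableau_ssyt: "row_tableau \<alpha> \<in> ssyt \<alpha>"
  by (simp add: ssyt_def row_tableau_def)

text \<open>Every entry is at least its row index, so \<open>row_tableau\<close> has the least
  weight in the multiset order and is the only tableau attaining it.\<close>

lemma pcoeff_schur_least:
  assumes "inj x"
  shows "pcoeff (schur x \<alpha>) (image_mset x (shape_content \<alpha>)) = 1"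
    and "pcoeff (schur x \<alpha>) (image_mset x M) \<noteq> 0 \<Longrightarrow> shape_content \<alpha> \<le> M"
proof -
  have le: "row c \<le> T c" if "T \<in> ssyt \<alpha>" "c \<in># mset_set (diagram \<alpha>)" for T c
    using ssyt_row_le[OF that(1), of "row c" "col c"] that(2) finite_diagram[of \<alpha>] by simp
  have "T = row_tableau \<alpha>" if T: "T \<in> ssyt \<alpha>" "weight (diagram \<alpha>) T = shape_content \<alpha>" for T
  proof
    fix c
    show "T c = row_tableau \<alpha> c"
    proof (cases "c \<in> diagram \<alpha>")
      case True
      have "image_mset row (mset_set (diagram \<alpha>)) = image_mset T (mset_set (diagram \<alpha>))"
        using T(2) by (simp add: weight_def shape_content_def)
      from image_mset_mono_eqD[OF le[OF T(1)] this] True finite_diagram[of \<alpha>]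
      show ?thesis by (simp add: row_tableau_def)
    next
      case False
      have "T c = 0" using T(1) False unfolding ssyt_def by blast
      with False show ?thesis by (simp add: row_tableau_def)
    qed
  qed
  then have "{T \<in> ssyt \<alpha>. weight (diagram \<alpha>) T = shape_content \<alpha>} = {row_tableau \<alpha>}"
    using row_tableau_ssyt weight_row_tableau by blast
  then show "pcoeff (schur x \<alpha>) (image_mset x (shape_content \<alpha>)) = 1"
    by (simp add: pcoeff_schur_inj[OF assms])
  show "shape_content \<alpha> \<le> M" if "pcoeff (schur x \<alpha>) (image_mset x M) \<noteq> 0"
  proof -
    have "{T \<in> ssyt \<alpha>. weight (diagram \<alpha>) T = M} \<noteq> {}"
      using that by (auto simp: pcoeff_schur_inj[OF assms] simp del: Collect_empty_eq)
    then obtain T where "T \<in> ssyt \<alpha>" "weight (diagram \<alpha>) T = M" by blast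
    then show ?thesis using image_mset_mono[OF le] by (auto simp: weight_def shape_content_def)
  qed
qed

lemma independent_schur: "independent_family (schur (\<lambda>i. i))"
proof (rule independent_if_leading_monomials[where M = shape_content and m = shape_content])
  show "pcoeff (schur (\<lambda>i. i) \<alpha>) (shape_content \<alpha>) \<noteq> 0" for \<alpha>
    using pcoeff_schur_least(1)[of "\<lambda>i. i" \<alpha>] by simp
  show "shape_content \<alpha> \<le> shape_content \<beta>" if "pcoeff (schur (\<lambda>i. i) \<alpha>) (shape_content \<beta>) \<noteq> 0" for \<alpha> \<beta>
    using pcoeff_schur_least(2)[of "\<lambda>i. i" \<alpha> "shape_content \<beta>"] that by simp
qed (rule shape_content_inj)

text \<open>The two factors use disjoint alphabets, so only the splitting of the monomial by
  alphabet can contribute.\<close>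

lemma pcoeff_schur2:
  "pcoeff (schur2 (\<alpha>, \<beta>)) (image_mset Inl A + image_mset Inr B) =
    pcoeff (schur Inl \<alpha> :: (nat + nat) pser) (image_mset Inl A) *
    pcoeff (schur Inr \<beta> :: (nat + nat) pser) (image_mset Inr B)"
proof -
  let ?l = "image_mset Inl A :: (nat + nat) multiset" and ?r = "image_mset Inr B :: (nat + nat) multiset"
  have "pcoeff (schur2 (\<alpha>, \<beta>)) (?l + ?r) =
      (\<Sum>(P, Q)\<in>{(?l, ?r)}. pcoeff (schur Inl \<alpha>) P * pcoeff (schur Inr \<beta>) Q)"
    unfolding schur2.simps pcoeff_mult
  proof (rule sum.mono_neutral_right)
    show "\<forall>z\<in>{(P, Q). P + Q = ?l + ?r} - {(?l, ?r)}. (case z of (P, Q) \<Rightarrow> pcoeff (schur Inl \<alpha>) P * pcoeff (schur Inr \<beta>) Q) = 0"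
    proof
      fix z assume z: "z \<in> {(P, Q). P + Q = ?l + ?r} - {(?l, ?r)}"
      obtain P Q where PQ: "z = (P, Q)" by (cases z)
      have eq: "P + Q = ?l + ?r" and ne: "(P, Q) \<noteq> (?l, ?r)" using z unfolding PQ by blast+
      show "(case z of (P, Q) \<Rightarrow> pcoeff (schur Inl \<alpha>) P * pcoeff (schur Inr \<beta>) Q) = 0"
        unfolding PQ case_prod_conv
      proof (rule ccontr)
        assume "pcoeff (schur Inl \<alpha>) P * pcoeff (schur Inr \<beta>) Q \<noteq> 0"
        then have "set_mset P \<subseteq> range Inl" "set_mset Q \<subseteq> range Inr"
          using pcoeff_schur_range by force+
        then have "\<forall>v\<in>#P. isl v" "\<forall>v\<in>#Q. \<not> isl v" by auto
        then have "filter_mset isl (P + Q) = P" "filter_mset (\<lambda>v. \<not> isl v) (P + Q) = Q"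
          unfolding filter_mset_eq_conv by simp_all
        moreover have "filter_mset isl (?l + ?r) = ?l" "filter_mset (\<lambda>v. \<not> isl v) (?l + ?r) = ?r"
          unfolding filter_mset_eq_conv by auto
        ultimately show False using eq ne by simp
      qed
    qed
  qed (auto simp: finite_splits)
  then show ?thesis by simp
qed

text \<open>Vertices are compared by the sum of their two contents. A contributing monomial bounds
  each content separately, so equal sums force both contents to agree.\<close>

lemma independent_schur2: "independent_family schur2"
proof (rule independent_if_leading_monomials
    [where M = "\<lambda>(\<alpha>, \<beta>). image_mset Inl (shape_content \<alpha>) + image_mset Inr (shape_content \<beta>)"
       and m = "\<lambda>(\<alpha>, \<beta>). shape_content \<alpha> + shape_content \<beta>"])
  fix v w :: vertex
  obtain \<alpha> \<beta> \<gamma> \<delta> where vw: "v = (\<alpha>, \<beta>)" "w = (\<gamma>, \<delta>)" by (cases v; cases w)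
  let ?M = "\<lambda>(\<alpha>, \<beta>). image_mset Inl (shape_content \<alpha>) + image_mset Inr (shape_content \<beta>)"
  let ?m = "\<lambda>(\<alpha>, \<beta>). shape_content \<alpha> + shape_content \<beta>"
  show "pcoeff (schur2 v) (?M v) \<noteq> 0"
    unfolding vw case_prod_conv pcoeff_schur2 pcoeff_schur_least(1)[OF inj_Inl] pcoeff_schur_least(1)[OF inj_Inr]
    by simp
  have le: "shape_content \<alpha> \<le> shape_content \<gamma>" "shape_content \<beta> \<le> shape_content \<delta>"
    if "pcoeff (schur2 v) (?M w) \<noteq> 0"
  proof -
    have "pcoeff (schur Inl \<alpha> :: (nat + nat) pser) (image_mset Inl (shape_content \<gamma>)) \<noteq> 0"
        "pcoeff (schur Inr \<beta> :: (nat + nat) pser) (image_mset Inr (shape_content \<delta>)) \<noteq> 0"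
      using that unfolding vw case_prod_conv pcoeff_schur2 by auto
    then show "shape_content \<alpha> \<le> shape_content \<gamma>" "shape_content \<beta> \<le> shape_content \<delta>"
      using pcoeff_schur_least(2)[OF inj_Inl] pcoeff_schur_least(2)[OF inj_Inr] by blast+
  qed
  show "?m v \<le> ?m w" if "pcoeff (schur2 v) (?M w) \<noteq> 0"
    using le[OF that] unfolding vw by (simp add: add_mono)
  show "v = w" if "pcoeff (schur2 v) (?M w) \<noteq> 0" "?m v = ?m w"
  proof -
    have "shape_content \<alpha> = shape_content \<gamma>" "shape_content \<beta> = shape_content \<delta>"
      using le[OF that(1)] that(2) unfolding vw case_prod_conv
      by (metis add_less_le_mono add_le_less_mono less_irrefl order_le_less)+
    then show ?thesis using shape_content_inj vw by blast
  qed
qed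


section \<open>Littlewood--Richardson coefficients\<close>

definition both_vars :: "nat \<Rightarrow> (nat + nat) set" where
  "both_vars n = Inl ` {..<n} \<union> Inr ` {..<n}"

lemma finite_both_vars: "finite (both_vars n)"
  by (simp add: both_vars_def)

lemma mono_both_vars: "mono both_vars"
  unfolding both_vars_def by (rule monoI) auto

lemma Union_both_vars: "(\<Union>n. both_vars n) = UNIV"
proof (intro equalityI subset_UNIV subsetI)
  fix v :: "nat + nat"
  show "v \<in> (\<Union>n. both_vars n)"
  proof (cases v)
    case (Inl i)
    then have "v \<in> both_vars (Suc i)" by (simp add: both_vars_def)
    then show ?thesis by blast
  next
    case (Inr i)
    then have "v \<in> both_vars (Suc i)" by (simp add: both_vars_def)
    then show ?thesis by blast
  qed
qed

lemma both_vars_Inl: "{t. Inl t \<in> both_vars n} = {..<n}"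
  and both_vars_Inr: "{t. Inr t \<in> both_vars n} = {..<n}"
  by (auto simp: both_vars_def)

text \<open>An explicit, finitely supported count, whereas \<open>lr_coeff\<close> is defined by
  unique coordinates. Independence of the Schur functions identifies the two in
  \<open>lr_coeff_eq_lr\<close>.\<close>

definition lr :: "partition \<Rightarrow> partition \<Rightarrow> partition \<Rightarrow> int" where
  "lr \<mu> \<nu> \<gamma> = (if \<gamma> \<in> outer \<mu> (card (diagram \<nu>)) then int (card (RW (skew \<gamma> \<mu>) (diagram \<nu>))) else 0)"

lemma finite_lr: "finite {\<gamma>. lr \<mu> \<nu> \<gamma> \<noteq> 0}"
  by (rule finite_subset[OF _ finite_outer[of \<mu> "card (diagram \<nu>)"]]) (auto simp: lr_def)

lemma sum_lr:
  fixes f :: "partition \<Rightarrow> 'v pser"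
  shows "(\<Sum>\<gamma>\<in>outer \<mu> (card (diagram \<nu>)). of_nat (card (RW (skew \<gamma> \<mu>) (diagram \<nu>))) * f \<gamma>) =
    (\<Sum>\<gamma> | lr \<mu> \<nu> \<gamma> \<noteq> 0. of_int (lr \<mu> \<nu> \<gamma>) * f \<gamma>)"
proof -
  have "{\<gamma>. lr \<mu> \<nu> \<gamma> \<noteq> 0} \<subseteq> outer \<mu> (card (diagram \<nu>))" by (auto simp: lr_def)
  then have "(\<Sum>\<gamma> | lr \<mu> \<nu> \<gamma> \<noteq> 0. of_int (lr \<mu> \<nu> \<gamma>) * f \<gamma>) =
      (\<Sum>\<gamma>\<in>outer \<mu> (card (diagram \<nu>)). of_int (lr \<mu> \<nu> \<gamma>) * f \<gamma>)"
    by (rule sum_support[OF finite_outer])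
  also have "\<dots> = (\<Sum>\<gamma>\<in>outer \<mu> (card (diagram \<nu>)). of_nat (card (RW (skew \<gamma> \<mu>) (diagram \<nu>))) * f \<gamma>)"
    by (rule sum.cong) (simp_all add: lr_def)
  finally show ?thesis by (rule sym)
qed

lemma schur_mult_lr:
  shows "schur (\<lambda>i. i) \<mu> * schur (\<lambda>i. i) \<nu> = (\<Sum>\<gamma> | lr \<mu> \<nu> \<gamma> \<noteq> 0. of_int (lr \<mu> \<nu> \<gamma>) * schur (\<lambda>i. i) \<gamma>)"
    and "schur Inl \<mu> * schur Inl \<nu> = (\<Sum>\<gamma> | lr \<mu> \<nu> \<gamma> \<noteq> 0. of_int (lr \<mu> \<nu> \<gamma>) * schur (Inl :: nat \<Rightarrow> nat + nat) \<gamma>)"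
    and "schur Inr \<mu> * schur Inr \<nu> = (\<Sum>\<gamma> | lr \<mu> \<nu> \<gamma> \<noteq> 0. of_int (lr \<mu> \<nu> \<gamma>) * schur (Inr :: nat \<Rightarrow> nat + nat) \<gamma>)"
proof -
  have "mono (lessThan :: nat \<Rightarrow> nat set)" "(\<Union>n. {..<n}) = (UNIV :: nat set)" "\<And>n::nat. {t. t \<in> {..<n}} = {..<n}"
    by (auto intro: monoI)
  from schur_mult_RW[of lessThan "\<lambda>i. i", OF finite_lessThan this]
  show "schur (\<lambda>i. i) \<mu> * schur (\<lambda>i. i) \<nu> = (\<Sum>\<gamma> | lr \<mu> \<nu> \<gamma> \<noteq> 0. of_int (lr \<mu> \<nu> \<gamma>) * schur (\<lambda>i. i) \<gamma>)"
    unfolding sum_lr .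
  note both = finite_both_vars mono_both_vars Union_both_vars
  show "schur Inl \<mu> * schur Inl \<nu> = (\<Sum>\<gamma> | lr \<mu> \<nu> \<gamma> \<noteq> 0. of_int (lr \<mu> \<nu> \<gamma>) * schur (Inl :: nat \<Rightarrow> nat + nat) \<gamma>)"
    using schur_mult_RW[OF both both_vars_Inl] unfolding sum_lr .
  show "schur Inr \<mu> * schur Inr \<nu> = (\<Sum>\<gamma> | lr \<mu> \<nu> \<gamma> \<noteq> 0. of_int (lr \<mu> \<nu> \<gamma>) * schur (Inr :: nat \<Rightarrow> nat + nat) \<gamma>)"
    using schur_mult_RW[OF both both_vars_Inr] unfolding sum_lr .
qed

lemma lr_coeff_eq_lr: "lr_coeff \<mu> \<nu> = lr \<mu> \<nu>"
  unfolding lr_coeff_def structure_const_def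
  by (rule ext) (simp only: coordinates_eqI[OF independent_schur finite_lr schur_mult_lr(1)])

definition lr2 :: "vertex \<Rightarrow> vertex \<Rightarrow> vertex \<Rightarrow> int" where
  "lr2 u v w = lr_coeff (fst u) (fst v) (fst w) * lr_coeff (snd u) (snd v) (snd w)"

lemma lr2_support:
  "{w. lr2 u v w \<noteq> 0} = {\<gamma>. lr (fst u) (fst v) \<gamma> \<noteq> 0} \<times> {\<gamma>. lr (snd u) (snd v) \<gamma> \<noteq> 0}"
  by (auto simp: lr2_def lr_coeff_eq_lr)

lemma finite_lr2: "finite {w. lr2 u v w \<noteq> 0}"
  unfolding lr2_support using finite_lr by simp

lemma schur2_mult: "schur2 u * schur2 v = (\<Sum>w | lr2 u v w \<noteq> 0. of_int (lr2 u v w) * schur2 w)"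
proof -
  obtain \<alpha> \<beta> \<mu> \<nu> where uv: "u = (\<alpha>, \<beta>)" "v = (\<mu>, \<nu>)" by (cases u; cases v)
  have "schur2 u * schur2 v = (schur Inl \<alpha> * schur Inl \<mu>) * (schur Inr \<beta> * schur Inr \<nu>)"
    unfolding uv schur2.simps by (simp only: mult_ac)
  also have "\<dots> = (\<Sum>\<gamma> | lr \<alpha> \<mu> \<gamma> \<noteq> 0. \<Sum>\<delta> | lr \<beta> \<nu> \<delta> \<noteq> 0. of_int (lr2 u v (\<gamma>, \<delta>)) * schur2 (\<gamma>, \<delta>))"
    unfolding schur_mult_lr sum_product uv lr2_def lr_coeff_eq_lr fst_conv snd_conv of_int_mult schur2.simps
    by (simp only: mult_ac)
  also have "\<dots> = (\<Sum>w | lr2 u v w \<noteq> 0. of_int (lr2 u v w) * schur2 w)"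
    unfolding lr2_support uv fst_conv snd_conv by (simp only: sum.cartesian_product) (simp only: case_prod_unfold prod.collapse)
  finally show ?thesis .
qed

section \<open>The change of variables underlying the Remmel--Whitney basis\<close>

text \<open>The ring homomorphism \<open>f(x, y) \<mapsto> f(x; y, x)\<close>, truncated to \<open>n\<close> variables of either kind.\<close>

definition double_vars :: "nat \<Rightarrow> (nat + nat) pser \<Rightarrow> (nat + nat) pser" where
  "double_vars n = psubst (Inl ` {..<n} \<union> Inr ` {..<n + n}) (case_sum Inl (merge_vars n))"

abbreviation restrict_vars :: "nat \<Rightarrow> (nat + nat) pser \<Rightarrow> (nat + nat) pser" where
  "restrict_vars n \<equiv> psubst (both_vars n) id"

lemma restrict_schur2: "restrict_vars n (schur2 (\<alpha>, \<beta>)) = spoly n Inl (diagram \<alpha>) * spoly n Inr (diagram \<beta>)"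
  using psubst_schur[OF finite_both_vars both_vars_Inl, of n id \<alpha>] psubst_schur[OF finite_both_vars both_vars_Inr, of n id \<beta>]
  by (simp add: psubst_mult[OF finite_both_vars])

text \<open>Twice as many variables y as x are kept because \<open>merge_vars n\<close> distributes
  them over both alphabets, \<open>n\<close> each.\<close>

lemma double_schur2:
  "double_vars n (schur2 (\<alpha>, \<beta>)) = spoly n Inl (diagram \<alpha>) * spoly (n + n) (merge_vars n) (diagram \<beta>)"
proof -
  let ?D = "Inl ` {..<n} \<union> Inr ` {..<n + n} :: (nat + nat) set"
  have fin: "finite ?D" by simp
  have "{t. Inl t \<in> ?D} = {..<n}" "{t. Inr t \<in> ?D} = {..<n + n}" by auto
  from psubst_schur[OF fin this(1), of "case_sum Inl (merge_vars n)" \<alpha>]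
    psubst_schur[OF fin this(2), of "case_sum Inl (merge_vars n)" \<beta>]
  show ?thesis by (simp add: double_vars_def psubst_mult[OF fin])
qed

text \<open>Constant along arrows, so one truncation bound serves a vertex and everything reachable
  from it.\<close>

definition vsize :: "vertex \<Rightarrow> nat" where
  "vsize v = card (diagram (fst v)) + card (diagram (snd v))"

lemma vsize_target: "a \<in> Arr v \<Longrightarrow> vsize (target a) = vsize v"
  by (cases v) (auto elim!: arrow_facts simp: vsize_def target_def)

lemma RW_empty: "RW {} {} = {\<lambda>_. 0}"
  by (auto simp: RW_def standard_tableaux_def bij_betw_def)

text \<open>The summand \<open>f (\<alpha>, \<beta>)\<close> stands for the excluded loop, the single tableau of \<open>RW {} {}\<close>.\<close>

lemma sum_Arr:
  fixes f :: "vertex \<Rightarrow> 'v pser"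
  shows "f (\<alpha>, \<beta>) + (\<Sum>a\<in>Arr (\<alpha>, \<beta>). f (target a)) =
    (\<Sum>\<delta> | diagram \<delta> \<subseteq> diagram \<beta>. \<Sum>\<gamma>\<in>outer \<alpha> (card (skew \<beta> \<delta>)).
       of_nat (card (RW (skew \<gamma> \<alpha>) (skew \<beta> \<delta>))) * f (\<gamma>, \<delta>))"
proof -
  let ?v = "(\<alpha>, \<beta>)"
  \<comment> \<open>Pairs are swapped, with \<delta> first, because the range of \<gamma> depends on
    \<delta>.\<close>
  define P where "P = (SIGMA \<delta>:{\<delta>. diagram \<delta> \<subseteq> diagram \<beta>}. outer \<alpha> (card (skew \<beta> \<delta>)))"
  define g where "g u = of_nat (card (RW (skew (fst u) \<alpha>) (skew \<beta> (snd u)))) * f u" for u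
  have finP: "finite P" unfolding P_def using finite_subpartitions finite_outer by blast
  have sk: "skew \<gamma> \<gamma> = {}" for \<gamma> by (simp add: skew_def)
  have vP: "(\<beta>, \<alpha>) \<in> P" by (simp add: P_def outer_def sk)
  have gv: "g ?v = f ?v" by (simp add: g_def sk RW_empty)
  have img: "(\<lambda>a. prod.swap (target a)) ` Arr ?v \<subseteq> P - {(\<beta>, \<alpha>)}"
  proof (rule image_subsetI)
    fix a assume "a \<in> Arr ?v"
    then show "prod.swap (target a) \<in> P - {(\<beta>, \<alpha>)}"
    proof (rule arrow_facts)
      fix \<gamma> \<delta> T
      assume a: "a = (?v, (\<gamma>, \<delta>), T)" and sub: "diagram \<alpha> \<subseteq> diagram \<gamma>" "diagram \<delta> \<subseteq> diagram \<beta>"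
        and "card (diagram \<delta>) < card (diagram \<beta>)"
        and "card (diagram \<gamma>) + card (diagram \<delta>) = card (diagram \<alpha>) + card (diagram \<beta>)"
      then show "prod.swap (target a) \<in> P - {(\<beta>, \<alpha>)}"
        by (auto simp: target_def P_def outer_def skew_def card_Diff_subset finite_diagram)
    qed
  qed
  have fib: "(\<Sum>a\<in>{a \<in> Arr ?v. prod.swap (target a) = (\<delta>, \<gamma>)}. f (target a)) = g (\<gamma>, \<delta>)"
    if "(\<delta>, \<gamma>) \<in> P - {(\<beta>, \<alpha>)}" for \<gamma> \<delta>
  proof -
    have "{a \<in> Arr ?v. prod.swap (target a) = (\<delta>, \<gamma>)} = (\<lambda>T. (?v, (\<gamma>, \<delta>), T)) ` RW (skew \<gamma> \<alpha>) (skew \<beta> \<delta>)"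
      using that by (auto simp: Arr_def arrows_def source_def target_def P_def outer_def)
    then have "card {a \<in> Arr ?v. prod.swap (target a) = (\<delta>, \<gamma>)} = card (RW (skew \<gamma> \<alpha>) (skew \<beta> \<delta>))"
      by (simp add: card_image inj_on_def)
    moreover have "(\<Sum>a\<in>{a \<in> Arr ?v. prod.swap (target a) = (\<delta>, \<gamma>)}. f (target a)) =
        (\<Sum>a\<in>{a \<in> Arr ?v. prod.swap (target a) = (\<delta>, \<gamma>)}. f (\<gamma>, \<delta>))"
      by (rule sum.cong) (auto simp: prod_eq_iff)
    ultimately show ?thesis by (simp add: g_def)
  qed
  have "(\<Sum>a\<in>Arr ?v. f (target a)) = (\<Sum>p\<in>P - {(\<beta>, \<alpha>)}. \<Sum>a\<in>{a \<in> Arr ?v. prod.swap (target a) = p}. f (target a))"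
    using finP by (intro sum.group[symmetric, OF finite_Arr _ img]) simp
  also have "\<dots> = (\<Sum>p\<in>P - {(\<beta>, \<alpha>)}. g (prod.swap p))"
  proof (rule sum.cong)
    fix p assume p: "p \<in> P - {(\<beta>, \<alpha>)}"
    obtain \<delta> \<gamma> where [simp]: "p = (\<delta>, \<gamma>)" by (cases p)
    show "(\<Sum>a\<in>{a \<in> Arr ?v. prod.swap (target a) = p}. f (target a)) = g (prod.swap p)"
      using fib[of \<delta> \<gamma>] p by simp
  qed simp
  also have "f ?v + \<dots> = (\<Sum>p\<in>P. g (prod.swap p))"
    using finP vP gv by (simp add: sum.remove)
  also have "\<dots> = (\<Sum>\<delta> | diagram \<delta> \<subseteq> diagram \<beta>. \<Sum>\<gamma>\<in>outer \<alpha> (card (skew \<beta> \<delta>)). g (\<gamma>, \<delta>))"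
    unfolding P_def using finite_subpartitions finite_outer by (subst sum.Sigma) (auto simp: case_prod_unfold prod.swap_def)
  finally show ?thesis by (simp only: g_def fst_conv snd_conv)
qed

lemma double_schur2_expansion:
  assumes n: "vsize v \<le> n"
  shows "double_vars n (schur2 v) = restrict_vars n (schur2 v) + (\<Sum>a\<in>Arr v. restrict_vars n (schur2 (target a)))"
proof -
  obtain \<alpha> \<beta> where v: "v = (\<alpha>, \<beta>)" by (cases v)
  have "spoly n Inl (diagram \<alpha>) * spoly n Inl (skew \<beta> \<delta>) =
      (\<Sum>\<gamma>\<in>outer \<alpha> (card (skew \<beta> \<delta>)). of_nat (card (RW (skew \<gamma> \<alpha>) (skew \<beta> \<delta>))) * spoly n Inl (diagram \<gamma>) :: (nat + nat) pser)"
    for \<delta>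
  proof (rule spoly_mult_RW[OF finite_skew convex_skew])
    have "card (skew \<beta> \<delta>) \<le> card (diagram \<beta>)"
      unfolding skew_def by (intro card_mono finite_diagram) auto
    then show "card (diagram \<alpha>) + card (skew \<beta> \<delta>) \<le> n" using n by (simp add: v vsize_def)
  qed
  then have "double_vars n (schur2 v) = (\<Sum>\<delta> | diagram \<delta> \<subseteq> diagram \<beta>. \<Sum>\<gamma>\<in>outer \<alpha> (card (skew \<beta> \<delta>)).
      of_nat (card (RW (skew \<gamma> \<alpha>) (skew \<beta> \<delta>))) * restrict_vars n (schur2 (\<gamma>, \<delta>)))"
    unfolding v double_schur2 spoly_coproduct restrict_schur2
    by (simp only: sum_distrib_left mult.assoc[symmetric]) (simp only: sum_distrib_right)
  then show ?thesis unfolding v sum_Arr[symmetric, where f = "\<lambda>u. restrict_vars n (schur2 u)"] .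
qed

text \<open>The arrow sum subtracted in the recursion is, by induction, sent to exactly the extra
  terms of \<open>double_schur2_expansion\<close>.\<close>

lemma double_rw_basis:
  assumes "vsize v \<le> n"
  shows "double_vars n (rw_basis v) = restrict_vars n (schur2 v)"
  using assms
proof (induction v rule: rw_basis.induct)
  case (1 v)
  have "double_vars n (rw_basis v) = double_vars n (schur2 v) - (\<Sum>a\<in>Arr v. double_vars n (rw_basis (target a)))"
    unfolding rw_basis.simps[of v] double_vars_def by (simp only: psubst_diff psubst_sum)
  also have "(\<Sum>a\<in>Arr v. double_vars n (rw_basis (target a))) = (\<Sum>a\<in>Arr v. restrict_vars n (schur2 (target a)))"
  proof (rule sum.cong)
    fix a assume a: "a \<in> Arr v"
    show "double_vars n (rw_basis (target a)) = restrict_vars n (schur2 (target a))"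
      by (rule 1(1)[OF a]) (simp only: vsize_target[OF a] 1(2))
  qed simp
  finally have "double_vars n (rw_basis v) = restrict_vars n (schur2 v)"
    using double_schur2_expansion[OF 1(2)] by simp
  then show ?case by (simp only: id_def)
qed

lemma schur2_eq_sum_rw_basis: "schur2 v = rw_basis v + (\<Sum>a\<in>Arr v. rw_basis (target a))"
  unfolding rw_basis.simps[of v] by simp

lemma in_span_rw_basis: "in_span schur2 (rw_basis v)"
proof (induction v rule: rw_basis.induct)
  case (1 v)
  then show ?case
    unfolding rw_basis.simps[of v] by (intro in_span_diff in_span_base in_span_sum)
qed

text \<open>The two families span each other over the integers, and the span of the products of
  Schur functions is closed under multiplication. This gives an expansion whose coefficients are
  still unknown.\<close>

lemma in_span_rw_basis_mult: "in_span rw_basis (rw_basis u * rw_basis v)"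
proof (rule in_span_trans)
  have "in_span schur2 (schur2 u * schur2 v)" for u v
    unfolding schur2_mult by (intro in_span_sum in_span_of_int_mult in_span_base)
  then show "in_span schur2 (rw_basis u * rw_basis v)"
    by (rule in_span_mult[OF in_span_rw_basis in_span_rw_basis])
  show "in_span rw_basis (schur2 w)" for w
    unfolding schur2_eq_sum_rw_basis by (intro in_span_add in_span_base in_span_sum)
qed

text \<open>A single homomorphism sends each member to its Schur product once \<open>n\<close>
  bounds the finitely many sizes involved; letting \<open>n\<close> grow removes the
  truncation.\<close>

lemma rw_basis_relation:
  assumes A: "finite A" and eq: "rw_basis u * rw_basis v = (\<Sum>w\<in>A. of_int (c w) * rw_basis w)"
  shows "schur2 u * schur2 v = (\<Sum>w\<in>A. of_int (c w) * schur2 w)"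
proof (rule pser_eq_if_restrictions_eq[OF _ mono_both_vars Union_both_vars])
  fix n assume n: "n \<ge> vsize u + vsize v + (\<Sum>w\<in>A. vsize w)"
  have le: "vsize w \<le> n" if "w \<in> A" for w
    using n member_le_sum[OF that, of vsize] A by simp
  have "restrict_vars n (schur2 u * schur2 v) = double_vars n (rw_basis u * rw_basis v)"
    using n by (simp add: psubst_mult[OF finite_both_vars] double_rw_basis[symmetric])
      (simp add: double_vars_def psubst_mult)
  also have "\<dots> = (\<Sum>w\<in>A. of_int (c w) * double_vars n (rw_basis w))"
    unfolding eq double_vars_def by (simp only: psubst_sum psubst_of_int_mult)
  also have "\<dots> = restrict_vars n (\<Sum>w\<in>A. of_int (c w) * schur2 w)"
    using le by (simp add: psubst_sum psubst_of_int_mult double_rw_basis)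
  finally show "restrict_vars n (schur2 u * schur2 v) = restrict_vars n (\<Sum>w\<in>A. of_int (c w) * schur2 w)" .
qed

lemma independent_rw_basis: "independent_family rw_basis"
  unfolding independent_family_def
proof (intro allI impI)
  fix A and c :: "vertex \<Rightarrow> int" assume A: "finite A" and z: "(\<Sum>w\<in>A. of_int (c w) * rw_basis w) = 0"
  have "(\<Sum>w\<in>A. of_int (c w) * schur2 w) = 0"
  proof (rule pser_eq_if_restrictions_eq[OF _ mono_both_vars Union_both_vars])
    fix n assume n: "n \<ge> (\<Sum>w\<in>A. vsize w)"
    have le: "vsize w \<le> n" if "w \<in> A" for w
      using n member_le_sum[OF that, of vsize] A by simp
    have "restrict_vars n (\<Sum>w\<in>A. of_int (c w) * schur2 w) = (\<Sum>w\<in>A. of_int (c w) * double_vars n (rw_basis w))"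
      using le by (simp add: psubst_sum psubst_of_int_mult double_rw_basis)
    also have "\<dots> = double_vars n (\<Sum>w\<in>A. of_int (c w) * rw_basis w)"
      unfolding double_vars_def by (simp only: psubst_sum psubst_of_int_mult)
    finally show "restrict_vars n (\<Sum>w\<in>A. of_int (c w) * schur2 w) = restrict_vars n 0"
      by (simp only: z double_vars_def psubst_0)
  qed
  then show "\<forall>w\<in>A. c w = 0" using independent_familyD[OF independent_schur2 A] by blast
qed

text \<open>The unknown coefficients also expand the product of the corresponding
  \<open>schur2\<close> elements, where coordinates are unique, so they are products of
  Littlewood--Richardson coefficients.\<close>

lemma rw_basis_mult: "rw_basis u * rw_basis v = (\<Sum>w | lr2 u v w \<noteq> 0. of_int (lr2 u v w) * rw_basis w)"
proof -
  obtain A c where A: "finite A" and eq: "rw_basis u * rw_basis v = (\<Sum>w\<in>A. of_int (c w) * rw_basis w)"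
    using in_span_rw_basis_mult[of u v] unfolding in_span_def by blast
  define d where "d w = (if w \<in> A then c w else 0)" for w
  have supp: "{w. d w \<noteq> 0} \<subseteq> A" by (auto simp: d_def)
  then have fin: "finite {w. d w \<noteq> 0}" using A by (rule finite_subset)
  have d: "(\<Sum>w | d w \<noteq> 0. of_int (d w) * b w) = (\<Sum>w\<in>A. of_int (c w) * b w)"
    for b :: "vertex \<Rightarrow> (nat + nat) pser"
    unfolding sum_support[OF A supp] by (rule sum.cong) (simp_all add: d_def)
  have "schur2 u * schur2 v = (\<Sum>w | d w \<noteq> 0. of_int (d w) * schur2 w)"
    unfolding d by (rule rw_basis_relation[OF A eq])
  then have "coordinates schur2 (schur2 u * schur2 v) = d"
    by (rule coordinates_eqI[OF independent_schur2 fin])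
  moreover have "coordinates schur2 (schur2 u * schur2 v) = lr2 u v"
    by (rule coordinates_eqI[OF independent_schur2 finite_lr2 schur2_mult])
  ultimately have "d = lr2 u v" by simp
  then show ?thesis using eq d[of rw_basis] by simp
qed

theorem mainTheorem1:
  fixes lam1 lam2 mu1 mu2 :: partition
  shows "finite {(gam1, gam2). lr_coeff lam1 mu1 gam1 * lr_coeff lam2 mu2 gam2 \<noteq> 0} \<and>
    rw_basis (lam1, lam2) * rw_basis (mu1, mu2) =
      (\<Sum>(gam1, gam2) | lr_coeff lam1 mu1 gam1 * lr_coeff lam2 mu2 gam2 \<noteq> 0.
         of_int (lr_coeff lam1 mu1 gam1 * lr_coeff lam2 mu2 gam2) * rw_basis (gam1, gam2)) \<and>
    (\<forall>gam. structure_const rw_basis (lam1, lam2) (mu1, mu2) gam =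
           structure_const schur2 (lam1, lam2) (mu1, mu2) gam)"
proof -
  let ?l = "lr2 (lam1, lam2) (mu1, mu2)"
  have supp: "{(gam1, gam2). lr_coeff lam1 mu1 gam1 * lr_coeff lam2 mu2 gam2 \<noteq> 0} = {w. ?l w \<noteq> 0}"
    by (auto simp: lr2_def)
  have "(\<Sum>(gam1, gam2)\<in>{w. ?l w \<noteq> 0}. of_int (lr_coeff lam1 mu1 gam1 * lr_coeff lam2 mu2 gam2) * rw_basis (gam1, gam2)) =
      (\<Sum>w | ?l w \<noteq> 0. of_int (?l w) * rw_basis w)"
    by (rule sum.cong) (simp_all add: lr2_def case_prod_unfold)
  with rw_basis_mult have "rw_basis (lam1, lam2) * rw_basis (mu1, mu2) =
      (\<Sum>(gam1, gam2) | lr_coeff lam1 mu1 gam1 * lr_coeff lam2 mu2 gam2 \<noteq> 0.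
         of_int (lr_coeff lam1 mu1 gam1 * lr_coeff lam2 mu2 gam2) * rw_basis (gam1, gam2))"
    unfolding supp by (simp only:)
  moreover have "coordinates rw_basis (rw_basis (lam1, lam2) * rw_basis (mu1, mu2)) = ?l"
    by (rule coordinates_eqI[OF independent_rw_basis finite_lr2 rw_basis_mult])
  moreover have "coordinates schur2 (schur2 (lam1, lam2) * schur2 (mu1, mu2)) = ?l"
    by (rule coordinates_eqI[OF independent_schur2 finite_lr2 schur2_mult])
  ultimately show ?thesis
    unfolding structure_const_def supp using finite_lr2 by simp
qed

end
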